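(* For every $N\ge 1$ the image of the homomorphism $\tau_N\colon\mathcal D(\mathbf{gl}_n)\to\mathrm{Diff}_{\mathbf h}(n,N)$, $\tau_N(\mathrm L_i^j)=\sum_{\alpha=1}^N x^{j,\alpha}\bar\partial_{i,\alpha}$, is preserved by the automorphisms $s_1,\dots,s_{n-1}$ of $\mathrm{Diff}_{\mathbf h}(n,N)$ given by $$s_i(x^{i,\alpha})=-x^{i+1,\alpha}\,\tilde h_{i,i+1},\quad s_i(x^{i+1,\alpha})=x^{i,\alpha}\frac{1}{\tilde h_{i,i+1}},\quad s_i(x^{j,\alpha})=x^{j,\alpha}\ (j\ne i,i+1),$$ $$s_i(\bar\partial_{i,\alpha})=-\frac{1}{\tilde h_{i,i+1}}\bar\partial_{i+1,\alpha},\quad s_i(\bar\partial_{i+1,\alpha})=\tilde h_{i,i+1}\,\bar\partial_{i,\alpha},\quad s_i(\bar\partial_{j,\alpha})=\bar\partial_{j,\alpha}\ (j\ne i,i+1),\quad s_i(\tilde h_j)=\tilde h_{s_i(j)},$$ and these formulas induce an action of the symmetric group $\mathrm S_n$ by automorphisms on the diagonal reduction algebra $\mathcal D(\mathbf{gl}_n)$; i.e. there is an action of $\mathrm S_n$ on $\mathcal D(\mathbf{gl}_n)$ by ring automorphisms such that $\tau_N(s_i(y))=s_i(\tau_N(y))$ for all $y\in\mathcal D(\mathbf{gl}_n)$, $i=1,\dots,n-1$ and all $N\ge 1$, where $s_i$ acts as the transposition $(i,i+1)$.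
   Context: $n\ge 1$ is an integer; $\mathfrak{k}$ is a commutative ground ring of characteristic zero. In $s_i(j)$, $s_i$ denotes the transposition $(i,i+1)$. $\mathrm{U}(\mathbf h)=\mathfrak{k}[\tilde h_1,\dots,\tilde h_n]$ is the polynomial ring; $\tilde h_{ij}:=\tilde h_i-\tilde h_j$; $\bar{\mathrm U}(\mathbf h)$ is the localization of $\mathrm{U}(\mathbf h)$ at the multiplicative set generated by all $\tilde h_{ij}+k$, $i\ne j$, $k\in\mathbb{Z}$. For $p\in\bar{\mathrm U}(\mathbf h)$, $p[\varepsilon_k]$ is obtained from $p$ by the shift $\tilde h_k\mapsto\tilde h_k+1$, $\tilde h_l\mapsto\tilde h_l$ ($l\ne k$). Let $\hat{\mathrm R}=\{\hat{\mathrm R}_{ij}^{kl}\}$ have the nonzero entries $\hat{\mathrm R}_{ij}^{ij}=\frac{1}{\tilde h_{ij}}$ for $i\neq j$; $\hat{\mathrm R}_{ji}^{ij}=\frac{\tilde h_{ij}^2-1}{\tilde h_{ij}^2}$ for $i<j$; $\hat{\mathrm R}_{ji}^{ij}=1$ for $i\ge j$. For $N\ge1$, the ring $\mathrm{Diff}_{\mathbf h}(n,N)$ is the $\mathfrak k$-algebra generated by $\bar{\mathrm U}(\mathbf h)$ and elements $x^{j,\alpha},\bar\partial_{j,\alpha}$, $j=1,\dots,n$, $\alpha=1,\dots,N$, with defining relations (besides those of $\bar{\mathrm U}(\mathbf h)$; relations for $\tilde h_i$ extend to all of $\bar{\mathrm U}(\mathbf h)$) $$\tilde h_ix^{j,\alpha}=x^{j,\alpha}(\tilde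 h_i+\delta_i^j),\qquad \tilde h_i\bar\partial_{j,\alpha}=\bar\partial_{j,\alpha}(\tilde h_i-\delta_i^j),$$ $$x^{i,\alpha}x^{j,\beta}=\sum_{k,l}\hat{\mathrm R}_{kl}^{ij}x^{k,\beta}x^{l,\alpha},\qquad \bar\partial_{i,\alpha}\bar\partial_{j,\beta}=\sum_{k,l}\hat{\mathrm R}_{ji}^{lk}\bar\partial_{k,\beta}\bar\partial_{l,\alpha},\qquad x^{i,\alpha}\bar\partial_{j,\beta}=\sum_{k,l}\hat{\mathrm R}_{lj}^{ki}[\varepsilon_k]\,\bar\partial_{k,\beta}x^{l,\alpha}-\delta^\alpha_\beta\delta^i_j.$$ The displayed formulas for $s_i$ define automorphisms of $\mathrm{Diff}_{\mathbf h}(n,N)$ giving an action of $\mathrm S_n$. The diagonal reduction algebra $\mathcal D(\mathbf{gl}_n)$ is the $\mathfrak k$-algebra generated by $\bar{\mathrm U}(\mathbf h)$ and elements $\mathrm L_i^j$, $i,j=1,\dots,n$, with relations $\tilde h_k\mathrm L_i^j=\mathrm L_i^j(\tilde h_k+\delta_k^j-\delta_k^i)$ (extended to all of $\bar{\mathrm U}(\mathbf h)$) and the reflection equation $$\hat{\mathrm R}_{12}\mathrm L_1\hat{\mathrm R}_{12}\mathrm L_1-\mathrm L_1\hat{\mathrm R}_{12}\mathrm L_1\hat{\mathrm R}_{12}=\hat{\mathrm R}_{12}\mathrm L_1-\mathrm L_1\hat{\mathrm R}_{12},$$ an equality of $n^2\times n^2$ matrices with entries in the algebra, where $(\hat{\mathrm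 R}_{12})^{ij}_{kl}=\hat{\mathrm R}^{ij}_{kl}$, $(\mathrm L_1)^{ij}_{kl}=\mathrm L^i_k\delta^j_l$, and matrix products are $(AB)^{ij}_{kl}=\sum_{a,b}A^{ij}_{ab}B^{ab}_{kl}$ (order of factors preserved). It is known that for each $N$ the map $\tau_N$ (identity on $\bar{\mathrm U}(\mathbf h)$) is a well-defined homomorphism, and that $\tau_N$ is injective for $N\ge n$. *)

theory Defs
  imports "HOL-Algebra.QuotRing" "HOL-Algebra.Group_Action" "HOL-Algebra.Sym_Groups"
    "HOL-Library.Poly_Mapping" "HOL-Combinatorics.Transposition"
begin

section \<open>Rings carried by a subset of a type-class ring\<close>

definition type_subring :: "'a::ring_1 set \<Rightarrow> 'a ring" where
  "type_subring A = \<lparr>carrier = A, monoid.mult = (*), one = 1, ring.zero = 0, add = (+)\<rparr>"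


section \<open>Localization of a commutative ring\<close>

definition loc_rel :: "('a, 'b) ring_scheme \<Rightarrow> 'a set \<Rightarrow> (('a \<times> 'a) \<times> ('a \<times> 'a)) set" where
  "loc_rel R S = {((a, s), (b, t)). a \<in> carrier R \<and> b \<in> carrier R \<and> s \<in> S \<and> t \<in> S \<and>
     (\<exists>u\<in>S. u \<otimes>\<^bsub>R\<^esub> (a \<otimes>\<^bsub>R\<^esub> t) = u \<otimes>\<^bsub>R\<^esub> (b \<otimes>\<^bsub>R\<^esub> s))}"

definition loc_frac :: "('a, 'b) ring_scheme \<Rightarrow> 'a set \<Rightarrow> 'a \<Rightarrow> 'a \<Rightarrow> ('a \<times> 'a) set" where
  "loc_frac R S a s = loc_rel R S `` {(a, s)}"

definition localization :: "('a, 'b) ring_scheme \<Rightarrow> 'a set \<Rightarrow> (('a \<times> 'a) set) ring" where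
  "localization R S =
    \<lparr>carrier = (carrier R \<times> S) // loc_rel R S,
     monoid.mult = (\<lambda>A B. \<Union>(a, s)\<in>A. \<Union>(b, t)\<in>B. loc_frac R S (a \<otimes>\<^bsub>R\<^esub> b) (s \<otimes>\<^bsub>R\<^esub> t)),
     one = loc_frac R S \<one>\<^bsub>R\<^esub> \<one>\<^bsub>R\<^esub>,
     ring.zero = loc_frac R S \<zero>\<^bsub>R\<^esub> \<one>\<^bsub>R\<^esub>,
     add = (\<lambda>A B. \<Union>(a, s)\<in>A. \<Union>(b, t)\<in>B.
       loc_frac R S ((a \<otimes>\<^bsub>R\<^esub> t) \<oplus>\<^bsub>R\<^esub> (b \<otimes>\<^bsub>R\<^esub> s)) (s \<otimes>\<^bsub>R\<^esub> t))\<rparr>"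

text \<open>The map of a localization induced by an endomorphism \<open>f\<close> of \<open>R\<close> that maps \<open>S\<close> into \<open>S\<close>.\<close>

definition loc_map ::
  "('a, 'b) ring_scheme \<Rightarrow> 'a set \<Rightarrow> ('a \<Rightarrow> 'a) \<Rightarrow> ('a \<times> 'a) set \<Rightarrow> ('a \<times> 'a) set" where
  "loc_map R S f A = (\<Union>(a, s)\<in>A. loc_frac R S (f a) (f s))"


section \<open>The rings \<open>U(h)\<close> and \<open>Ubar(h)\<close>\<close>

text \<open>A monomial \<open>m\<close> has exponent \<open>lookup m i\<close> at the variable \<open>h\<^sub>i\<close>.\<close>

type_synonym 'k hpoly = "(nat \<Rightarrow>\<^sub>0 nat) \<Rightarrow>\<^sub>0 'k"

definition hvar :: "nat \<Rightarrow> 'k::comm_ring_1 hpoly" where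
  "hvar i = Poly_Mapping.single (Poly_Mapping.single i 1) 1"

definition hdiff :: "nat \<Rightarrow> nat \<Rightarrow> 'k::comm_ring_1 hpoly" where
  "hdiff i j = hvar i - hvar j"

definition hpoly_ring :: "nat \<Rightarrow> 'k::comm_ring_1 hpoly ring" where
  "hpoly_ring n = type_subring {p. \<forall>m\<in>Poly_Mapping.keys p. Poly_Mapping.keys m \<subseteq> {1..n}}"

inductive_set hdenoms :: "nat \<Rightarrow> 'k::comm_ring_1 hpoly set" for n :: nat where
  one: "1 \<in> hdenoms n"
| mult: "\<lbrakk>s \<in> hdenoms n; i \<in> {1..n}; j \<in> {1..n}; i \<noteq> j\<rbrakk>
    \<Longrightarrow> (hdiff i j + of_int k) * s \<in> hdenoms n"

definition hsubst :: "(nat \<Rightarrow> 'k hpoly) \<Rightarrow> 'k::comm_ring_1 hpoly \<Rightarrow> 'k hpoly" where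
  "hsubst f p = (\<Sum>m\<in>Poly_Mapping.keys p.
     Poly_Mapping.single 0 (Poly_Mapping.lookup p m) *
     (\<Prod>i\<in>Poly_Mapping.keys m. f i ^ Poly_Mapping.lookup m i))"

type_synonym 'k ubar = "('k hpoly \<times> 'k hpoly) set"

definition Ubar :: "nat \<Rightarrow> 'k::comm_ring_1 ubar ring" where
  "Ubar n = localization (hpoly_ring n) (hdenoms n)"

definition ufrac :: "nat \<Rightarrow> 'k::comm_ring_1 hpoly \<Rightarrow> 'k hpoly \<Rightarrow> 'k ubar" where
  "ufrac n p s = loc_frac (hpoly_ring n) (hdenoms n) p s"

text \<open>\<open>ushift n e\<close> is the substitution \<open>h\<^sub>k \<mapsto> h\<^sub>k + e k\<close>, so \<open>p[\<epsilon>\<^sub>k]\<close> is \<open>ushift n (eps k) p\<close>.\<close>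

definition ushift :: "nat \<Rightarrow> (nat \<Rightarrow> int) \<Rightarrow> 'k::comm_ring_1 ubar \<Rightarrow> 'k ubar" where
  "ushift n e = loc_map (hpoly_ring n) (hdenoms n) (hsubst (\<lambda>i. hvar i + of_int (e i)))"

definition eps :: "nat \<Rightarrow> nat \<Rightarrow> int" where
  "eps k = (\<lambda>l. if l = k then 1 else 0)"

definition uperm :: "nat \<Rightarrow> (nat \<Rightarrow> nat) \<Rightarrow> 'k::comm_ring_1 ubar \<Rightarrow> 'k ubar" where
  "uperm n \<sigma> = loc_map (hpoly_ring n) (hdenoms n) (hsubst (\<lambda>i. hvar (\<sigma> i)))"

text \<open>\<open>Rhat n i j k l\<close> has upper indices \<open>i, j\<close> and lower indices \<open>k, l\<close>.\<close>

definition Rhat :: "nat \<Rightarrow> nat \<Rightarrow> nat \<Rightarrow> nat \<Rightarrow> nat \<Rightarrow> 'k::comm_ring_1 ubar" where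
  "Rhat n i j k l =
    (if i \<noteq> j \<and> k = i \<and> l = j then ufrac n 1 (hdiff i j)
     else if k = j \<and> l = i then
       (if i < j then ufrac n ((hdiff i j)\<^sup>2 - 1) ((hdiff i j)\<^sup>2) else ufrac n 1 1)
     else ufrac n 0 1)"


section \<open>Algebras given by generators and relations\<close>

text \<open>The free associative \<open>k\<close>-algebra is the monoid algebra over \<open>k\<close> of the free monoid. The
  free monoid is a copy of the type of lists, written additively because the multiplication of
  \<open>\<Rightarrow>\<^sub>0\<close> adds exponents.\<close>

datatype 'g free_monoid = Free_Monoid (letters: "'g list")

instantiation free_monoid :: (type) monoid_add
begin

definition zero_free_monoid :: "'a free_monoid" where
  "zero_free_monoid = Free_Monoid []"

definition plus_free_monoid :: "'a free_monoid \<Rightarrow> 'a free_monoid \<Rightarrow> 'a free_monoid" where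
  "plus_free_monoid v w = Free_Monoid (letters v @ letters w)"

instance
  by intro_classes (simp_all add: zero_free_monoid_def plus_free_monoid_def)

end

type_synonym ('g, 'k) free_alg = "'g free_monoid \<Rightarrow>\<^sub>0 'k"

definition scalar :: "'k \<Rightarrow> ('g, 'k::comm_ring_1) free_alg" where
  "scalar c = Poly_Mapping.single 0 c"

definition generator :: "'g \<Rightarrow> ('g, 'k::comm_ring_1) free_alg" where
  "generator g = Poly_Mapping.single (Free_Monoid [g]) 1"

definition free_alg :: "'g set \<Rightarrow> ('g, 'k::comm_ring_1) free_alg ring" where
  "free_alg G = type_subring {p. \<forall>w\<in>Poly_Mapping.keys p. set (letters w) \<subseteq> G}"

definition rel_ideal ::
  "'g set \<Rightarrow> ('g, 'k::comm_ring_1) free_alg set \<Rightarrow> ('g, 'k) free_alg set" where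
  "rel_ideal G P = genideal (free_alg G) P"

definition presented ::
  "'g set \<Rightarrow> ('g, 'k::comm_ring_1) free_alg set \<Rightarrow> ('g, 'k) free_alg set ring" where
  "presented G P = free_alg G Quot rel_ideal G P"

text \<open>The homomorphism of free algebras with prescribed values on the generators, and the map it
  induces from a quotient of the source to the algebra with generators \<open>G\<close> and relators \<open>P\<close>.\<close>

definition free_lift :: "('g \<Rightarrow> ('h, 'k) free_alg) \<Rightarrow> ('g, 'k::comm_ring_1) free_alg
    \<Rightarrow> ('h, 'k) free_alg" where
  "free_lift f p = (\<Sum>w\<in>Poly_Mapping.keys p.
     scalar (Poly_Mapping.lookup p w) * prod_list (map f (letters w)))"

definition induced_map :: "'h set \<Rightarrow> ('h, 'k::comm_ring_1) free_alg set
    \<Rightarrow> ('g \<Rightarrow> ('h, 'k) free_alg) \<Rightarrow> ('g, 'k) free_alg set \<Rightarrow> ('h, 'k) free_alg set" where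
  "induced_map G P f A = (\<Union>p\<in>A. rel_ideal G P +>\<^bsub>free_alg G\<^esub> free_lift f p)"


section \<open>Algebras generated by \<open>Ubar(h)\<close> and further elements\<close>

datatype ('u, 'e) gen = Coef 'u | Elt 'e

type_synonym ('e, 'k) hfree = "(('k ubar, 'e) gen, 'k) free_alg"

abbreviation coef :: "'k ubar \<Rightarrow> ('e, 'k::comm_ring_1) hfree" where
  "coef u \<equiv> generator (Coef u)"

abbreviation elt :: "'e \<Rightarrow> ('e, 'k::comm_ring_1) hfree" where
  "elt e \<equiv> generator (Elt e)"

definition hgens :: "nat \<Rightarrow> 'e set \<Rightarrow> ('k::comm_ring_1 ubar, 'e) gen set" where
  "hgens n E = Coef ` carrier (Ubar n) \<union> Elt ` E"

text \<open>The relations of \<open>Ubar(h)\<close>, making \<^const>\<open>coef\<close> a homomorphism of \<open>k\<close>-algebras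
  from \<open>Ubar(h)\<close>.\<close>

definition coef_rels :: "nat \<Rightarrow> ('e, 'k::comm_ring_1) hfree set" where
  "coef_rels n =
     {coef (u \<oplus>\<^bsub>Ubar n\<^esub> v) - (coef u + coef v) | u v.
        u \<in> carrier (Ubar n) \<and> v \<in> carrier (Ubar n)} \<union>
     {coef (u \<otimes>\<^bsub>Ubar n\<^esub> v) - coef u * coef v | u v.
        u \<in> carrier (Ubar n) \<and> v \<in> carrier (Ubar n)} \<union>
     {coef (ufrac n (Poly_Mapping.single 0 c) 1) - scalar c | c. True}"

text \<open>\<open>u e = e u[wt e]\<close> for all \<open>u\<close> in \<open>Ubar(h)\<close>.\<close>

definition weight_rels ::
  "nat \<Rightarrow> 'e set \<Rightarrow> ('e \<Rightarrow> nat \<Rightarrow> int) \<Rightarrow> ('e, 'k::comm_ring_1) hfree set" where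
  "weight_rels n E wt =
     {coef u * elt e - elt e * coef (ushift n (wt e) u) | u e. u \<in> carrier (Ubar n) \<and> e \<in> E}"


subsection \<open>The ring \<open>Diff\<^sub>h(n, N)\<close>\<close>

text \<open>\<open>XGen j \<alpha>\<close> is \<open>x\<close> with upper indices \<open>j, \<alpha>\<close>; \<open>DGen j \<alpha>\<close> is
  \<open>\<partial>\<close> with lower indices \<open>j, \<alpha>\<close>.\<close>

datatype diff_gen = XGen nat nat | DGen nat nat

abbreviation xg :: "nat \<Rightarrow> nat \<Rightarrow> (diff_gen, 'k::comm_ring_1) hfree" where
  "xg j \<alpha> \<equiv> elt (XGen j \<alpha>)"

abbreviation dg :: "nat \<Rightarrow> nat \<Rightarrow> (diff_gen, 'k::comm_ring_1) hfree" where
  "dg j \<alpha> \<equiv> elt (DGen j \<alpha>)"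

definition diff_elts :: "nat \<Rightarrow> nat \<Rightarrow> diff_gen set" where
  "diff_elts n N = {XGen j \<alpha> | j \<alpha>. j \<in> {1..n} \<and> \<alpha> \<in> {1..N}} \<union>
                   {DGen j \<alpha> | j \<alpha>. j \<in> {1..n} \<and> \<alpha> \<in> {1..N}}"

fun diff_wt :: "diff_gen \<Rightarrow> nat \<Rightarrow> int" where
  "diff_wt (XGen j \<alpha>) = (\<lambda>l. eps j l)"
| "diff_wt (DGen j \<alpha>) = (\<lambda>l. - eps j l)"

definition diff_rels :: "nat \<Rightarrow> nat \<Rightarrow> (diff_gen, 'k::comm_ring_1) hfree set" where
  "diff_rels n N = coef_rels n \<union> weight_rels n (diff_elts n N) diff_wt \<union>
     {xg i \<alpha> * xg j \<beta>
        - (\<Sum>k\<in>{1..n}. \<Sum>l\<in>{1..n}. coef (Rhat n i j k l) * xg k \<beta> * xg l \<alpha>)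
       | i j \<alpha> \<beta>. i \<in> {1..n} \<and> j \<in> {1..n} \<and> \<alpha> \<in> {1..N} \<and> \<beta> \<in> {1..N}} \<union>
     {dg i \<alpha> * dg j \<beta>
        - (\<Sum>k\<in>{1..n}. \<Sum>l\<in>{1..n}. coef (Rhat n l k j i) * dg k \<beta> * dg l \<alpha>)
       | i j \<alpha> \<beta>. i \<in> {1..n} \<and> j \<in> {1..n} \<and> \<alpha> \<in> {1..N} \<and> \<beta> \<in> {1..N}} \<union>
     {xg i \<alpha> * dg j \<beta>
        - ((\<Sum>k\<in>{1..n}. \<Sum>l\<in>{1..n}.
              coef (ushift n (eps k) (Rhat n k i l j)) * dg k \<beta> * xg l \<alpha>)
           - (if \<alpha> = \<beta> \<and> i = j then 1 else 0))
       | i j \<alpha> \<beta>. i \<in> {1..n} \<and> j \<in> {1..n} \<and> \<alpha> \<in> {1..N} \<and> \<beta> \<in> {1..N}}"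

definition Diff :: "nat \<Rightarrow> nat \<Rightarrow> (diff_gen, 'k::comm_ring_1) hfree set ring" where
  "Diff n N = presented (hgens n (diff_elts n N)) (diff_rels n N)"

fun diff_s_gen ::
  "nat \<Rightarrow> nat \<Rightarrow> ('k::comm_ring_1 ubar, diff_gen) gen \<Rightarrow> (diff_gen, 'k) hfree" where
  "diff_s_gen n i (Coef u) = coef (uperm n (transpose i (i + 1)) u)"
| "diff_s_gen n i (Elt (XGen j \<alpha>)) =
    (if j = i then - (xg (i + 1) \<alpha> * coef (ufrac n (hdiff i (i + 1)) 1))
     else if j = i + 1 then xg i \<alpha> * coef (ufrac n 1 (hdiff i (i + 1)))
     else xg j \<alpha>)"
| "diff_s_gen n i (Elt (DGen j \<alpha>)) =
    (if j = i then - (coef (ufrac n 1 (hdiff i (i + 1))) * dg (i + 1) \<alpha>)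
     else if j = i + 1 then coef (ufrac n (hdiff i (i + 1)) 1) * dg i \<alpha>
     else dg j \<alpha>)"

definition diff_s :: "nat \<Rightarrow> nat \<Rightarrow> nat \<Rightarrow>
    (diff_gen, 'k::comm_ring_1) hfree set \<Rightarrow> (diff_gen, 'k) hfree set" where
  "diff_s n N i = induced_map (hgens n (diff_elts n N)) (diff_rels n N) (diff_s_gen n i)"


subsection \<open>The diagonal reduction algebra of \<open>gl\<^sub>n\<close>\<close>

text \<open>\<open>LGen i j\<close> has lower index \<open>i\<close> and upper index \<open>j\<close>.\<close>

datatype dra_gen = LGen nat nat

abbreviation lg :: "nat \<Rightarrow> nat \<Rightarrow> (dra_gen, 'k::comm_ring_1) hfree" where
  "lg i j \<equiv> elt (LGen i j)"

definition dra_elts :: "nat \<Rightarrow> dra_gen set" where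
  "dra_elts n = {LGen i j | i j. i \<in> {1..n} \<and> j \<in> {1..n}}"

fun dra_wt :: "dra_gen \<Rightarrow> nat \<Rightarrow> int" where
  "dra_wt (LGen i j) = (\<lambda>l. eps j l - eps i l)"

text \<open>Matrices with upper indices \<open>i, j\<close> and lower indices \<open>k, l\<close>, all in \<open>{1..n}\<close>.\<close>

type_synonym 'a mat4 = "nat \<Rightarrow> nat \<Rightarrow> nat \<Rightarrow> nat \<Rightarrow> 'a"

definition mat4_mult :: "nat \<Rightarrow> 'a::ring_1 mat4 \<Rightarrow> 'a mat4 \<Rightarrow> 'a mat4" where
  "mat4_mult n A B = (\<lambda>i j k l. \<Sum>a\<in>{1..n}. \<Sum>b\<in>{1..n}. A i j a b * B a b k l)"

definition R12 :: "nat \<Rightarrow> (dra_gen, 'k::comm_ring_1) hfree mat4" where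
  "R12 n = (\<lambda>i j k l. coef (Rhat n i j k l))"

definition L1 :: "(dra_gen, 'k::comm_ring_1) hfree mat4" where
  "L1 = (\<lambda>i j k l. lg k i * (if j = l then 1 else 0))"

definition reflection_lhs :: "nat \<Rightarrow> (dra_gen, 'k::comm_ring_1) hfree mat4" where
  "reflection_lhs n = (\<lambda>i j k l.
     mat4_mult n (mat4_mult n (mat4_mult n (R12 n) L1) (R12 n)) L1 i j k l
     - mat4_mult n (mat4_mult n (mat4_mult n L1 (R12 n)) L1) (R12 n) i j k l)"

definition reflection_rhs :: "nat \<Rightarrow> (dra_gen, 'k::comm_ring_1) hfree mat4" where
  "reflection_rhs n = (\<lambda>i j k l.
     mat4_mult n (R12 n) L1 i j k l - mat4_mult n L1 (R12 n) i j k l)"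

definition dra_rels :: "nat \<Rightarrow> (dra_gen, 'k::comm_ring_1) hfree set" where
  "dra_rels n = coef_rels n \<union> weight_rels n (dra_elts n) dra_wt \<union>
     {reflection_lhs n i j k l - reflection_rhs n i j k l | i j k l.
        i \<in> {1..n} \<and> j \<in> {1..n} \<and> k \<in> {1..n} \<and> l \<in> {1..n}}"

definition Dgl :: "nat \<Rightarrow> (dra_gen, 'k::comm_ring_1) hfree set ring" where
  "Dgl n = presented (hgens n (dra_elts n)) (dra_rels n)"


subsection \<open>The homomorphism \<open>\<tau>\<^sub>N\<close>\<close>

fun tau_gen :: "nat \<Rightarrow> ('k::comm_ring_1 ubar, dra_gen) gen \<Rightarrow> (diff_gen, 'k) hfree" where
  "tau_gen N (Coef u) = coef u"
| "tau_gen N (Elt (LGen i j)) = (\<Sum>\<alpha>\<in>{1..N}. xg j \<alpha> * dg i \<alpha>)"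

definition tau :: "nat \<Rightarrow> nat \<Rightarrow>
    (dra_gen, 'k::comm_ring_1) hfree set \<Rightarrow> (diff_gen, 'k) hfree set" where
  "tau n N = induced_map (hgens n (diff_elts n N)) (diff_rels n N) (tau_gen N)"

end

theory Submission
  imports Defs
begin

text \<open>The formulas for \<open>s\<^sub>i\<close> become a plain relabelling of indices after a change of generators. Put
\<open>\<chi>\<^sub>i = \<Prod>\<^bsub>k > i\<^esub> (h\<^sub>i - h\<^sub>k - 1)\<close> (\<open>chi\<close>) and replace \<open>x\<^sup>i\<close> by \<open>\<chi>\<^sub>i\<^bsup>-1\<^esup> x\<^sup>i\<close>, \<open>\<partial>\<^sub>i\<close> by
\<open>\<partial>\<^sub>i \<chi>\<^sub>i\<close> and the generator \<open>L\<close> with upper index \<open>i\<close> and lower index \<open>k\<close> by \<open>\<chi>\<^sub>i\<^bsup>-1\<^esup> L \<chi>\<^sub>k\<close>. All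
quadratic relations keep their shape, but the matrix \<open>R\<close> is replaced by \<open>G\<^bsup>-1\<^esup> R G\<close>, where \<open>G\<close> is
the diagonal matrix with entries \<open>\<chi>\<^sub>i \<chi>\<^sub>j[-\<epsilon>\<^sub>i]\<close> (\<open>gauge\<close>). The new matrix has the entries
\<open>1 / h\<^sub>i\<^sub>j\<close> and \<open>1 + 1 / h\<^sub>i\<^sub>j\<close> for all \<open>i \<noteq> j\<close>, without any reference to the order of \<open>i\<close> and \<open>j\<close>
(\<open>gauge_RT\<close>), so that every permutation of the indices preserves the relations. Undoing the change of
generators gives automorphisms of the original algebras (\<open>diff_sys_symmetric\<close>,
\<open>dra_sys_symmetric\<close>). Since they are conjugate to relabellings, the group law is immediate
(\<open>perm_map_comp\<close>). For the transposition of \<open>i\<close> and \<open>i + 1\<close> nearly all factors of the \<open>\<chi>\<close> cancel, and what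
remains are the factors in the given formulas (\<open>diff_s_gen_gauge\<close>); hence \<open>\<tau>\<^sub>N\<close> intertwines the two
actions and its image is preserved.

That \<open>\<tau>\<^sub>N\<close> is well defined is the computation
\<open>L\<^sub>1 R L\<^sub>1 - L\<^sub>1 = \<Sum> x x \<partial> \<partial>\<close>, which follows from the relation between \<open>x\<close> and \<open>\<partial>\<close>; the right-hand side
commutes with \<open>R\<close> because of the relations among the \<open>x\<close> and among the \<open>\<partial>\<close>, and this is the
reflection equation (\<open>refl_eq_oscillator\<close>).

The algebras are quotients of free algebras by ideals that depend on \<open>n\<close> and \<open>N\<close>, hence not types.
The computations are nevertheless done by rewriting in one type of rings into which all quotients of
a type embed (\<open>univ_quot\<close>). A map from generators to such a ring kills the relators if and only if
the images satisfy a system of equations (\<open>diff_rels_iff\<close>, \<open>dra_rels_iff\<close>): one direction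
produces the equations in the algebras, the other one produces homomorphisms.\<close>

section \<open>A ring containing all quotients of a ring\<close>

definition two_sided_ideal :: "'a::ring_1 set \<Rightarrow> bool" where
  "two_sided_ideal J \<longleftrightarrow> 0 \<in> J \<and> (\<forall>a\<in>J. \<forall>b\<in>J. a - b \<in> J) \<and>
     (\<forall>a\<in>J. \<forall>x. x * a \<in> J \<and> a * x \<in> J)"

lemma two_sided_ideal_zero: "two_sided_ideal {0}"
  by (simp add: two_sided_ideal_def)

lemma two_sided_idealD:
  assumes "two_sided_ideal J"
  shows "0 \<in> J" "a \<in> J \<Longrightarrow> b \<in> J \<Longrightarrow> a - b \<in> J" "a \<in> J \<Longrightarrow> x * a \<in> J" "a \<in> J \<Longrightarrow> a * x \<in> J"
    "a \<in> J \<Longrightarrow> - a \<in> J" "a \<in> J \<Longrightarrow> b \<in> J \<Longrightarrow> a + b \<in> J"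
proof -
  show *: "0 \<in> J" "\<And>a b. a \<in> J \<Longrightarrow> b \<in> J \<Longrightarrow> a - b \<in> J" "a \<in> J \<Longrightarrow> x * a \<in> J" "a \<in> J \<Longrightarrow> a * x \<in> J"
    using assms by (auto simp: two_sided_ideal_def)
  show m: "- a \<in> J" if "a \<in> J" for a using *(2)[OF *(1) that] by simp
  show "a + b \<in> J" if "a \<in> J" "b \<in> J" using *(2)[OF that(1) m[OF that(2)]] by simp
qed

text \<open>The product of the quotients by all two-sided ideals, presented as families indexed by arbitrary
sets whose entries at sets other than ideals are ignored. Unlike a single quotient by an ideal that
depends on parameters, this product is a type.\<close>

definition univ_quot_rel :: "('a::ring_1 set \<Rightarrow> 'a) \<Rightarrow> ('a set \<Rightarrow> 'a) \<Rightarrow> bool" where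
  "univ_quot_rel f g \<longleftrightarrow> (\<forall>J. two_sided_ideal J \<longrightarrow> f J - g J \<in> J)"

quotient_type (overloaded) 'a univ_quot = "'a::ring_1 set \<Rightarrow> 'a" / univ_quot_rel
proof (rule equivpI)
  show "reflp univ_quot_rel"
    by (auto simp: reflp_def univ_quot_rel_def two_sided_idealD)
  show "symp univ_quot_rel"
    unfolding symp_def univ_quot_rel_def using two_sided_idealD(5) by (metis minus_diff_eq)
  show "transp univ_quot_rel"
    unfolding transp_def univ_quot_rel_def using two_sided_idealD(6)
    by (metis (no_types, lifting) diff_add_cancel add_diff_eq)
qed

lemma add_diff_add_eq: "(a + b) - (c + d) = (a - c) + (b - d :: 'a::ring_1)"
  and diff_diff_diff_eq: "(a - b) - (c - d) = (a - c) - (b - d :: 'a::ring_1)"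
  by simp_all

instantiation univ_quot :: (ring_1) ring_1
begin

lift_definition zero_univ_quot :: "'a univ_quot" is "\<lambda>_. 0" .
lift_definition one_univ_quot :: "'a univ_quot" is "\<lambda>_. 1" .
lift_definition uminus_univ_quot :: "'a univ_quot \<Rightarrow> 'a univ_quot" is "\<lambda>f J. - f J"
  unfolding univ_quot_rel_def using two_sided_idealD(5) by fastforce
lift_definition plus_univ_quot :: "'a univ_quot \<Rightarrow> 'a univ_quot \<Rightarrow> 'a univ_quot" is "\<lambda>f g J. f J + g J"
  unfolding univ_quot_rel_def by (metis add_diff_add_eq two_sided_idealD(6))
lift_definition minus_univ_quot :: "'a univ_quot \<Rightarrow> 'a univ_quot \<Rightarrow> 'a univ_quot" is "\<lambda>f g J. f J - g J"
  unfolding univ_quot_rel_def by (metis diff_diff_diff_eq two_sided_idealD(2))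
lift_definition times_univ_quot :: "'a univ_quot \<Rightarrow> 'a univ_quot \<Rightarrow> 'a univ_quot" is "\<lambda>f g J. f J * g J"
  unfolding univ_quot_rel_def
proof (intro allI impI)
  fix f f' g g' :: "'a set \<Rightarrow> 'a" and J :: "'a set"
  assume "\<forall>J. two_sided_ideal J \<longrightarrow> f J - f' J \<in> J" "\<forall>J. two_sided_ideal J \<longrightarrow> g J - g' J \<in> J"
    and J: "two_sided_ideal J"
  then have "(f J - f' J) * g J \<in> J" "f' J * (g J - g' J) \<in> J"
    using two_sided_idealD(3,4)[OF J] by blast+
  then have "(f J - f' J) * g J + f' J * (g J - g' J) \<in> J"
    using two_sided_idealD(6)[OF J] by blast
  then show "f J * g J - f' J * g' J \<in> J"
    by (simp add: algebra_simps)
qed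

instance
proof
  show "(0::'a univ_quot) \<noteq> 1"
    by transfer (use two_sided_ideal_zero in \<open>force simp: univ_quot_rel_def\<close>)
qed (transfer; simp add: univ_quot_rel_def two_sided_idealD algebra_simps)+

end

text \<open>The inclusion of the factor at \<open>J\<close>. It is additive and multiplicative but not unital: it maps \<open>1\<close> to
an idempotent.\<close>

lift_definition univ_quot_emb :: "'a::ring_1 set \<Rightarrow> 'a \<Rightarrow> 'a univ_quot" is "\<lambda>J p J'. if J' = J then p else 0" .

lemma univ_quot_emb_zero [simp]: "univ_quot_emb J 0 = 0"
  by transfer (simp add: univ_quot_rel_def two_sided_idealD)

lemma univ_quot_emb_add: "univ_quot_emb J (p + q) = univ_quot_emb J p + univ_quot_emb J q"
  by transfer (simp add: univ_quot_rel_def two_sided_idealD)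

lemma univ_quot_emb_mult: "univ_quot_emb J (p * q) = univ_quot_emb J p * univ_quot_emb J q"
  by transfer (simp add: univ_quot_rel_def two_sided_idealD)

lemma univ_quot_emb_eq_0_iff:
  assumes "two_sided_ideal J"
  shows "univ_quot_emb J p = 0 \<longleftrightarrow> p \<in> J"
  using assms by transfer (auto simp: univ_quot_rel_def two_sided_idealD)


section \<open>Monoid algebras\<close>

lemma single_central:
  fixes q :: "'m::monoid_add \<Rightarrow>\<^sub>0 'k::comm_ring_1"
  shows "Poly_Mapping.single 0 c * q = q * Poly_Mapping.single 0 c"
proof (induct q rule: update_induct)
  case const then show ?case by simp
next
  case (update f a b)
  have "Poly_Mapping.update a b f = f + Poly_Mapping.single a b"
    using update(1)
    by (intro poly_mapping_eqI)
       (auto simp: lookup_update lookup_add lookup_single when_def in_keys_iff)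
  then show ?case using update(3)
    by (simp add: distrib_left distrib_right mult_single mult.commute)
qed

text \<open>The common form of \<^const>\<open>free_lift\<close> and \<^const>\<open>hsubst\<close>.\<close>

definition mlift :: "('m \<Rightarrow> 'b::monoid_add \<Rightarrow>\<^sub>0 'k) \<Rightarrow> ('m \<Rightarrow>\<^sub>0 'k::comm_ring_1) \<Rightarrow> 'b \<Rightarrow>\<^sub>0 'k" where
  "mlift \<phi> p = (\<Sum>m\<in>Poly_Mapping.keys p. Poly_Mapping.single 0 (Poly_Mapping.lookup p m) * \<phi> m)"

lemma mlift_superset:
  assumes "finite A" "Poly_Mapping.keys p \<subseteq> A"
  shows "mlift \<phi> p = (\<Sum>m\<in>A. Poly_Mapping.single 0 (Poly_Mapping.lookup p m) * \<phi> m)"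
  unfolding mlift_def using assms
  by (intro sum.mono_neutral_left) (auto simp: in_keys_iff)

lemma mlift_add: "mlift \<phi> (p + q) = mlift \<phi> p + mlift \<phi> q"
proof -
  let ?A = "Poly_Mapping.keys p \<union> Poly_Mapping.keys q"
  have "mlift \<phi> r = (\<Sum>m\<in>?A. Poly_Mapping.single 0 (Poly_Mapping.lookup r m) * \<phi> m)"
    if "Poly_Mapping.keys r \<subseteq> ?A" for r
    using that by (intro mlift_superset) auto
  then show ?thesis
    using keys_add[of p q]
    by (simp add: lookup_add single_add distrib_right sum.distrib)
qed

lemma mlift_0 [simp]: "mlift \<phi> 0 = 0"
  by (simp add: mlift_def)

lemma mlift_uminus: "mlift \<phi> (- p) = - mlift \<phi> p"
  by (metis add.right_inverse mlift_0 mlift_add neg_eq_iff_add_eq_0)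

lemma mlift_diff: "mlift \<phi> (p - q) = mlift \<phi> p - mlift \<phi> q"
  by (metis diff_conv_add_uminus mlift_add mlift_uminus)

lemma mlift_sum: "mlift \<phi> (\<Sum>i\<in>A. f i) = (\<Sum>i\<in>A. mlift \<phi> (f i))"
  by (induct A rule: infinite_finite_induct) (auto simp: mlift_add)

lemma mlift_single: "mlift \<phi> (Poly_Mapping.single m c) = Poly_Mapping.single 0 c * \<phi> m"
  by (cases "c = 0") (auto simp: mlift_def)

lemma poly_mapping_single_induct [case_names zero add]:
  assumes "P 0" "\<And>p m c. m \<notin> Poly_Mapping.keys p \<Longrightarrow> P p \<Longrightarrow> P (Poly_Mapping.single m c + p)"
  shows "P (p :: 'm \<Rightarrow>\<^sub>0 'k::comm_ring_1)"
proof (induct p rule: update_induct)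
  case const then show ?case using assms(1) by simp
next
  case (update f a b)
  have "Poly_Mapping.update a b f = Poly_Mapping.single a b + f"
    using update(1)
    by (intro poly_mapping_eqI)
       (auto simp: lookup_update lookup_add lookup_single when_def in_keys_iff)
  then show ?case using assms(2) update by metis
qed

lemma mlift_mult:
  fixes \<phi> :: "'m::monoid_add \<Rightarrow> 'b::monoid_add \<Rightarrow>\<^sub>0 'k::comm_ring_1"
  assumes "\<And>a b. \<phi> (a + b) = \<phi> a * \<phi> b"
  shows "mlift \<phi> (p * q) = mlift \<phi> p * mlift \<phi> q"
proof (induct p rule: poly_mapping_single_induct)
  case (add p m c)
  have "mlift \<phi> (Poly_Mapping.single m c * q) = mlift \<phi> (Poly_Mapping.single m c) * mlift \<phi> q"
  proof (induct q rule: poly_mapping_single_induct)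
    case (add q m' c')
    have "mlift \<phi> (Poly_Mapping.single m c * Poly_Mapping.single m' c')
      = Poly_Mapping.single 0 c * (Poly_Mapping.single 0 c' * \<phi> m) * \<phi> m'"
      by (simp add: mult_single mlift_single assms mult.assoc[symmetric])
    also have "\<dots> = mlift \<phi> (Poly_Mapping.single m c) * mlift \<phi> (Poly_Mapping.single m' c')"
      by (simp add: single_central[of c'] mlift_single mult.assoc)
    finally show ?case using add by (simp add: distrib_left mlift_add)
  qed simp
  then show ?case using add by (simp add: distrib_right mlift_add)
qed simp

lemma mlift_scalar: "\<phi> 0 = 1 \<Longrightarrow> mlift \<phi> (Poly_Mapping.single 0 c) = Poly_Mapping.single 0 c"
  by (simp add: mlift_single)

section \<open>Free algebras\<close>

lemma free_lift_mlift: "free_lift f = mlift (\<lambda>w. prod_list (map f (letters w)))"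
  by (simp add: fun_eq_iff free_lift_def mlift_def scalar_def)

lemma letters_zero [simp]: "letters 0 = []"
  by (simp add: zero_free_monoid_def)

lemma letters_plus [simp]: "letters (v + w) = letters v @ letters w"
  by (simp add: plus_free_monoid_def)

lemma free_lift_hom:
  "free_lift f 0 = 0"
  "free_lift f (p + q) = free_lift f p + free_lift f q"
  "free_lift f (- p) = - free_lift f p"
  "free_lift f (p - q) = free_lift f p - free_lift f q"
  "free_lift f (p * q) = free_lift f p * free_lift f q"
  "free_lift f 1 = 1"
  "free_lift f (scalar c) = scalar c"
  "free_lift f (generator g) = f g"
  "free_lift f (sum F A) = (\<Sum>i\<in>A. free_lift f (F i))"
  unfolding free_lift_mlift generator_def scalar_def
  by (simp_all add: mlift_add mlift_uminus mlift_diff mlift_mult mlift_scalar mlift_sum mlift_single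
      mlift_scalar[of _ 1, simplified])

lemma scalar_1 [simp]: "scalar 1 = 1"
  by (simp add: scalar_def)

lemma single_eq_prod_list:
  fixes w :: "'a free_monoid" and c :: "'b::comm_ring_1"
  shows "Poly_Mapping.single w c = scalar c * prod_list (map generator (letters w))"
proof -
  have *: "prod_list (map generator ws) = (Poly_Mapping.single (Free_Monoid ws) 1 :: ('a, 'b) free_alg)"
    for ws
    by (induct ws) (auto simp: generator_def mult_single plus_free_monoid_def
        zero_free_monoid_def[symmetric])
  then show ?thesis
    by (cases w) (simp add: * scalar_def mult_single)
qed

abbreviation in_alg :: "'g set \<Rightarrow> ('g, 'k::comm_ring_1) free_alg \<Rightarrow> bool" where
  "in_alg G p \<equiv> p \<in> carrier (free_alg G)"

lemma free_alg_simps [simp]: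
  "monoid.mult (free_alg G) = (*)" "ring.add (free_alg G) = (+)" "monoid.one (free_alg G) = 1" "ring.zero (free_alg G) = 0"
  by (simp_all add: free_alg_def type_subring_def)

lemma in_alg_iff: "in_alg G p \<longleftrightarrow> (\<forall>w\<in>Poly_Mapping.keys p. set (letters w) \<subseteq> G)"
  by (simp add: free_alg_def type_subring_def)

lemma in_alg_intros [simp, intro]:
  "in_alg G 0" "in_alg G 1" "in_alg G (scalar c)"
  "in_alg G p \<Longrightarrow> in_alg G (- p)"
  "in_alg G p \<Longrightarrow> in_alg G q \<Longrightarrow> in_alg G (p + q)"
  "in_alg G p \<Longrightarrow> in_alg G q \<Longrightarrow> in_alg G (p - q)"
  "in_alg G p \<Longrightarrow> in_alg G q \<Longrightarrow> in_alg G (p * q)"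
  "g \<in> G \<Longrightarrow> in_alg G (generator g)"
proof -
  show "in_alg G p \<Longrightarrow> in_alg G q \<Longrightarrow> in_alg G (p + q)"
    using keys_add[of p q] unfolding in_alg_iff by blast
  show "in_alg G p \<Longrightarrow> in_alg G q \<Longrightarrow> in_alg G (p - q)"
    using keys_diff[of p q] unfolding in_alg_iff by blast
  show "in_alg G p \<Longrightarrow> in_alg G q \<Longrightarrow> in_alg G (p * q)"
    using keys_mult[of p q] unfolding in_alg_iff by (fastforce simp: plus_free_monoid_def)
qed (auto simp: in_alg_iff scalar_def generator_def)

lemma in_alg_sum [intro]: "(\<And>i. i \<in> A \<Longrightarrow> in_alg G (f i)) \<Longrightarrow> in_alg G (sum f A)"
  by (induct A rule: infinite_finite_induct) auto

lemma in_alg_prod_list: "(\<And>g. g \<in> set ws \<Longrightarrow> in_alg G (f g)) \<Longrightarrow> in_alg G (prod_list (map f ws))"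
  by (induct ws) auto

lemma in_alg_free_lift:
  assumes "in_alg G p" "\<And>g. g \<in> G \<Longrightarrow> in_alg H (f g)"
  shows "in_alg H (free_lift f p)"
  unfolding free_lift_def using assms(1)
  by (intro in_alg_sum in_alg_intros in_alg_prod_list assms(2)) (auto simp: in_alg_iff[of _ G])

lemma free_alg_induct [consumes 1, case_names scalar generator add mult]:
  fixes p :: "('g, 'k::comm_ring_1) free_alg"
  assumes "in_alg G p" "\<And>c. Q (scalar c)" "\<And>g. g \<in> G \<Longrightarrow> Q (generator g)"
    "\<And>p q. in_alg G p \<Longrightarrow> in_alg G q \<Longrightarrow> Q p \<Longrightarrow> Q q \<Longrightarrow> Q (p + q)"
    "\<And>p q. in_alg G p \<Longrightarrow> in_alg G q \<Longrightarrow> Q p \<Longrightarrow> Q q \<Longrightarrow> Q (p * q)"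
  shows "Q p"
proof -
  have 1: "Q (prod_list (map generator ws)) \<and> in_alg G (prod_list (map generator ws) :: ('g, 'k) free_alg)"
    if "set ws \<subseteq> G" for ws
    using that
  proof (induct ws)
    case Nil then show ?case using assms(2)[of 1] by simp
  next
    case (Cons g ws) then show ?case using assms(3)[of g] assms(5) by simp
  qed
  show ?thesis using assms(1)
  proof (induct p rule: poly_mapping_single_induct)
    case zero then show ?case using assms(2)[of 0] by (simp add: scalar_def)
  next
    case (add p m c)
    show ?case
    proof (cases "c = 0")
      case False
      have k: "Poly_Mapping.keys (Poly_Mapping.single m c + p) = insert m (Poly_Mapping.keys p)"
        using add(1) False
        by (auto simp: in_keys_iff lookup_add lookup_single when_def split: if_splits)
      then have p: "in_alg G p" and m: "set (letters m) \<subseteq> G"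
        using add(3) by (auto simp: in_alg_iff)
      then show ?thesis
        using 1[OF m] add(2) assms(2)[of c]
        by (intro assms(4)) (auto simp: single_eq_prod_list intro: assms(5))
    qed (use add in simp)
  qed
qed

lemma free_alg_ring: "ring (free_alg G :: ('g, 'k::comm_ring_1) free_alg ring)"
proof (rule ringI)
  show "abelian_group (free_alg G :: ('g, 'k) free_alg ring)"
  proof (rule abelian_groupI)
    fix x :: "('g, 'k) free_alg" assume "in_alg G x"
    then show "\<exists>y\<in>carrier (free_alg G). y \<oplus>\<^bsub>free_alg G\<^esub> x = \<zero>\<^bsub>free_alg G\<^esub>"
      by (intro bexI[of _ "- x"]) auto
  qed (auto simp: algebra_simps)
  show "monoid (free_alg G :: ('g, 'k) free_alg ring)"
    by (rule monoidI) (auto simp: algebra_simps)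
qed (auto simp: algebra_simps)

lemma free_alg_a_minus:
  assumes "in_alg G p" "in_alg G q"
  shows "p \<ominus>\<^bsub>free_alg G\<^esub> q = p - q"
proof -
  interpret ring "free_alg G" by (rule free_alg_ring)
  have "\<ominus>\<^bsub>free_alg G\<^esub> q = - q"
    using assms(2) by (intro minus_equality) auto
  then show ?thesis by (simp add: a_minus_def)
qed

section \<open>Presented algebras\<close>

context
  fixes G :: "'g set" and P :: "('g, 'k::comm_ring_1) free_alg set"
  assumes P: "P \<subseteq> carrier (free_alg G)"
begin

lemma rel_ideal_ideal: "ideal (rel_ideal G P) (free_alg G)"
  unfolding rel_ideal_def using free_alg_ring P by (rule ring.genideal_ideal)

lemma rel_ideal_sub: "P \<subseteq> rel_ideal G P"
  unfolding rel_ideal_def using ring.genideal_self[OF free_alg_ring P] .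

end

definition residue :: "'g set \<Rightarrow> ('g, 'k::comm_ring_1) free_alg set \<Rightarrow> ('g, 'k) free_alg \<Rightarrow> ('g, 'k) free_alg set" where
  "residue G P p = rel_ideal G P +>\<^bsub>free_alg G\<^esub> p"

text \<open>The homomorphism that kills the generators outside \<open>G\<close>. The relation ideal is an ideal of the
subalgebra generated by \<open>G\<close> only; its preimage under this retraction is an ideal of the whole type
and meets the subalgebra in the relation ideal.\<close>

definition retract :: "'g set \<Rightarrow> ('g, 'k::comm_ring_1) free_alg \<Rightarrow> ('g, 'k) free_alg" where
  "retract G = free_lift (\<lambda>g. if g \<in> G then generator g else 0)"

lemma retract_in: "in_alg G (retract G p)"
  unfolding retract_def using in_alg_free_lift[of p UNIV _ G] by (auto simp: in_alg_iff[of _ UNIV])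

lemma retract_hom:
  "retract G 0 = 0" "retract G (p - q) = retract G p - retract G q"
  "retract G (p * q) = retract G p * retract G q"
  by (simp_all add: retract_def free_lift_hom)

lemma retract_id: "in_alg G p \<Longrightarrow> retract G p = p"
  by (induct p rule: free_alg_induct) (auto simp: retract_def free_lift_hom)

text \<open>The factor at this ideal turns equality in the presented algebra into equality in a type-class ring.\<close>

definition quotval :: "'g set \<Rightarrow> ('g, 'k::comm_ring_1) free_alg set \<Rightarrow> ('g, 'k) free_alg \<Rightarrow> ('g, 'k) free_alg univ_quot" where
  "quotval G P = univ_quot_emb {p. retract G p \<in> rel_ideal G P}"

lemma quotval_hom:
  "quotval G P 0 = 0"
  "quotval G P (p + q) = quotval G P p + quotval G P q"
  "quotval G P (- p) = - quotval G P p"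
  "quotval G P (p - q) = quotval G P p - quotval G P q"
  "quotval G P (p * q) = quotval G P p * quotval G P q"
  "quotval G P (sum F A) = (\<Sum>i\<in>A. quotval G P (F i))"
proof -
  show *: "quotval G P 0 = 0" "\<And>p q. quotval G P (p + q) = quotval G P p + quotval G P q"
    "quotval G P (p * q) = quotval G P p * quotval G P q"
    by (simp_all add: quotval_def univ_quot_emb_add univ_quot_emb_mult)
  show m: "quotval G P (- p) = - quotval G P p" for p
    by (metis * add.right_inverse neg_eq_iff_add_eq_0)
  show "quotval G P (p - q) = quotval G P p - quotval G P q"
    by (metis * m diff_conv_add_uminus)
  show "quotval G P (sum F A) = (\<Sum>i\<in>A. quotval G P (F i))"
    by (induct A rule: infinite_finite_induct) (auto simp: *)
qed

lemma quotval_eq_0_iff: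
  assumes P: "P \<subseteq> carrier (free_alg G)" and p: "in_alg G p"
  shows "quotval G P p = 0 \<longleftrightarrow> p \<in> rel_ideal G P"
proof -
  interpret I: ideal "rel_ideal G P" "free_alg G" by (rule rel_ideal_ideal[OF P])
  have sub: "a - b \<in> rel_ideal G P" if "a \<in> rel_ideal G P" "b \<in> rel_ideal G P" for a b
    using additive_subgroup.a_closed[OF I.additive_subgroup_axioms that(1), of "- 1 * b"]
      I.I_l_closed[OF that(2), of "- 1"] by simp
  have "two_sided_ideal {p. retract G p \<in> rel_ideal G P}"
    unfolding two_sided_ideal_def
    using I.I_l_closed[OF _ retract_in] I.I_r_closed[OF _ retract_in] sub[of p p] sub
      additive_subgroup.zero_closed[OF I.additive_subgroup_axioms]
    by (auto simp: retract_hom)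
  from univ_quot_emb_eq_0_iff[OF this] show ?thesis
    by (simp add: quotval_def retract_id[OF p])
qed

lemma residue_eq_iff:
  assumes P: "P \<subseteq> carrier (free_alg G)" and "in_alg G p" "in_alg G q"
  shows "residue G P p = residue G P q \<longleftrightarrow> quotval G P p = quotval G P q"
proof -
  have "residue G P p = residue G P q \<longleftrightarrow> p - q \<in> rel_ideal G P"
    unfolding residue_def
    using ring.quotient_eq_iff_same_a_r_cos[OF free_alg_ring rel_ideal_ideal[OF P] assms(2,3)]
    by (simp add: free_alg_a_minus assms)
  also have "\<dots> \<longleftrightarrow> quotval G P (p - q) = 0"
    using quotval_eq_0_iff[OF P, of "p - q"] assms by simp
  finally show ?thesis by (simp add: quotval_hom)
qed

lemma carrier_presented: "carrier (presented G P) = residue G P ` carrier (free_alg G)"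
  unfolding presented_def residue_def FactRing_def A_RCOSETS_def' by auto

lemma residue_hom:
  assumes P: "P \<subseteq> carrier (free_alg G)"
  shows "residue G P \<in> ring_hom (free_alg G) (presented G P)"
  unfolding presented_def residue_def[abs_def] using ideal.rcos_ring_hom[OF rel_ideal_ideal[OF P]] .

text \<open>The kernel of \<^term>\<open>\<lambda>p. quotval H Q (free_lift f p)\<close> is an ideal, so it contains the relation ideal
as soon as it contains the relators.\<close>

lemma presented_hom:
  fixes f :: "'g \<Rightarrow> ('h, 'k::comm_ring_1) free_alg"
  assumes P: "P \<subseteq> carrier (free_alg G)" and Q: "Q \<subseteq> carrier (free_alg H)"
    and f: "\<And>g. g \<in> G \<Longrightarrow> in_alg H (f g)"
    and rel: "\<And>r. r \<in> P \<Longrightarrow> quotval H Q (free_lift f r) = 0"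
  shows "in_alg G p \<Longrightarrow> induced_map H Q f (residue G P p) = residue H Q (free_lift f p)"
    and "induced_map H Q f \<in> ring_hom (presented G P) (presented H Q)"
proof -
  interpret A: ring "free_alg G :: ('g, 'k) free_alg ring" by (rule free_alg_ring)
  interpret I: ideal "rel_ideal G P" "free_alg G" by (rule rel_ideal_ideal[OF P])
  have lift_in: "in_alg H (free_lift f p)" if "in_alg G p" for p
    using that f by (rule in_alg_free_lift)
  have hom: "ring_hom_ring (free_alg G) (free_alg H) (free_lift f)"
    by (intro ring_hom_ringI2 free_alg_ring ring_hom_memI) (auto simp: free_lift_hom lift_in)
  have "ideal {p \<in> carrier (free_alg G). free_lift f p \<in> rel_ideal H Q} (free_alg G)"
    using ring_hom_ring.ideal_vimage[OF hom rel_ideal_ideal[OF Q]] .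
  then have "rel_ideal G P \<subseteq> {p \<in> carrier (free_alg G). free_lift f p \<in> rel_ideal H Q}"
    unfolding rel_ideal_def[of G]
    using P quotval_eq_0_iff[OF Q] rel lift_in by (intro A.genideal_minimal) auto
  then have ker: "free_lift f r \<in> rel_ideal H Q" if "r \<in> rel_ideal G P" for r
    using that by blast
  have ind: "induced_map H Q f (residue G P p) = residue H Q (free_lift f p)" if p: "in_alg G p" for p
  proof -
    have eq: "residue H Q (free_lift f (r + p)) = residue H Q (free_lift f p)" if "r \<in> rel_ideal G P" for r
    proof -
      have r: "in_alg G r" using that I.Icarr by blast
      have "quotval H Q (free_lift f r) = 0"
        using quotval_eq_0_iff[OF Q lift_in[OF r]] ker[OF that] by simp
      then show ?thesis
        using residue_eq_iff[OF Q lift_in lift_in, of "r + p" p] r p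
        by (simp add: free_lift_hom quotval_hom)
    qed
    have "residue G P p = (\<lambda>r. r + p) ` rel_ideal G P"
      by (auto simp: residue_def a_r_coset_def' )
    then have "induced_map H Q f (residue G P p) = (\<Union>r\<in>rel_ideal G P. residue H Q (free_lift f (r + p)))"
      by (simp add: induced_map_def residue_def)
    also have "\<dots> = (\<Union>r\<in>rel_ideal G P. residue H Q (free_lift f p))"
      using eq by simp
    also have "\<dots> = residue H Q (free_lift f p)"
      using I.zero_closed by auto
    finally show ?thesis .
  qed
  then show "in_alg G p \<Longrightarrow> induced_map H Q f (residue G P p) = residue H Q (free_lift f p)" .
  note h = ring_hom_memE[OF residue_hom[OF P]] and h' = ring_hom_memE[OF residue_hom[OF Q]]
  show "induced_map H Q f \<in> ring_hom (presented G P) (presented H Q)"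
  proof (rule ring_hom_memI)
    fix x assume x: "x \<in> carrier (presented G P)"
    then obtain p where p: "in_alg G p" "x = residue G P p" by (auto simp: carrier_presented)
    then show "induced_map H Q f x \<in> carrier (presented H Q)"
      using lift_in by (auto simp: ind carrier_presented)
    fix y assume "y \<in> carrier (presented G P)"
    then obtain q where q: "in_alg G q" "y = residue G P q" by (auto simp: carrier_presented)
    have "x \<otimes>\<^bsub>presented G P\<^esub> y = residue G P (p * q)" "x \<oplus>\<^bsub>presented G P\<^esub> y = residue G P (p + q)"
      using p q h(2,3) by simp_all
    moreover have "induced_map H Q f x = residue H Q (free_lift f p)" "induced_map H Q f y = residue H Q (free_lift f q)"
      using p q ind by auto
    ultimately show
      "induced_map H Q f (x \<otimes>\<^bsub>presented G P\<^esub> y) = induced_map H Q f x \<otimes>\<^bsub>presented H Q\<^esub> induced_map H Q f y"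
      "induced_map H Q f (x \<oplus>\<^bsub>presented G P\<^esub> y) = induced_map H Q f x \<oplus>\<^bsub>presented H Q\<^esub> induced_map H Q f y"
      using p q ind h'(2,3)[OF lift_in lift_in] by (simp_all add: free_lift_hom)
  next
    have "\<one>\<^bsub>presented G P\<^esub> = residue G P 1" "\<one>\<^bsub>presented H Q\<^esub> = residue H Q 1"
      using h(4) h'(4) by simp_all
    then show "induced_map H Q f \<one>\<^bsub>presented G P\<^esub> = \<one>\<^bsub>presented H Q\<^esub>"
      by (simp add: ind free_lift_hom)
  qed
qed

lemma quotval_lift_eqI:
  assumes "in_alg G p"
    and "\<And>g. g \<in> G \<Longrightarrow> quotval H Q (f g) = quotval H Q (f' g)"
  shows "quotval H Q (free_lift f p) = quotval H Q (free_lift f' p)"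
  using assms by (induct p rule: free_alg_induct) (auto simp: free_lift_hom quotval_hom)

lemma free_lift_comp: "free_lift f (free_lift g p) = free_lift (\<lambda>x. free_lift f (g x)) p"
proof -
  have "in_alg UNIV p" by (simp add: in_alg_iff)
  then show ?thesis by (induct p rule: free_alg_induct) (auto simp: free_lift_hom)
qed

section \<open>Fractions with denominators \<open>h\<^sub>i - h\<^sub>j + k\<close>\<close>

abbreviation Pol :: "nat \<Rightarrow> 'k::comm_ring_1 hpoly set" where
  "Pol n \<equiv> carrier (hpoly_ring n)"

abbreviation Den :: "nat \<Rightarrow> 'k::comm_ring_1 hpoly set" where
  "Den n \<equiv> hdenoms n"

lemma hpoly_ring_simps [simp]:
  "monoid.mult (hpoly_ring n) = (*)" "ring.add (hpoly_ring n) = (+)" "monoid.one (hpoly_ring n) = 1"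
  "ring.zero (hpoly_ring n) = 0"
  by (simp_all add: hpoly_ring_def type_subring_def)

lemma Pol_iff: "p \<in> Pol n \<longleftrightarrow> (\<forall>m\<in>Poly_Mapping.keys p. Poly_Mapping.keys m \<subseteq> {1..n})"
  by (simp add: hpoly_ring_def type_subring_def)

lemma Pol_const [simp]: "Poly_Mapping.single 0 c \<in> Pol n"
  by (auto simp: Pol_iff)

lemma Pol_intros [simp, intro]:
  "0 \<in> Pol n" "1 \<in> Pol n"
  "p \<in> Pol n \<Longrightarrow> - p \<in> Pol n"
  "p \<in> Pol n \<Longrightarrow> q \<in> Pol n \<Longrightarrow> p + q \<in> Pol n"
  "p \<in> Pol n \<Longrightarrow> q \<in> Pol n \<Longrightarrow> p - q \<in> Pol n"
  "p \<in> Pol n \<Longrightarrow> q \<in> Pol n \<Longrightarrow> p * q \<in> Pol n"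
proof -
  show "p \<in> Pol n \<Longrightarrow> q \<in> Pol n \<Longrightarrow> p + q \<in> Pol n"
    using keys_add[of p q] unfolding Pol_iff by blast
  show "p \<in> Pol n \<Longrightarrow> q \<in> Pol n \<Longrightarrow> p - q \<in> Pol n"
    using keys_diff[of p q] unfolding Pol_iff by blast
  show "p * q \<in> Pol n" if "p \<in> Pol n" "q \<in> Pol n"
    unfolding Pol_iff
  proof
    fix m assume "m \<in> Poly_Mapping.keys (p * q)"
    then obtain a b where "m = a + b" "a \<in> Poly_Mapping.keys p" "b \<in> Poly_Mapping.keys q"
      using keys_mult[of p q] by blast
    then show "Poly_Mapping.keys m \<subseteq> {1..n}"
      using that keys_add[of a b] unfolding Pol_iff by blast
  qed
qed (auto simp: Pol_iff)

lemma Pol_sum [intro]: "(\<And>i. i \<in> A \<Longrightarrow> f i \<in> Pol n) \<Longrightarrow> sum f A \<in> Pol n"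
  by (induct A rule: infinite_finite_induct) auto

lemma Pol_prod [intro]: "(\<And>i. i \<in> A \<Longrightarrow> f i \<in> Pol n) \<Longrightarrow> prod f A \<in> Pol n"
  by (induct A rule: infinite_finite_induct) auto

lemma Pol_power [simp, intro]: "p \<in> Pol n \<Longrightarrow> p ^ k \<in> Pol n"
  by (induct k) auto

lemma Pol_of_int [simp]: "of_int k \<in> Pol n"
proof (induct k rule: int_induct[of _ 0])
qed auto

lemma Pol_hvar [simp]: "i \<in> {1..n} \<Longrightarrow> hvar i \<in> Pol n"
  by (auto simp: Pol_iff hvar_def)

lemma Pol_hdiff [simp]: "i \<in> {1..n} \<Longrightarrow> j \<in> {1..n} \<Longrightarrow> hdiff i j \<in> Pol n"
  unfolding hdiff_def by (intro Pol_intros Pol_hvar)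

lemma Den_Pol [simp]: "s \<in> Den n \<Longrightarrow> s \<in> Pol n"
  by (induct rule: hdenoms.induct) auto

lemma Den_one [simp]: "1 \<in> Den n"
  by (rule hdenoms.one)

lemma Den_mult [simp, intro]: "s \<in> Den n \<Longrightarrow> t \<in> Den n \<Longrightarrow> s * t \<in> Den n"
  by (induct rule: hdenoms.induct) (auto simp: mult.assoc hdenoms.mult)

lemma Den_prod [intro]: "(\<And>i. i \<in> A \<Longrightarrow> f i \<in> Den n) \<Longrightarrow> prod f A \<in> Den n"
  by (induct A rule: infinite_finite_induct) auto

lemma Den_hdiff_int [intro]:
  "i \<in> {1..n} \<Longrightarrow> j \<in> {1..n} \<Longrightarrow> i \<noteq> j \<Longrightarrow> hdiff i j + of_int k \<in> Den n"
  using hdenoms.mult[OF hdenoms.one, of i n j k] by simp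

lemma Den_hdiff [intro]:
  assumes "i \<in> {1..n}" "j \<in> {1..n}" "i \<noteq> j"
  shows "hdiff i j \<in> Den n" "hdiff i j + 1 \<in> Den n" "hdiff i j - 1 \<in> Den n"
  using Den_hdiff_int[OF assms, of 0] Den_hdiff_int[OF assms, of 1] Den_hdiff_int[OF assms, of "- 1"]
  by simp_all

lemma hsubst_mlift: "hsubst f = mlift (\<lambda>m. \<Prod>i\<in>Poly_Mapping.keys m. f i ^ Poly_Mapping.lookup m i)"
  by (simp add: fun_eq_iff hsubst_def mlift_def)

lemma hsubst_monomial_add:
  fixes f :: "nat \<Rightarrow> 'k::comm_ring_1 hpoly" and a b :: "nat \<Rightarrow>\<^sub>0 nat"
  shows "(\<Prod>i\<in>Poly_Mapping.keys (a + b). f i ^ Poly_Mapping.lookup (a + b) i) =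
    (\<Prod>i\<in>Poly_Mapping.keys a. f i ^ Poly_Mapping.lookup a i) *
    (\<Prod>i\<in>Poly_Mapping.keys b. f i ^ Poly_Mapping.lookup b i)"
proof -
  let ?A = "Poly_Mapping.keys a \<union> Poly_Mapping.keys b"
  have "(\<Prod>i\<in>Poly_Mapping.keys c. f i ^ Poly_Mapping.lookup c i) = (\<Prod>i\<in>?A. f i ^ Poly_Mapping.lookup c i)"
    if "Poly_Mapping.keys c \<subseteq> ?A" for c
    using that by (intro prod.mono_neutral_left) (auto simp: in_keys_iff)
  from this[of a] this[of b] this[of "a + b"] show ?thesis
    using keys_add[of a b] by (simp add: lookup_add power_add prod.distrib)
qed

lemma hsubst_hom:
  "hsubst f 0 = 0" "hsubst f 1 = 1"
  "hsubst f (p + q) = hsubst f p + hsubst f q"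
  "hsubst f (p - q) = hsubst f p - hsubst f q"
  "hsubst f (- p) = - hsubst f p"
  "hsubst f (p * q) = hsubst f p * hsubst f q"
  "hsubst f (Poly_Mapping.single 0 c) = Poly_Mapping.single 0 c"
  "hsubst f (hvar i) = f i"
  "hsubst f (sum F A) = (\<Sum>i\<in>A. hsubst f (F i))"
proof -
  show 1: "hsubst f 1 = 1"
    unfolding hsubst_mlift by (subst single_one[symmetric], subst mlift_scalar) auto
  show "hsubst f (hvar i) = f i"
    by (simp add: hsubst_mlift hvar_def mlift_single)
qed (simp_all add: hsubst_mlift mlift_add mlift_diff mlift_uminus mlift_sum mlift_scalar
    mlift_mult[OF hsubst_monomial_add])

lemma hsubst_power: "hsubst f (p ^ k) = hsubst f p ^ k"
  by (induct k) (auto simp: hsubst_hom)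

lemma hsubst_prod: "hsubst f (prod F A) = (\<Prod>i\<in>A. hsubst f (F i))"
  by (induct A rule: infinite_finite_induct) (auto simp: hsubst_hom)

lemma hsubst_of_int: "hsubst f (of_int k) = of_int k"
  by (induct k rule: int_induct[of _ 0]) (auto simp: hsubst_hom)

lemma hsubst_comp: "hsubst f (hsubst g p) = hsubst (\<lambda>i. hsubst f (g i)) p"
  unfolding hsubst_def[of g] hsubst_def[of "\<lambda>i. hsubst f (g i)"]
  by (simp add: hsubst_hom hsubst_prod hsubst_power)

lemma hsubst_Pol:
  assumes "p \<in> Pol n" "\<And>i. i \<in> {1..n} \<Longrightarrow> f i \<in> Pol m"
  shows "hsubst f p \<in> Pol m"
  unfolding hsubst_def using assms(1)
  by (intro Pol_sum Pol_intros Pol_prod Pol_power Pol_const assms(2)) (use Pol_iff in blast)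

lemma hsubst_hvar: "hsubst hvar p = p"
proof (induct p rule: poly_mapping_single_induct)
  case (add p m c)
  have *: "(\<Prod>i\<in>A. hvar i ^ Poly_Mapping.lookup m i) =
     (Poly_Mapping.single (\<Sum>i\<in>A. Poly_Mapping.single i (Poly_Mapping.lookup m i)) 1 :: 'a hpoly)" for A
  proof (induct A rule: infinite_finite_induct)
    case (insert x A)
    have "(hvar x ^ k :: 'a hpoly) = Poly_Mapping.single (Poly_Mapping.single x k) 1" for k
      by (induct k) (auto simp: hvar_def mult_single simp flip: single_add)
    with insert show ?case by (simp add: mult_single)
  qed simp_all
  have "(\<Sum>i\<in>Poly_Mapping.keys m. Poly_Mapping.single i (Poly_Mapping.lookup m i)) = m"
    by (intro poly_mapping_eqI) (auto simp: lookup_sum lookup_single when_def in_keys_iff)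
  with * have "hsubst hvar (Poly_Mapping.single m c :: 'a hpoly) = Poly_Mapping.single m c"
    by (simp add: hsubst_mlift mlift_single mult_single)
  with add show ?case by (simp add: hsubst_hom)
qed (simp add: hsubst_hom)

definition hshift :: "(nat \<Rightarrow> int) \<Rightarrow> 'k::comm_ring_1 hpoly \<Rightarrow> 'k hpoly" where
  "hshift e = hsubst (\<lambda>i. hvar i + of_int (e i))"

definition hperm :: "(nat \<Rightarrow> nat) \<Rightarrow> 'k::comm_ring_1 hpoly \<Rightarrow> 'k hpoly" where
  "hperm \<sigma> = hsubst (\<lambda>i. hvar (\<sigma> i))"

lemmas hshift_hom = hsubst_hom(1-7,9)[of "\<lambda>i. hvar i + of_int (e i)" for e, folded hshift_def]
  hsubst_power[of "\<lambda>i. hvar i + of_int (e i)" for e, folded hshift_def]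
  hsubst_prod[of "\<lambda>i. hvar i + of_int (e i)" for e, folded hshift_def]
  hsubst_of_int[of "\<lambda>i. hvar i + of_int (e i)" for e, folded hshift_def]

lemmas hperm_hom = hsubst_hom(1-7,9)[of "\<lambda>i. hvar (\<sigma> i)" for \<sigma>, folded hperm_def]
  hsubst_power[of "\<lambda>i. hvar (\<sigma> i)" for \<sigma>, folded hperm_def]
  hsubst_prod[of "\<lambda>i. hvar (\<sigma> i)" for \<sigma>, folded hperm_def]
  hsubst_of_int[of "\<lambda>i. hvar (\<sigma> i)" for \<sigma>, folded hperm_def]

lemma hshift_hdiff: "hshift e (hdiff i j) = hdiff i j + of_int (e i - e j)"
  by (simp add: hdiff_def hshift_def hsubst_hom)

lemma hperm_hdiff: "hperm \<sigma> (hdiff i j) = hdiff (\<sigma> i) (\<sigma> j)"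
  by (simp add: hdiff_def hperm_def hsubst_hom)

lemma hshift_hshift: "hshift e (hshift e' p) = hshift (\<lambda>i. e i + e' i) p"
  unfolding hshift_def hsubst_comp by (simp add: hsubst_hom hsubst_of_int add.assoc)

lemma hshift_zero: "hshift (\<lambda>_. 0) p = p"
  by (simp add: hshift_def hsubst_hvar)

lemma hperm_hperm: "hperm \<sigma> (hperm \<tau> p) = hperm (\<sigma> \<circ> \<tau>) p"
  unfolding hperm_def hsubst_comp by (simp add: hsubst_hom)

lemma hperm_id: "hperm id p = p"
  by (simp add: hperm_def hsubst_hvar)

lemma hshift_hperm: "hshift e (hperm \<sigma> p) = hperm \<sigma> (hshift (\<lambda>i. e (\<sigma> i)) p)"
  unfolding hshift_def hperm_def hsubst_comp by (simp add: hsubst_hom hsubst_of_int)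

lemma hshift_Pol [simp, intro]: "p \<in> Pol n \<Longrightarrow> hshift e p \<in> Pol n"
  unfolding hshift_def by (rule hsubst_Pol) auto

lemma hshift_Den [simp, intro]: "s \<in> Den n \<Longrightarrow> hshift e s \<in> Den n"
proof (induct rule: hdenoms.induct)
  case (mult s i j k)
  have "hshift e ((hdiff i j + of_int k) * s) = (hdiff i j + of_int (e i - e j + k)) * hshift e s"
    by (simp add: hshift_hom hshift_hdiff algebra_simps)
  then show ?case using hdenoms.mult[OF mult(2-5)] by (simp only:)
qed (simp add: hshift_hom)

lemma hperm_Pol [simp, intro]: "\<sigma> permutes {1..n} \<Longrightarrow> p \<in> Pol n \<Longrightarrow> hperm \<sigma> p \<in> Pol n"
  unfolding hperm_def by (rule hsubst_Pol) (auto simp: permutes_in_image simp del: atLeastAtMost_iff)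

lemma hperm_Den [simp, intro]:
  assumes "\<sigma> permutes {1..n}" "s \<in> Den n"
  shows "hperm \<sigma> s \<in> Den n"
  using assms(2)
proof (induct s rule: hdenoms.induct)
  case (mult s i j k)
  have "hperm \<sigma> ((hdiff i j + of_int k) * s) = (hdiff (\<sigma> i) (\<sigma> j) + of_int k) * hperm \<sigma> s"
    by (simp add: hperm_hom hperm_hdiff)
  moreover have "\<sigma> i \<noteq> \<sigma> j" "\<sigma> i \<in> {1..n}" "\<sigma> j \<in> {1..n}"
    using mult assms(1) permutes_inj[of \<sigma>] by (auto simp: inj_eq permutes_in_image simp del: atLeastAtMost_iff)
  ultimately show ?case using hdenoms.mult[OF mult(2)] by (simp only:)
qed (simp add: hperm_hom)

abbreviation frel :: "nat \<Rightarrow> (('k::comm_ring_1 hpoly \<times> 'k hpoly) \<times> 'k hpoly \<times> 'k hpoly) set" where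
  "frel n \<equiv> loc_rel (hpoly_ring n) (Den n)"

lemma frel_iff: "((a, s), (b, t)) \<in> frel n \<longleftrightarrow>
    a \<in> Pol n \<and> b \<in> Pol n \<and> s \<in> Den n \<and> t \<in> Den n \<and> (\<exists>u\<in>Den n. u * (a * t) = u * (b * s))"
  by (auto simp: loc_rel_def)

lemma frel_trans: "trans (frel n :: (('k::comm_ring_1 hpoly \<times> 'k hpoly) \<times> 'k hpoly \<times> 'k hpoly) set)"
proof (rule transI)
  fix x y z :: "'k hpoly \<times> 'k hpoly"
  assume "(x, y) \<in> frel n" "(y, z) \<in> frel n"
  moreover obtain a s b t c r where xyz: "x = (a, s)" "y = (b, t)" "z = (c, r)" by (metis surj_pair)
  ultimately have *: "((a, s), (b, t)) \<in> frel n" "((b, t), (c, r)) \<in> frel n" by simp_all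
  from * obtain u v where uv: "u \<in> Den n" "v \<in> Den n"
    "u * (a * t) = u * (b * s)" "v * (b * r) = v * (c * t)"
    unfolding frel_iff by blast
  have "(u * v * t) * (a * r) = (u * (a * t)) * (v * r)" by (simp add: mult_ac)
  also have "\<dots> = (v * (b * r)) * (u * s)" unfolding uv(3) by (simp only: mult_ac)
  also have "\<dots> = (u * v * t) * (c * s)" unfolding uv(4) by (simp only: mult_ac)
  finally have "(u * v * t) * (a * r) = (u * v * t) * (c * s)" .
  moreover have "u * v * t \<in> Den n" using uv * by (auto simp: frel_iff)
  ultimately show "(x, z) \<in> frel n" using * unfolding xyz frel_iff by blast
qed

lemma frel_equiv: "equiv (Pol n \<times> Den n) (frel n :: ((('k::comm_ring_1 hpoly \<times> 'k hpoly) \<times> 'k hpoly \<times> 'k hpoly) set))"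
proof (rule equivI)
  show "frel n \<subseteq> (Pol n \<times> Den n) \<times> (Pol n \<times> Den n)"
    by (auto simp: loc_rel_def)
  show "refl_on (Pol n \<times> Den n) (frel n)"
    by (auto simp: refl_on_def frel_iff intro: Den_one)
  show "sym (frel n)"
    by (auto simp: sym_def frel_iff) (metis)
qed (rule frel_trans)

lemma ufrac_eq:
  assumes "p \<in> Pol n" "q \<in> Pol n" "s \<in> Den n" "t \<in> Den n" "p * t = q * s"
  shows "ufrac n p s = ufrac n q t"
  unfolding ufrac_def loc_frac_def
  using assms Den_one[of n] by (intro equiv_class_eq[OF frel_equiv]) (auto simp: frel_iff)

lemma ufrac_eq_rel:
  assumes "((p, s), (q, t)) \<in> frel n"
  shows "ufrac n p s = ufrac n q t"
  unfolding ufrac_def loc_frac_def using assms by (rule equiv_class_eq[OF frel_equiv])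

lemma carrier_Ubar: "carrier (Ubar n) = {ufrac n p s | p s. p \<in> Pol n \<and> s \<in> Den n}"
  unfolding Ubar_def localization_def ufrac_def loc_frac_def quotient_def by auto

lemma ufrac_carrier [simp, intro]: "p \<in> Pol n \<Longrightarrow> s \<in> Den n \<Longrightarrow> ufrac n p s \<in> carrier (Ubar n)"
  by (auto simp: carrier_Ubar)

text \<open>The operations of a localization are unions over all representatives. If the summand is independent
of the representatives, the union is the common value.\<close>

lemma UN_ufrac:
  assumes "p \<in> Pol n" "s \<in> Den n"
    and "\<And>a t. ((p, s), (a, t)) \<in> frel n \<Longrightarrow> g a t = K"
  shows "(\<Union>(a, t)\<in>ufrac n p s. g a t) = K"
proof -
  have mem: "(a, t) \<in> ufrac n p s \<longleftrightarrow> ((p, s), (a, t)) \<in> frel n" for a t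
    by (simp add: ufrac_def loc_frac_def)
  have "(p, s) \<in> ufrac n p s"
    using assms(1,2) unfolding mem frel_iff by (auto intro: Den_one)
  then show ?thesis using assms(3) mem by blast
qed

lemma ufrac_mult:
  assumes "p \<in> Pol n" "q \<in> Pol n" "s \<in> Den n" "t \<in> Den n"
  shows "ufrac n p s \<otimes>\<^bsub>Ubar n\<^esub> ufrac n q t = ufrac n (p * q) (s * t)"
proof -
  have "ufrac n (a * b) (u * v) = ufrac n (p * q) (s * t)"
    if rel: "((p, s), (a, u)) \<in> frel n" "((q, t), (b, v)) \<in> frel n" for a u b v
  proof (rule ufrac_eq_rel[symmetric])
    from rel obtain x y where xy: "x \<in> Den n" "y \<in> Den n"
      "x * (p * u) = x * (a * s)" "y * (q * v) = y * (b * t)" unfolding frel_iff by blast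
    have "(x * y) * ((p * q) * (u * v)) = (x * (p * u)) * (y * (q * v))" by (simp add: mult_ac)
    also have "\<dots> = (x * y) * ((a * b) * (s * t))" unfolding xy by (simp add: mult_ac)
    finally show "((p * q, s * t), (a * b, u * v)) \<in> frel n"
      using rel Den_mult[OF xy(1,2)] unfolding frel_iff by blast
  qed
  then have *: "(\<Union>(b, v)\<in>ufrac n q t. ufrac n (a * b) (u * v)) = ufrac n (p * q) (s * t)"
    if "((p, s), (a, u)) \<in> frel n" for a u
    using that assms by (intro UN_ufrac) auto
  have "(\<Union>(a, u)\<in>ufrac n p s. \<Union>(b, v)\<in>ufrac n q t. ufrac n (a * b) (u * v)) = ufrac n (p * q) (s * t)"
    by (rule UN_ufrac[OF assms(1,3) *])
  then show ?thesis
    by (simp add: Ubar_def localization_def ufrac_def)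
qed

lemma ufrac_add:
  assumes "p \<in> Pol n" "q \<in> Pol n" "s \<in> Den n" "t \<in> Den n"
  shows "ufrac n p s \<oplus>\<^bsub>Ubar n\<^esub> ufrac n q t = ufrac n (p * t + q * s) (s * t)"
proof -
  have "ufrac n (a * v + b * u) (u * v) = ufrac n (p * t + q * s) (s * t)"
    if rel: "((p, s), (a, u)) \<in> frel n" "((q, t), (b, v)) \<in> frel n" for a u b v
  proof (rule ufrac_eq_rel[symmetric])
    from rel obtain x y where xy: "x \<in> Den n" "y \<in> Den n"
      "x * (p * u) = x * (a * s)" "y * (q * v) = y * (b * t)" unfolding frel_iff by blast
    have "(x * y) * ((p * t + q * s) * (u * v))
      = (x * (p * u)) * (y * t * v) + (y * (q * v)) * (x * s * u)" by (simp add: algebra_simps)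
    also have "\<dots> = (x * y) * ((a * v + b * u) * (s * t))"
      unfolding xy by (simp add: algebra_simps)
    finally have "(x * y) * ((p * t + q * s) * (u * v)) = (x * y) * ((a * v + b * u) * (s * t))" .
    moreover have "x * y \<in> Den n" using xy by auto
    ultimately show "((p * t + q * s, s * t), (a * v + b * u, u * v)) \<in> frel n"
      using rel unfolding frel_iff by (blast intro: Pol_intros Den_Pol Den_mult)
  qed
  then have *: "(\<Union>(b, v)\<in>ufrac n q t. ufrac n (a * v + b * u) (u * v)) = ufrac n (p * t + q * s) (s * t)"
    if "((p, s), (a, u)) \<in> frel n" for a u
    using that assms by (intro UN_ufrac) auto
  have "(\<Union>(a, u)\<in>ufrac n p s. \<Union>(b, v)\<in>ufrac n q t. ufrac n (a * v + b * u) (u * v))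
      = ufrac n (p * t + q * s) (s * t)"
    by (rule UN_ufrac[OF assms(1,3) *])
  then show ?thesis
    by (simp add: Ubar_def localization_def ufrac_def)
qed

lemma loc_map_ufrac:
  assumes ps: "p \<in> Pol n" "s \<in> Den n" and f: "\<And>p. p \<in> Pol n \<Longrightarrow> hsubst f p \<in> Pol n"
    "\<And>s. s \<in> Den n \<Longrightarrow> hsubst f s \<in> Den n"
  shows "loc_map (hpoly_ring n) (Den n) (hsubst f) (ufrac n p s) = ufrac n (hsubst f p) (hsubst f s)"
proof -
  have "ufrac n (hsubst f a) (hsubst f t) = ufrac n (hsubst f p) (hsubst f s)"
    if rel: "((p, s), (a, t)) \<in> frel n" for a t
  proof (rule ufrac_eq_rel[symmetric])
    from rel obtain x where x: "x \<in> Den n" "x * (p * t) = x * (a * s)" unfolding frel_iff by blast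
    then have "hsubst f x * (hsubst f p * hsubst f t) = hsubst f x * (hsubst f a * hsubst f s)"
      by (metis hsubst_hom(6))
    then show "((hsubst f p, hsubst f s), (hsubst f a, hsubst f t)) \<in> frel n"
      using rel x(1) f unfolding frel_iff by blast
  qed
  then show ?thesis
    unfolding loc_map_def using ps by (fold ufrac_def) (rule UN_ufrac)
qed

lemma ushift_ufrac:
  assumes "p \<in> Pol n" "s \<in> Den n"
  shows "ushift n e (ufrac n p s) = ufrac n (hshift e p) (hshift e s)"
  unfolding ushift_def hshift_def
  by (rule loc_map_ufrac[OF assms]) (use hshift_Pol hshift_Den in \<open>simp_all add: hshift_def\<close>)

lemma uperm_ufrac:
  assumes "p \<in> Pol n" "s \<in> Den n" "\<sigma> permutes {1..n}"
  shows "uperm n \<sigma> (ufrac n p s) = ufrac n (hperm \<sigma> p) (hperm \<sigma> s)"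
  unfolding uperm_def hperm_def
  by (rule loc_map_ufrac[OF assms(1,2)]) (use hperm_Pol hperm_Den assms in \<open>simp_all add: hperm_def\<close>)

section \<open>The symmetric form of the R-matrix\<close>

text \<open>The substitution that results from moving a coefficient past \<open>x\<^sup>i\<close> from right to left, or past
\<open>\<partial>\<^sub>i\<close> from left to right.\<close>

abbreviation sh :: "nat \<Rightarrow> 'k::comm_ring_1 hpoly \<Rightarrow> 'k hpoly" where
  "sh i \<equiv> hshift (\<lambda>l. - eps i l)"

definition chi :: "nat \<Rightarrow> nat \<Rightarrow> 'k::comm_ring_1 hpoly" where
  "chi n i = (\<Prod>k\<in>{i<..n}. hdiff i k - 1)"

definition gauge :: "nat \<Rightarrow> nat \<Rightarrow> nat \<Rightarrow> 'k::comm_ring_1 hpoly" where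
  "gauge n i j = chi n i * sh i (chi n j)"

lemma chi_Den [simp, intro]: "i \<in> {1..n} \<Longrightarrow> chi n i \<in> Den n"
  unfolding chi_def by (intro Den_prod Den_hdiff) auto

text \<open>For \<open>i < j\<close> the shift by \<open>-\<epsilon>\<^sub>i\<close> leaves \<open>\<chi>\<^sub>j\<close> unchanged, whereas the shift by \<open>-\<epsilon>\<^sub>j\<close> changes exactly one factor
of \<open>\<chi>\<^sub>i\<close>, from \<open>h\<^sub>i\<^sub>j - 1\<close> to \<open>h\<^sub>i\<^sub>j\<close>.\<close>

lemma gauge_swap:
  assumes "i \<in> {1..n}" "j \<in> {1..n}" "i < j"
  shows "(hdiff i j - 1) * gauge n j i = hdiff i j * (gauge n i j :: 'k::comm_ring_1 hpoly)"
proof -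
  have a: "sh i (chi n j) = (chi n j :: 'k hpoly)"
    unfolding chi_def using assms(3)
    by (auto simp: hshift_hom hshift_hdiff eps_def intro!: prod.cong)
  have j: "j \<in> {i<..n}" using assms by auto
  have "sh j (chi n i) = (\<Prod>k\<in>{i<..n}. if k = j then hdiff i j else hdiff i k - 1 :: 'k hpoly)"
    unfolding chi_def hshift_hom using assms(3)
    by (auto simp: hshift_hom hshift_hdiff eps_def intro!: prod.cong)
  also have "\<dots> = hdiff i j * (\<Prod>k\<in>{i<..n} - {j}. hdiff i k - 1)"
    by (subst prod.remove[OF _ j]) (auto intro!: prod.cong)
  finally have "(hdiff i j - 1) * sh j (chi n i) = hdiff i j * (chi n i :: 'k hpoly)"
    unfolding chi_def by (subst (2) prod.remove[OF _ j]) (auto simp: mult_ac)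
  then have "(hdiff i j - 1) * sh j (chi n i) * chi n j = hdiff i j * (chi n i :: 'k hpoly) * chi n j"
    by simp
  then show ?thesis
    unfolding gauge_def a by (simp add: mult_ac)
qed

text \<open>Numerators and denominators of the entries of \<open>R\<close>. Identities between entries thus become
polynomial identities, obtained by cross-multiplication.\<close>

definition Rn :: "nat \<Rightarrow> nat \<Rightarrow> nat \<Rightarrow> nat \<Rightarrow> 'k::comm_ring_1 hpoly" where
  "Rn i j k l = (if i \<noteq> j \<and> k = i \<and> l = j then 1
     else if k = j \<and> l = i then (if i < j then (hdiff i j)\<^sup>2 - 1 else 1) else 0)"

definition Rd :: "nat \<Rightarrow> nat \<Rightarrow> nat \<Rightarrow> nat \<Rightarrow> 'k::comm_ring_1 hpoly" where
  "Rd i j k l = (if i \<noteq> j \<and> k = i \<and> l = j then hdiff i j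
     else if k = j \<and> l = i then (if i < j then (hdiff i j)\<^sup>2 else 1) else 1)"

text \<open>Numerators and denominators of the entries of \<open>G\<^bsup>-1\<^esup> R G\<close>.\<close>

definition Tn :: "nat \<Rightarrow> nat \<Rightarrow> nat \<Rightarrow> nat \<Rightarrow> 'k::comm_ring_1 hpoly" where
  "Tn i j k l = (if i \<noteq> j \<and> k = i \<and> l = j then 1
     else if k = j \<and> l = i then (if i \<noteq> j then hdiff i j + 1 else 1) else 0)"

definition Td :: "nat \<Rightarrow> nat \<Rightarrow> nat \<Rightarrow> nat \<Rightarrow> 'k::comm_ring_1 hpoly" where
  "Td i j k l = (if i \<noteq> j \<and> (k = i \<and> l = j \<or> k = j \<and> l = i) then hdiff i j else 1)"

lemma Rhat_ufrac: "Rhat n i j k l = ufrac n (Rn i j k l) (Rd i j k l)"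
proof -
  have *: "(if A then u c x else if B then (if C then u y z else u c c) else u d c)
    = u (if A then c else if B then (if C then y else c) else d)
        (if A then x else if B then (if C then z else c) else c)"
    for A B C and u :: "'a hpoly \<Rightarrow> 'a hpoly \<Rightarrow> 'a ubar" and c d x y z
    by simp
  show ?thesis unfolding Rhat_def Rn_def Rd_def by (rule *)
qed

lemma RT_Pol [simp, intro]:
  assumes "i \<in> {1..n}" "j \<in> {1..n}"
  shows "Rn i j k l \<in> Pol n" "Rd i j k l \<in> Den n" "Tn i j k l \<in> Pol n" "Td i j k l \<in> Den n"
  using assms
  by (simp_all add: Rn_def Rd_def Tn_def Td_def power2_eq_square Den_hdiff del: atLeastAtMost_iff)

lemma gauge_swap_arith:
  fixes H g g' :: "'a::comm_ring_1"
  shows "(H - 1) * g' = H * g \<Longrightarrow> (H + 1) * H\<^sup>2 * g = (H\<^sup>2 - 1) * g' * H"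
    and "(- H - 1) * g = - H * g' \<Longrightarrow> (H + 1) * g = g' * H"
proof -
  assume *: "(H - 1) * g' = H * g"
  have "(H + 1) * H\<^sup>2 * g = (H + 1) * H * (H * g)" by (simp add: power2_eq_square mult_ac)
  also have "\<dots> = (H + 1) * H * ((H - 1) * g')" by (simp only: *)
  also have "\<dots> = (H\<^sup>2 - 1) * g' * H" by (simp add: power2_eq_square algebra_simps)
  finally show "(H + 1) * H\<^sup>2 * g = (H\<^sup>2 - 1) * g' * H" .
next
  assume "(- H - 1) * g = - H * g'"
  then have "- ((H + 1) * g) = - (g' * H)" by (simp add: algebra_simps)
  then show "(H + 1) * g = g' * H" by (simp only: neg_equal_iff_equal)
qed

text \<open>The off-diagonal entries of \<open>R\<close> depend on the order of \<open>i\<close> and \<open>j\<close>, and so does the ratio of the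
entries of \<open>G\<close> at \<open>(i, j)\<close> and \<open>(j, i)\<close>; the two dependences cancel.\<close>

lemma gauge_RT:
  assumes "i \<in> {1..n}" "j \<in> {1..n}"
  shows "Tn i j k l * Rd i j k l * gauge n i j
    = Rn i j k l * gauge n k l * (Td i j k l :: 'k::comm_ring_1 hpoly)"
proof -
  consider "i = j" | "i \<noteq> j" "k = i" "l = j" | "i \<noteq> j" "k = j" "l = i"
    | "i \<noteq> j" "\<not> (k = i \<and> l = j)" "\<not> (k = j \<and> l = i)" by blast
  then show ?thesis
  proof cases
    case 3
    show ?thesis
    proof (cases "i < j")
      case True
      show ?thesis using 3 True gauge_swap_arith(1)[OF gauge_swap[OF assms True]]
        by (simp add: Tn_def Td_def Rn_def Rd_def)
    next
      case False
      then have "j < i" using 3 by simp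
      have d: "hdiff j i = (- hdiff i j :: 'k hpoly)" by (simp add: hdiff_def)
      have "(hdiff i j + 1) * gauge n i j = gauge n j i * (hdiff i j :: 'k hpoly)"
        using gauge_swap[OF assms(2,1) \<open>j < i\<close>, where 'k='k] unfolding d by (rule gauge_swap_arith(2))
      then show ?thesis using 3 False by (simp add: Tn_def Td_def Rn_def Rd_def)
    qed
  qed (auto simp: Tn_def Td_def Rn_def Rd_def)
qed

lemma hperm_T:
  assumes "inj \<sigma>"
  shows "hperm \<sigma> (Tn i j k l) = Tn (\<sigma> i) (\<sigma> j) (\<sigma> k) (\<sigma> l)"
    "hperm \<sigma> (Td i j k l) = Td (\<sigma> i) (\<sigma> j) (\<sigma> k) (\<sigma> l)"
  using inj_eq[OF assms] by (simp_all add: Tn_def Td_def hperm_hom hperm_hdiff) auto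

lemma sh_sh_hdiff: "sh i (sh j (hdiff i j)) = hdiff i j" "sh j (sh i (hdiff i j)) = hdiff i j"
  by (simp_all add: hshift_hdiff hshift_hom eps_def)

text \<open>The nonzero entries of \<open>R\<close> depend on \<open>h\<^sub>i - h\<^sub>j\<close> only and therefore commute with \<open>\<partial>\<^sub>i \<partial>\<^sub>j\<close>. This
allows the coefficients in the relations among the \<open>\<partial>\<close> to be written on the right.\<close>

lemma sh_sh_R:
  assumes "Rn i j k l \<noteq> (0 :: 'k::comm_ring_1 hpoly)"
  shows "sh i (sh j (Rn i j k l)) = (Rn i j k l :: 'k hpoly)"
    "sh i (sh j (Rd i j k l)) = (Rd i j k l :: 'k hpoly)"
  by (simp_all only: Rn_def Rd_def hshift_hom sh_sh_hdiff if_distrib[of "hshift _"])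

section \<open>Exchange relations and the reflection equation\<close>

subsection \<open>Exchange relations\<close>

definition xx_rel :: "nat set \<Rightarrow> nat set \<Rightarrow> 'r::ring_1 mat4 \<Rightarrow> (nat \<Rightarrow> nat \<Rightarrow> 'r) \<Rightarrow> bool" where
  "xx_rel I A T X \<longleftrightarrow> (\<forall>i\<in>I. \<forall>j\<in>I. \<forall>\<alpha>\<in>A. \<forall>\<beta>\<in>A.
     X i \<alpha> * X j \<beta> = (\<Sum>k\<in>I. \<Sum>l\<in>I. T i j k l * X k \<beta> * X l \<alpha>))"

text \<open>With the coefficients to the right of the \<open>\<partial>\<close> here, and between \<open>\<partial>\<close> and \<open>x\<close> below, a rescaling of
the generators conjugates the matrix \<open>T\<close> without shifting its entries.\<close>

definition dd_rel :: "nat set \<Rightarrow> nat set \<Rightarrow> 'r::ring_1 mat4 \<Rightarrow> (nat \<Rightarrow> nat \<Rightarrow> 'r) \<Rightarrow> bool" where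
  "dd_rel I A T D \<longleftrightarrow> (\<forall>i\<in>I. \<forall>j\<in>I. \<forall>\<alpha>\<in>A. \<forall>\<beta>\<in>A.
     D i \<alpha> * D j \<beta> = (\<Sum>k\<in>I. \<Sum>l\<in>I. D k \<beta> * D l \<alpha> * T l k j i))"

definition xd_rel :: "nat set \<Rightarrow> nat set \<Rightarrow> 'r::ring_1 \<Rightarrow> 'r mat4 \<Rightarrow> (nat \<Rightarrow> nat \<Rightarrow> 'r)
    \<Rightarrow> (nat \<Rightarrow> nat \<Rightarrow> 'r) \<Rightarrow> bool" where
  "xd_rel I A e T X D \<longleftrightarrow> (\<forall>i\<in>I. \<forall>j\<in>I. \<forall>\<alpha>\<in>A. \<forall>\<beta>\<in>A.
     X i \<alpha> * D j \<beta> = (\<Sum>k\<in>I. \<Sum>l\<in>I. D k \<beta> * T k i l j * X l \<alpha>)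
       - (if \<alpha> = \<beta> \<and> i = j then e else 0))"

text \<open>Moving the factors \<open>V\<close> to the front multiplies \<open>X\<^sub>i X\<^sub>j\<close> by \<open>V\<^sub>i V'\<^sub>i\<^sub>j\<close>, where \<open>V'\<^sub>i\<^sub>j\<close> is \<open>V\<^sub>j\<close> after
passing \<open>X\<^sub>i\<close>. Hence the coefficient matrix is conjugated by the diagonal matrix of these products.\<close>

lemma xx_rel_gauge:
  assumes rel: "xx_rel I A T X"
    and VX: "\<And>i j \<alpha>. i \<in> I \<Longrightarrow> j \<in> I \<Longrightarrow> \<alpha> \<in> A \<Longrightarrow> X i \<alpha> * V j = V' i j * X i \<alpha>"
    and VT: "\<And>i j k l. i \<in> I \<Longrightarrow> j \<in> I \<Longrightarrow> k \<in> I \<Longrightarrow> l \<in> I \<Longrightarrow>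
      T' i j k l * (V k * V' k l) = V i * V' i j * T i j k l"
  shows "xx_rel I A T' (\<lambda>i \<alpha>. V i * X i \<alpha>)"
  unfolding xx_rel_def
proof (intro ballI)
  fix i j \<alpha> \<beta> assume *: "i \<in> I" "j \<in> I" "\<alpha> \<in> A" "\<beta> \<in> A"
  have move: "V k * X k \<gamma> * (V l * X l \<delta>) = V k * V' k l * (X k \<gamma> * X l \<delta>)"
    if "k \<in> I" "l \<in> I" "\<gamma> \<in> A" for k l \<gamma> \<delta>
    using VX[OF that] by (metis mult.assoc)
  have "V i * X i \<alpha> * (V j * X j \<beta>) = V i * V' i j * (X i \<alpha> * X j \<beta>)"
    using * by (intro move)
  also have "X i \<alpha> * X j \<beta> = (\<Sum>k\<in>I. \<Sum>l\<in>I. T i j k l * X k \<beta> * X l \<alpha>)"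
    using rel * unfolding xx_rel_def by blast
  also have "V i * V' i j * \<dots> = (\<Sum>k\<in>I. \<Sum>l\<in>I. (V i * V' i j * T i j k l) * (X k \<beta> * X l \<alpha>))"
    by (simp add: sum_distrib_left mult.assoc)
  also have "\<dots> = (\<Sum>k\<in>I. \<Sum>l\<in>I. T' i j k l * (V k * X k \<beta>) * (V l * X l \<alpha>))"
  proof (intro sum.cong refl)
    fix k l assume kl: "k \<in> I" "l \<in> I"
    show "V i * V' i j * T i j k l * (X k \<beta> * X l \<alpha>) = T' i j k l * (V k * X k \<beta>) * (V l * X l \<alpha>)"
      using VT[OF *(1,2) kl] move[OF kl *(4)] by (metis mult.assoc)
  qed
  finally show "V i * X i \<alpha> * (V j * X j \<beta>)
    = (\<Sum>k\<in>I. \<Sum>l\<in>I. T' i j k l * (V k * X k \<beta>) * (V l * X l \<alpha>))" .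
qed

lemma dd_rel_gauge:
  assumes rel: "dd_rel I A T D"
    and WD: "\<And>i j \<alpha>. i \<in> I \<Longrightarrow> j \<in> I \<Longrightarrow> \<alpha> \<in> A \<Longrightarrow> W j * D i \<alpha> = D i \<alpha> * W' i j"
    and WT: "\<And>i j k l. i \<in> I \<Longrightarrow> j \<in> I \<Longrightarrow> k \<in> I \<Longrightarrow> l \<in> I \<Longrightarrow>
      T l k j i * (W' j i * W j) = W' l k * W l * T' l k j i"
  shows "dd_rel I A T' (\<lambda>i \<alpha>. D i \<alpha> * W i)"
  unfolding dd_rel_def
proof (intro ballI)
  fix i j \<alpha> \<beta> assume *: "i \<in> I" "j \<in> I" "\<alpha> \<in> A" "\<beta> \<in> A"
  have move: "D k \<gamma> * W k * (D l \<delta> * W l) = D k \<gamma> * D l \<delta> * (W' l k * W l)"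
    if "l \<in> I" "k \<in> I" "\<delta> \<in> A" for k l \<gamma> \<delta>
    using WD[OF that] by (metis mult.assoc)
  have "D i \<alpha> * W i * (D j \<beta> * W j) = D i \<alpha> * D j \<beta> * (W' j i * W j)"
    using * by (intro move)
  also have "D i \<alpha> * D j \<beta> = (\<Sum>k\<in>I. \<Sum>l\<in>I. D k \<beta> * D l \<alpha> * T l k j i)"
    using rel * unfolding dd_rel_def by blast
  also have "\<dots> * (W' j i * W j) = (\<Sum>k\<in>I. \<Sum>l\<in>I. (D k \<beta> * D l \<alpha>) * (T l k j i * (W' j i * W j)))"
    by (simp add: sum_distrib_right mult.assoc)
  also have "\<dots> = (\<Sum>k\<in>I. \<Sum>l\<in>I. (D k \<beta> * W k) * (D l \<alpha> * W l) * T' l k j i)"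
  proof (intro sum.cong refl)
    fix k l assume kl: "k \<in> I" "l \<in> I"
    show "(D k \<beta> * D l \<alpha>) * (T l k j i * (W' j i * W j)) = (D k \<beta> * W k) * (D l \<alpha> * W l) * T' l k j i"
      using WT[OF *(1,2) kl] move[OF kl(2,1) *(3)] by (metis mult.assoc)
  qed
  finally show "D i \<alpha> * W i * (D j \<beta> * W j)
    = (\<Sum>k\<in>I. \<Sum>l\<in>I. (D k \<beta> * W k) * (D l \<alpha> * W l) * T' l k j i)" .
qed

lemma xd_rel_gauge:
  assumes rel: "xd_rel I A e T X D"
    and VD: "\<And>i k \<beta>. i \<in> I \<Longrightarrow> k \<in> I \<Longrightarrow> \<beta> \<in> A \<Longrightarrow> V i * D k \<beta> = D k \<beta> * V' k i"
    and XW: "\<And>l j \<alpha>. l \<in> I \<Longrightarrow> j \<in> I \<Longrightarrow> \<alpha> \<in> A \<Longrightarrow> X l \<alpha> * W j = W' l j * X l \<alpha>"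
    and T': "\<And>i j k l. i \<in> I \<Longrightarrow> j \<in> I \<Longrightarrow> k \<in> I \<Longrightarrow> l \<in> I \<Longrightarrow>
      W k * T' k i l j * V l = V' k i * T k i l j * W' l j"
    and e: "\<And>i. i \<in> I \<Longrightarrow> V i * e * W i = e"
  shows "xd_rel I A e T' (\<lambda>i \<alpha>. V i * X i \<alpha>) (\<lambda>i \<alpha>. D i \<alpha> * W i)"
  unfolding xd_rel_def
proof (intro ballI)
  fix i j \<alpha> \<beta> assume *: "i \<in> I" "j \<in> I" "\<alpha> \<in> A" "\<beta> \<in> A"
  have "V i * X i \<alpha> * (D j \<beta> * W j) = V i * (X i \<alpha> * D j \<beta>) * W j"
    by (simp add: mult.assoc)
  also have "X i \<alpha> * D j \<beta> = (\<Sum>k\<in>I. \<Sum>l\<in>I. D k \<beta> * T k i l j * X l \<alpha>)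
       - (if \<alpha> = \<beta> \<and> i = j then e else 0)"
    using rel * unfolding xd_rel_def by blast
  also have "V i * \<dots> * W j = (\<Sum>k\<in>I. \<Sum>l\<in>I. (V i * D k \<beta>) * T k i l j * (X l \<alpha> * W j))
       - (if \<alpha> = \<beta> \<and> i = j then e else 0)"
    using e[OF *(1)] by (auto simp: sum_distrib_left sum_distrib_right mult.assoc
        left_diff_distrib right_diff_distrib)
  also have "(\<Sum>k\<in>I. \<Sum>l\<in>I. (V i * D k \<beta>) * T k i l j * (X l \<alpha> * W j))
    = (\<Sum>k\<in>I. \<Sum>l\<in>I. D k \<beta> * W k * T' k i l j * (V l * X l \<alpha>))"
  proof (intro sum.cong refl)
    fix k l assume kl: "k \<in> I" "l \<in> I"
    have "(V i * D k \<beta>) * T k i l j * (X l \<alpha> * W j) = D k \<beta> * (V' k i * T k i l j * W' l j) * X l \<alpha>"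
      using VD[OF *(1) kl(1) *(4)] XW[OF kl(2) *(2,3)] by (simp add: mult.assoc)
    also have "\<dots> = D k \<beta> * (W k * T' k i l j * V l) * X l \<alpha>"
      using T'[OF *(1,2) kl] by simp
    finally show "(V i * D k \<beta>) * T k i l j * (X l \<alpha> * W j)
      = D k \<beta> * W k * T' k i l j * (V l * X l \<alpha>)" by (simp add: mult.assoc)
  qed
  finally show "V i * X i \<alpha> * (D j \<beta> * W j)
    = (\<Sum>k\<in>I. \<Sum>l\<in>I. D k \<beta> * W k * T' k i l j * (V l * X l \<alpha>))
       - (if \<alpha> = \<beta> \<and> i = j then e else 0)" .
qed

lemma sum2_permute:
  assumes "\<sigma> permutes I"
  shows "(\<Sum>k\<in>I. \<Sum>l\<in>I. f k l) = (\<Sum>k\<in>I. \<Sum>l\<in>I. f (\<sigma> k) (\<sigma> l))"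
  using sum.permute[OF assms, of "\<lambda>k. \<Sum>l\<in>I. f k l"] sum.permute[OF assms, of "f (\<sigma> k)" for k]
  by simp

lemma rel_permute:
  assumes \<sigma>: "\<sigma> permutes I"
  shows "xx_rel I A T X \<Longrightarrow> xx_rel I A (\<lambda>i j k l. T (\<sigma> i) (\<sigma> j) (\<sigma> k) (\<sigma> l)) (\<lambda>i. X (\<sigma> i))"
    "dd_rel I A T D \<Longrightarrow> dd_rel I A (\<lambda>i j k l. T (\<sigma> i) (\<sigma> j) (\<sigma> k) (\<sigma> l)) (\<lambda>i. D (\<sigma> i))"
    "xd_rel I A e T X D \<Longrightarrow>
      xd_rel I A e (\<lambda>i j k l. T (\<sigma> i) (\<sigma> j) (\<sigma> k) (\<sigma> l)) (\<lambda>i. X (\<sigma> i)) (\<lambda>i. D (\<sigma> i))"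
proof -
  have mem: "\<sigma> i \<in> I" if "i \<in> I" for i
    using permutes_in_image[OF \<sigma>] that by blast
  have eq: "(\<sigma> i = \<sigma> j) = (i = j)" for i j
    using inj_eq[OF permutes_inj[OF \<sigma>]] .
  show "xx_rel I A (\<lambda>i j k l. T (\<sigma> i) (\<sigma> j) (\<sigma> k) (\<sigma> l)) (\<lambda>i. X (\<sigma> i))" if r: "xx_rel I A T X"
    unfolding xx_rel_def
  proof (intro ballI)
    fix i j \<alpha> \<beta> assume *: "i \<in> I" "j \<in> I" "\<alpha> \<in> A" "\<beta> \<in> A"
    show "X (\<sigma> i) \<alpha> * X (\<sigma> j) \<beta>
      = (\<Sum>k\<in>I. \<Sum>l\<in>I. T (\<sigma> i) (\<sigma> j) (\<sigma> k) (\<sigma> l) * X (\<sigma> k) \<beta> * X (\<sigma> l) \<alpha>)"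
      unfolding r[unfolded xx_rel_def, rule_format, OF mem[OF *(1)] mem[OF *(2)] *(3,4)]
      by (rule sum2_permute[OF \<sigma>])
  qed
  show "dd_rel I A (\<lambda>i j k l. T (\<sigma> i) (\<sigma> j) (\<sigma> k) (\<sigma> l)) (\<lambda>i. D (\<sigma> i))" if r: "dd_rel I A T D"
    unfolding dd_rel_def
  proof (intro ballI)
    fix i j \<alpha> \<beta> assume *: "i \<in> I" "j \<in> I" "\<alpha> \<in> A" "\<beta> \<in> A"
    show "D (\<sigma> i) \<alpha> * D (\<sigma> j) \<beta>
      = (\<Sum>k\<in>I. \<Sum>l\<in>I. D (\<sigma> k) \<beta> * D (\<sigma> l) \<alpha> * T (\<sigma> l) (\<sigma> k) (\<sigma> j) (\<sigma> i))"
      unfolding r[unfolded dd_rel_def, rule_format, OF mem[OF *(1)] mem[OF *(2)] *(3,4)]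
      by (rule sum2_permute[OF \<sigma>])
  qed
  show "xd_rel I A e (\<lambda>i j k l. T (\<sigma> i) (\<sigma> j) (\<sigma> k) (\<sigma> l)) (\<lambda>i. X (\<sigma> i)) (\<lambda>i. D (\<sigma> i))"
    if r: "xd_rel I A e T X D"
    unfolding xd_rel_def
  proof (intro ballI)
    fix i j \<alpha> \<beta> assume *: "i \<in> I" "j \<in> I" "\<alpha> \<in> A" "\<beta> \<in> A"
    show "X (\<sigma> i) \<alpha> * D (\<sigma> j) \<beta>
      = (\<Sum>k\<in>I. \<Sum>l\<in>I. D (\<sigma> k) \<beta> * T (\<sigma> k) (\<sigma> i) (\<sigma> l) (\<sigma> j) * X (\<sigma> l) \<alpha>)
        - (if \<alpha> = \<beta> \<and> i = j then e else 0)"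
      unfolding r[unfolded xd_rel_def, rule_format, OF mem[OF *(1)] mem[OF *(2)] *(3,4)] eq
      by (rule arg_cong2[of _ _ _ _ minus, OF sum2_permute[OF \<sigma>] refl])
  qed
qed

subsection \<open>The reflection equation\<close>

abbreviation mm :: "nat \<Rightarrow> 'a::ring_1 mat4 \<Rightarrow> 'a mat4 \<Rightarrow> 'a mat4" where
  "mm \<equiv> mat4_mult"

text \<open>The matrix \<open>L\<^sub>1\<close> of an array whose first index is the lower one.\<close>

definition lmat :: "(nat \<Rightarrow> nat \<Rightarrow> 'a::ring_1) \<Rightarrow> 'a mat4" where
  "lmat L = (\<lambda>i j k l. if j = l then L k i else 0)"

definition refl_eq :: "nat \<Rightarrow> 'a::ring_1 mat4 \<Rightarrow> 'a mat4 \<Rightarrow> bool" where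
  "refl_eq n R L \<longleftrightarrow> (\<forall>i\<in>{1..n}. \<forall>j\<in>{1..n}. \<forall>k\<in>{1..n}. \<forall>l\<in>{1..n}.
     mm n (mm n (mm n R L) R) L i j k l - mm n (mm n (mm n L R) L) R i j k l
     = mm n R L i j k l - mm n L R i j k l)"

definition mat_eq :: "nat \<Rightarrow> 'a mat4 \<Rightarrow> 'a mat4 \<Rightarrow> bool" where
  "mat_eq n A B \<longleftrightarrow> (\<forall>i\<in>{1..n}. \<forall>j\<in>{1..n}. \<forall>k\<in>{1..n}. \<forall>l\<in>{1..n}. A i j k l = B i j k l)"

lemma mm_cong: "mat_eq n A A' \<Longrightarrow> mat_eq n B B' \<Longrightarrow> mat_eq n (mm n A B) (mm n A' B')"
  by (simp add: mat_eq_def mat4_mult_def)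

lemma sum3_swap: "(\<Sum>b\<in>B. \<Sum>c\<in>C. \<Sum>d\<in>D. g b c d) = (\<Sum>c\<in>C. \<Sum>d\<in>D. \<Sum>b\<in>B. g b c d)"
  by (subst sum.swap) (intro sum.cong refl sum.swap)

lemma sum4_swap:
  "(\<Sum>a\<in>A. \<Sum>b\<in>B. \<Sum>c\<in>C. \<Sum>d\<in>D. f a b c d) = (\<Sum>c\<in>C. \<Sum>d\<in>D. \<Sum>a\<in>A. \<Sum>b\<in>B. f a b c d)"
  by (rule trans[OF sum.cong[OF refl sum3_swap] sum3_swap])

lemma mm_assoc: "mm n (mm n A B) C = mm n A (mm n B C)"
proof (intro ext)
  fix i j k l
  have "(\<Sum>a\<in>I. \<Sum>b\<in>I. (\<Sum>c\<in>I. \<Sum>d\<in>I. A i j c d * B c d a b) * C a b k l)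
    = (\<Sum>c\<in>I. \<Sum>d\<in>I. A i j c d * (\<Sum>a\<in>I. \<Sum>b\<in>I. B c d a b * C a b k l))" for I
  proof -
    have "(\<Sum>a\<in>I. \<Sum>b\<in>I. (\<Sum>c\<in>I. \<Sum>d\<in>I. A i j c d * B c d a b) * C a b k l)
      = (\<Sum>a\<in>I. \<Sum>b\<in>I. \<Sum>c\<in>I. \<Sum>d\<in>I. A i j c d * B c d a b * C a b k l)"
      by (simp add: sum_distrib_right)
    also have "\<dots> = (\<Sum>c\<in>I. \<Sum>d\<in>I. \<Sum>a\<in>I. \<Sum>b\<in>I. A i j c d * B c d a b * C a b k l)"
      by (rule sum4_swap)
    also have "\<dots> = (\<Sum>c\<in>I. \<Sum>d\<in>I. A i j c d * (\<Sum>a\<in>I. \<Sum>b\<in>I. B c d a b * C a b k l))"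
      by (simp add: sum_distrib_left mult.assoc)
    finally show ?thesis .
  qed
  then show "mm n (mm n A B) C i j k l = mm n A (mm n B C) i j k l"
    by (simp add: mat4_mult_def)
qed

definition conj_mat :: "(nat \<Rightarrow> nat \<Rightarrow> 'a::ring_1) \<Rightarrow> (nat \<Rightarrow> nat \<Rightarrow> 'a) \<Rightarrow> 'a mat4 \<Rightarrow> 'a mat4" where
  "conj_mat G H A = (\<lambda>i j k l. G i j * A i j k l * H k l)"

lemma mm_conj:
  assumes "\<And>a b k l. a \<in> {1..n} \<Longrightarrow> b \<in> {1..n} \<Longrightarrow> k \<in> {1..n} \<Longrightarrow> l \<in> {1..n} \<Longrightarrow>
    H a b * G a b * B a b k l = B a b k l"
  shows "mat_eq n (mm n (conj_mat G H A) (conj_mat G H B)) (conj_mat G H (mm n A B))"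
  unfolding mat_eq_def
proof (intro ballI)
  fix i j k l assume *: "i \<in> {1..n}" "j \<in> {1..n}" "k \<in> {1..n}" "l \<in> {1..n}"
  have "mm n (conj_mat G H A) (conj_mat G H B) i j k l
    = (\<Sum>a\<in>{1..n}. \<Sum>b\<in>{1..n}. G i j * (A i j a b * (H a b * G a b * B a b k l)) * H k l)"
    by (simp add: mat4_mult_def conj_mat_def mult.assoc)
  also have "\<dots> = (\<Sum>a\<in>{1..n}. \<Sum>b\<in>{1..n}. G i j * (A i j a b * B a b k l) * H k l)"
    using assms[OF _ _ *(3,4)] by (intro sum.cong refl) simp
  also have "\<dots> = conj_mat G H (mm n A B) i j k l"
    by (simp add: mat4_mult_def conj_mat_def sum_distrib_left sum_distrib_right)
  finally show "mm n (conj_mat G H A) (conj_mat G H B) i j k l = conj_mat G H (mm n A B) i j k l" .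
qed

lemma mat_eq_trans: "mat_eq n A B \<Longrightarrow> mat_eq n B C \<Longrightarrow> mat_eq n A C"
  by (simp add: mat_eq_def)

lemma mat_eq_refl: "mat_eq n A A"
  by (simp add: mat_eq_def)

text \<open>The reflection equation involves only matrix products, so it is invariant under conjugation. The
inverse diagonal matrices need to cancel only against the entries of \<open>R\<close> and \<open>L\<close>, since the unit of
the coefficients is merely an idempotent of the ambient ring.\<close>

lemma refl_eq_conj:
  assumes refl: "refl_eq n R L"
    and B: "\<And>B a b k l. B \<in> {R, L} \<Longrightarrow> a \<in> {1..n} \<Longrightarrow> b \<in> {1..n} \<Longrightarrow> k \<in> {1..n} \<Longrightarrow> l \<in> {1..n} \<Longrightarrow>
      H a b * G a b * B a b k l = B a b k l"
    and R': "mat_eq n R' (conj_mat G H R)" and L': "mat_eq n L' (conj_mat G H L)"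
  shows "refl_eq n R' L'"
proof -
  let ?c = "conj_mat G H"
  have step: "mat_eq n (mm n A' B') (?c (mm n A B))"
    if "mat_eq n A' (?c A)" "mat_eq n B' (?c B)" "B \<in> {R, L}" for A A' B B'
    using mat_eq_trans[OF mm_cong[OF that(1,2)] mm_conj] B[OF that(3)] by metis
  have RL: "mat_eq n (mm n R' L') (?c (mm n R L))" and LR: "mat_eq n (mm n L' R') (?c (mm n L R))"
    using R' L' by (auto intro: step)
  have RLRL: "mat_eq n (mm n (mm n (mm n R' L') R') L') (?c (mm n (mm n (mm n R L) R) L))"
    and LRLR: "mat_eq n (mm n (mm n (mm n L' R') L') R') (?c (mm n (mm n (mm n L R) L) R))"
    using R' L' RL LR by (auto intro!: step)
  show ?thesis
    unfolding refl_eq_def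
  proof (intro ballI)
    fix i j k l assume *: "i \<in> {1..n}" "j \<in> {1..n}" "k \<in> {1..n}" "l \<in> {1..n}"
    have "G i j * (mm n (mm n (mm n R L) R) L i j k l - mm n (mm n (mm n L R) L) R i j k l) * H k l
      = G i j * (mm n R L i j k l - mm n L R i j k l) * H k l"
      using refl * unfolding refl_eq_def by simp
    then show "mm n (mm n (mm n R' L') R') L' i j k l - mm n (mm n (mm n L' R') L') R' i j k l
      = mm n R' L' i j k l - mm n L' R' i j k l"
      using RL LR RLRL LRLR * unfolding mat_eq_def
      by (simp add: conj_mat_def left_diff_distrib right_diff_distrib)
  qed
qed

lemma refl_eq_permute:
  assumes \<sigma>: "\<sigma> permutes {1..n}" and refl: "refl_eq n R L"
  shows "refl_eq n (\<lambda>i j k l. R (\<sigma> i) (\<sigma> j) (\<sigma> k) (\<sigma> l)) (\<lambda>i j k l. L (\<sigma> i) (\<sigma> j) (\<sigma> k) (\<sigma> l))"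
proof -
  let ?p = "\<lambda>A i j k l. A (\<sigma> i) (\<sigma> j) (\<sigma> k) (\<sigma> l)"
  have mm: "mm n (?p A) (?p B) = ?p (mm n A B)" for A B :: "'a mat4"
    unfolding mat4_mult_def
    by (intro ext) (rule sum2_permute[OF \<sigma>, symmetric])
  show ?thesis
    using refl permutes_in_image[OF \<sigma>] unfolding refl_eq_def mm by blast
qed

text \<open>The relation between \<open>X\<close> and \<open>D\<close> turns \<open>L\<^sub>1 R L\<^sub>1\<close> into \<open>Y + L\<^sub>1\<close> with \<open>Y = \<Sum> X X D D\<close>. Multiplying
\<open>Y\<close> by \<open>R\<close> on the left exchanges the labels of the two \<open>X\<close>, on the right those of the two
\<open>D\<close>; after summation over the labels both give the same result.\<close>

lemma refl_eq_oscillator: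
  fixes R :: "'r::ring_1 mat4" and X D :: "nat \<Rightarrow> nat \<Rightarrow> 'r"
  assumes L_def: "L = (\<lambda>k i. \<Sum>\<alpha>\<in>A. X i \<alpha> * D k \<alpha>)" and A: "finite A" and xx: "xx_rel {1..n} A R X" and dd: "dd_rel {1..n} A R D" and xd: "xd_rel {1..n} A e R X D"
    and e: "\<And>i \<alpha>. i \<in> {1..n} \<Longrightarrow> \<alpha> \<in> A \<Longrightarrow> X i \<alpha> * e = X i \<alpha>"
  shows "refl_eq n R (lmat L)"
proof -
  let ?I = "{1..n}"
  define Y :: "'r mat4" where
    "Y = (\<lambda>i j k l. \<Sum>\<alpha>\<in>A. \<Sum>\<beta>\<in>A. X i \<alpha> * X j \<beta> * D l \<alpha> * D k \<beta>)"
  have LRL: "mm n (mm n (lmat L) R) (lmat L) i j k l = Y i j k l + lmat L i j k l"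
    if *: "i \<in> ?I" "j \<in> ?I" "k \<in> ?I" "l \<in> ?I" for i j k l
  proof -
    have "mm n (mm n (lmat L) R) (lmat L) i j k l = (\<Sum>b\<in>?I. (\<Sum>a\<in>?I. L a i * R a j b l) * L k b)"
      using * by (simp add: mat4_mult_def lmat_def if_distrib[of "\<lambda>x. x * _"] if_distrib[of "\<lambda>x. _ * x"]
          sum.delta sum.delta' cong: if_cong)
    also have "\<dots> = (\<Sum>b\<in>?I. \<Sum>\<beta>\<in>A. \<Sum>a\<in>?I. \<Sum>\<alpha>\<in>A. X i \<alpha> * (D a \<alpha> * R a j b l * X b \<beta>) * D k \<beta>)"
      by (simp add: L_def sum_distrib_left sum_distrib_right mult.assoc)
    also have "\<dots> = (\<Sum>b\<in>?I. \<Sum>a\<in>?I. \<Sum>\<beta>\<in>A. \<Sum>\<alpha>\<in>A. X i \<alpha> * (D a \<alpha> * R a j b l * X b \<beta>) * D k \<beta>)"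
      by (intro sum.cong refl sum.swap)
    also have "\<dots> = (\<Sum>\<alpha>\<in>A. \<Sum>\<beta>\<in>A. \<Sum>a\<in>?I. \<Sum>b\<in>?I. X i \<alpha> * (D a \<alpha> * R a j b l * X b \<beta>) * D k \<beta>)"
      by (rule trans[OF sum4_swap trans[OF sum.swap sum.cong[OF refl sum.cong[OF refl sum.swap]]]])
    also have "\<dots> = (\<Sum>\<alpha>\<in>A. \<Sum>\<beta>\<in>A. X i \<alpha> * (\<Sum>a\<in>?I. \<Sum>b\<in>?I. D a \<alpha> * R a j b l * X b \<beta>) * D k \<beta>)"
      by (simp add: sum_distrib_left sum_distrib_right)
    also have "\<dots> = (\<Sum>\<alpha>\<in>A. \<Sum>\<beta>\<in>A. X i \<alpha> * (X j \<beta> * D l \<alpha> + (if \<beta> = \<alpha> \<and> j = l then e else 0)) * D k \<beta>)"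
      using xd * unfolding xd_rel_def by (intro sum.cong refl) (simp add: algebra_simps)
    also have "\<dots> = Y i j k l + (\<Sum>\<alpha>\<in>A. \<Sum>\<beta>\<in>A. if \<beta> = \<alpha> then (if j = l then X i \<alpha> * e * D k \<alpha> else 0) else 0)"
      unfolding Y_def sum.distrib[symmetric]
      by (intro sum.cong refl) (auto simp: algebra_simps)
    also have "(\<Sum>\<alpha>\<in>A. \<Sum>\<beta>\<in>A. if \<beta> = \<alpha> then (if j = l then X i \<alpha> * e * D k \<alpha> else 0) else 0) = lmat L i j k l"
      using A e[OF *(1)] by (auto simp: lmat_def L_def sum.delta')
    finally show ?thesis .
  qed
  have RY: "mm n R Y i j k l = (\<Sum>\<alpha>\<in>A. \<Sum>\<beta>\<in>A. X i \<beta> * X j \<alpha> * D l \<alpha> * D k \<beta>)"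
    if *: "i \<in> ?I" "j \<in> ?I" "k \<in> ?I" "l \<in> ?I" for i j k l
  proof -
    have "mm n R Y i j k l = (\<Sum>a\<in>?I. \<Sum>b\<in>?I. \<Sum>\<alpha>\<in>A. \<Sum>\<beta>\<in>A. (R i j a b * X a \<alpha> * X b \<beta>) * D l \<alpha> * D k \<beta>)"
      by (simp add: mat4_mult_def Y_def sum_distrib_left mult.assoc)
    also have "\<dots> = (\<Sum>\<alpha>\<in>A. \<Sum>\<beta>\<in>A. \<Sum>a\<in>?I. \<Sum>b\<in>?I. (R i j a b * X a \<alpha> * X b \<beta>) * D l \<alpha> * D k \<beta>)"
      by (rule sum4_swap)
    also have "\<dots> = (\<Sum>\<alpha>\<in>A. \<Sum>\<beta>\<in>A. (\<Sum>a\<in>?I. \<Sum>b\<in>?I. R i j a b * X a \<alpha> * X b \<beta>) * D l \<alpha> * D k \<beta>)"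
      by (simp add: sum_distrib_right)
    also have "\<dots> = (\<Sum>\<alpha>\<in>A. \<Sum>\<beta>\<in>A. X i \<beta> * X j \<alpha> * D l \<alpha> * D k \<beta>)"
      using xx * unfolding xx_rel_def by (intro sum.cong refl) simp
    finally show ?thesis .
  qed
  have YR: "mm n Y R i j k l = (\<Sum>\<alpha>\<in>A. \<Sum>\<beta>\<in>A. X i \<alpha> * X j \<beta> * D l \<beta> * D k \<alpha>)"
    if *: "i \<in> ?I" "j \<in> ?I" "k \<in> ?I" "l \<in> ?I" for i j k l
  proof -
    have "mm n Y R i j k l = (\<Sum>a\<in>?I. \<Sum>b\<in>?I. \<Sum>\<alpha>\<in>A. \<Sum>\<beta>\<in>A. X i \<alpha> * X j \<beta> * (D b \<alpha> * D a \<beta> * R a b k l))"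
      by (simp add: mat4_mult_def Y_def sum_distrib_right mult.assoc)
    also have "\<dots> = (\<Sum>\<alpha>\<in>A. \<Sum>\<beta>\<in>A. \<Sum>b\<in>?I. \<Sum>a\<in>?I. X i \<alpha> * X j \<beta> * (D b \<alpha> * D a \<beta> * R a b k l))"
      by (rule trans[OF sum4_swap sum.cong[OF refl sum.cong[OF refl sum.swap]]])
    also have "\<dots> = (\<Sum>\<alpha>\<in>A. \<Sum>\<beta>\<in>A. X i \<alpha> * X j \<beta> * (\<Sum>b\<in>?I. \<Sum>a\<in>?I. D b \<alpha> * D a \<beta> * R a b k l))"
      by (simp add: sum_distrib_left)
    also have "\<dots> = (\<Sum>\<alpha>\<in>A. \<Sum>\<beta>\<in>A. X i \<alpha> * X j \<beta> * (D l \<beta> * D k \<alpha>))"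
      using dd * unfolding dd_rel_def by (intro sum.cong refl) simp
    finally show ?thesis by (simp add: mult.assoc)
  qed
  have comm: "mm n R Y i j k l = mm n Y R i j k l"
    if *: "i \<in> ?I" "j \<in> ?I" "k \<in> ?I" "l \<in> ?I" for i j k l
    unfolding RY[OF *] YR[OF *] by (rule sum.swap)
  let ?YL = "\<lambda>i j k l. Y i j k l + lmat L i j k l"
  have LRL': "mat_eq n (mm n (mm n (lmat L) R) (lmat L)) ?YL"
    using LRL unfolding mat_eq_def by blast
  have 1: "mat_eq n (mm n (mm n (mm n R (lmat L)) R) (lmat L)) (mm n R ?YL)"
    using mm_cong[OF mat_eq_refl LRL', of R] by (simp add: mm_assoc)
  have 2: "mat_eq n (mm n (mm n (mm n (lmat L) R) (lmat L)) R) (mm n ?YL R)"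
    using mm_cong[OF LRL' mat_eq_refl] .
  have 3: "mm n R ?YL i j k l = mm n R Y i j k l + mm n R (lmat L) i j k l"
    "mm n ?YL R i j k l = mm n Y R i j k l + mm n (lmat L) R i j k l" for i j k l
    by (simp_all add: mat4_mult_def algebra_simps sum.distrib)
  show ?thesis
    using 1 2 comm unfolding refl_eq_def mat_eq_def 3 by (simp add: algebra_simps)
qed

section \<open>Symmetries of the defining relations\<close>

text \<open>\<open>F p s\<close> is the value of the fraction \<open>p / s\<close> under a homomorphism from the ring of fractions that is
given by \<open>S\<close> on scalars. It need not be unital, which is why \<open>F 1 1\<close> takes the place of \<open>1\<close> below.\<close>

definition frac_hom :: "nat \<Rightarrow> ('k \<Rightarrow> 'r) \<Rightarrow> ('k::comm_ring_1 hpoly \<Rightarrow> 'k hpoly \<Rightarrow> 'r::ring_1) \<Rightarrow> bool" where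
  "frac_hom n S F \<longleftrightarrow> (\<forall>p\<in>Pol n. \<forall>q\<in>Pol n. \<forall>s\<in>Den n. \<forall>t\<in>Den n.
     F p s * F q t = F (p * q) (s * t) \<and> F p s + F q t = F (p * t + q * s) (s * t) \<and>
     (p * t = q * s \<longrightarrow> F p s = F q t)) \<and> (\<forall>c. F (Poly_Mapping.single 0 c) 1 = S c)"

definition has_weight :: "nat \<Rightarrow> ('k::comm_ring_1 hpoly \<Rightarrow> 'k hpoly \<Rightarrow> 'r::ring_1) \<Rightarrow> (nat \<Rightarrow> int) \<Rightarrow> 'r \<Rightarrow> bool" where
  "has_weight n F e X \<longleftrightarrow> F 1 1 * X = X \<and> X * F 1 1 = X \<and>
     (\<forall>p\<in>Pol n. \<forall>s\<in>Den n. F p s * X = X * F (hshift e p) (hshift e s))"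

abbreviation (input) fperm :: "(nat \<Rightarrow> nat) \<Rightarrow> ('k::comm_ring_1 hpoly \<Rightarrow> 'k hpoly \<Rightarrow> 'r) \<Rightarrow> 'k hpoly \<Rightarrow> 'k hpoly \<Rightarrow> 'r" where
  "fperm \<sigma> F \<equiv> \<lambda>p s. F (hperm \<sigma> p) (hperm \<sigma> s)"

abbreviation (input) fmat :: "('p \<Rightarrow> 'p \<Rightarrow> 'r) \<Rightarrow> 'p mat4 \<Rightarrow> 'p mat4 \<Rightarrow> 'r mat4" where
  "fmat F An Ad \<equiv> \<lambda>i j k l. F (An i j k l) (Ad i j k l)"

lemma hrepD:
  assumes "frac_hom n S F"
  shows "p \<in> Pol n \<Longrightarrow> q \<in> Pol n \<Longrightarrow> s \<in> Den n \<Longrightarrow> t \<in> Den n \<Longrightarrow> F p s * F q t = F (p * q) (s * t)"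
    "p \<in> Pol n \<Longrightarrow> q \<in> Pol n \<Longrightarrow> s \<in> Den n \<Longrightarrow> t \<in> Den n \<Longrightarrow> F p s + F q t = F (p * t + q * s) (s * t)"
    "p \<in> Pol n \<Longrightarrow> q \<in> Pol n \<Longrightarrow> s \<in> Den n \<Longrightarrow> t \<in> Den n \<Longrightarrow> p * t = q * s \<Longrightarrow> F p s = F q t"
    "F (Poly_Mapping.single 0 c) 1 = S c"
  using assms unfolding frac_hom_def by blast+

lemma frac_hom_commute:
  assumes "frac_hom n S F" "p \<in> Pol n" "q \<in> Pol n" "s \<in> Den n" "t \<in> Den n"
  shows "F p s * F q t = F q t * F p s"
  using assms by (simp add: hrepD(1)[OF assms(1)] mult.commute)

lemma frac_hom_zero:
  assumes "frac_hom n S F" "s \<in> Den n"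
  shows "F 0 s = 0"
proof -
  have "F 0 s = F 0 1" using assms by (intro hrepD(3)[OF assms(1)]) auto
  moreover have "F 0 1 + F 0 1 = F 0 1" using hrepD(2)[OF assms(1), of 0 0 1 1] by simp
  ultimately show ?thesis by simp
qed

lemma frac_hom_fperm:
  assumes "frac_hom n S F" "\<sigma> permutes {1..n}"
  shows "frac_hom n S (fperm \<sigma> F)"
  unfolding frac_hom_def
proof (intro conjI ballI allI impI)
  fix p q s t :: "'a hpoly" assume *: "p \<in> Pol n" "q \<in> Pol n" "s \<in> Den n" "t \<in> Den n"
  note ** = hperm_Pol[OF assms(2) *(1)] hperm_Pol[OF assms(2) *(2)] hperm_Den[OF assms(2) *(3)] hperm_Den[OF assms(2) *(4)]
  show "F (hperm \<sigma> p) (hperm \<sigma> s) * F (hperm \<sigma> q) (hperm \<sigma> t) = F (hperm \<sigma> (p * q)) (hperm \<sigma> (s * t))"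
    using hrepD(1)[OF assms(1) **] by (simp add: hperm_hom)
  show "F (hperm \<sigma> p) (hperm \<sigma> s) + F (hperm \<sigma> q) (hperm \<sigma> t) = F (hperm \<sigma> (p * t + q * s)) (hperm \<sigma> (s * t))"
    using hrepD(2)[OF assms(1) **] by (simp add: hperm_hom)
  show "F (hperm \<sigma> p) (hperm \<sigma> s) = F (hperm \<sigma> q) (hperm \<sigma> t)" if "p * t = q * s"
    using hrepD(3)[OF assms(1) **] that by (metis hperm_hom(6))
qed (use hrepD(4)[OF assms(1)] in \<open>simp add: hperm_hom\<close>)

lemma has_weight_unit:
  assumes "has_weight n F e X"
  shows "F 1 1 * X = X" "X * F 1 1 = X"
  using assms unfolding has_weight_def by blast+

lemma has_weight_shift:
  assumes "has_weight n F e X" "p \<in> Pol n" "s \<in> Den n"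
  shows "F (hshift a p) (hshift a s) * X = X * F (hshift (\<lambda>l. e l + a l) p) (hshift (\<lambda>l. e l + a l) s)"
  using assms unfolding has_weight_def by (simp add: hshift_hshift)

lemma has_weight_X:
  assumes "has_weight n F (eps i) X" "p \<in> Pol n" "s \<in> Den n"
  shows "X * F p s = F (sh i p) (sh i s) * X"
  using has_weight_shift[OF assms, of "\<lambda>l. - eps i l"] by (simp add: hshift_zero)

lemma has_weight_L:
  assumes "has_weight n F (\<lambda>l. eps i l - eps k l) L" "p \<in> Pol n" "s \<in> Den n"
  shows "F (sh i p) (sh i s) * L = L * F (sh k p) (sh k s)"
  using has_weight_shift[OF assms, of "\<lambda>l. - eps i l"] by simp

lemma has_weight_mult:
  assumes h: "frac_hom n S F" and w: "has_weight n F e X" and "a \<in> Pol n" "b \<in> Den n"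
  shows "has_weight n F e (F a b * X)" "has_weight n F e (X * F a b)"
proof -
  have 1: "F p s * X = X * F (hshift e p) (hshift e s)" if "p \<in> Pol n" "s \<in> Den n" for p s
    using w that unfolding has_weight_def by blast
  have 2: "F 1 1 * X = X" "X * F 1 1 = X" using w unfolding has_weight_def by auto
  have 3: "F 1 1 * F a b = F a b" "F a b * F 1 1 = F a b"
    using hrepD(1)[OF h, of 1 a 1 b] hrepD(1)[OF h, of a 1 b 1] assms by simp_all
  show "has_weight n F e (F a b * X)"
    unfolding has_weight_def
  proof (intro conjI ballI)
    fix p s :: "'a hpoly" assume ps: "p \<in> Pol n" "s \<in> Den n"
    show "F p s * (F a b * X) = F a b * X * F (hshift e p) (hshift e s)"
      using 1[OF ps] frac_hom_commute[OF h ps(1) assms(3) ps(2) assms(4)] by (metis mult.assoc)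
  qed (use 2 3 in \<open>simp_all add: mult.assoc[symmetric]\<close>, simp add: mult.assoc)
  show "has_weight n F e (X * F a b)"
    unfolding has_weight_def
  proof (intro conjI ballI)
    fix p s :: "'a hpoly" assume ps: "p \<in> Pol n" "s \<in> Den n"
    show "F p s * (X * F a b) = X * F a b * F (hshift e p) (hshift e s)"
      using 1[OF ps] frac_hom_commute[OF h hshift_Pol[OF ps(1)] assms(3) hshift_Den[OF ps(2)] assms(4)]
      by (metis mult.assoc)
  qed (use 2 3 in \<open>simp_all add: mult.assoc[symmetric]\<close>, simp add: mult.assoc)
qed

lemma has_weight_fperm:
  assumes "has_weight n F e X" "\<sigma> permutes {1..n}"
  shows "has_weight n (fperm \<sigma> F) (\<lambda>l. e (\<sigma> l)) X"
  using assms unfolding has_weight_def by (simp add: hperm_hom hshift_hperm[symmetric])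

lemma eps_permutes: "\<sigma> permutes I \<Longrightarrow> eps (\<sigma> i) (\<sigma> l) = eps i l"
  by (simp add: eps_def inj_eq[OF permutes_inj])

subsection \<open>Gauge transformations\<close>

text \<open>The matrices \<open>A\<close> and \<open>B\<close> of fractions are conjugate under the diagonal matrix with entries
\<open>g\<^sub>i g\<^sub>j[-\<epsilon>\<^sub>i]\<close>, \<open>g = v / w\<close>, with denominators cleared.\<close>

definition gauge_cond :: "nat \<Rightarrow> 'k::comm_ring_1 hpoly mat4 \<Rightarrow> 'k hpoly mat4 \<Rightarrow> 'k hpoly mat4 \<Rightarrow> 'k hpoly mat4
    \<Rightarrow> (nat \<Rightarrow> 'k hpoly) \<Rightarrow> (nat \<Rightarrow> 'k hpoly) \<Rightarrow> bool" where
  "gauge_cond n An Ad Bn Bd v w \<longleftrightarrow>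
     (\<forall>i\<in>{1..n}. v i \<in> Den n \<and> w i \<in> Den n) \<and>
     (\<forall>i\<in>{1..n}. \<forall>j\<in>{1..n}. \<forall>k\<in>{1..n}. \<forall>l\<in>{1..n}.
       An i j k l \<in> Pol n \<and> Ad i j k l \<in> Den n \<and> Bn i j k l \<in> Pol n \<and> Bd i j k l \<in> Den n \<and>
       Bn i j k l * Ad i j k l * (v k * sh k (v l)) * (w i * sh i (w j))
       = An i j k l * Bd i j k l * (v i * sh i (v j)) * (w k * sh k (w l)))"

text \<open>The defining relations of the ring of differential operators and of the reduction algebra, for
elements of an arbitrary ring and with an arbitrary matrix of fractions in place of \<open>R\<close>.\<close>

definition diff_sys where
  "diff_sys n N S F An Ad X D \<longleftrightarrow> frac_hom n S F \<and>
     (\<forall>i\<in>{1..n}. \<forall>\<alpha>\<in>{1..N}. has_weight n F (eps i) (X i \<alpha>) \<and> has_weight n F (\<lambda>l. - eps i l) (D i \<alpha>)) \<and>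
     xx_rel {1..n} {1..N} (fmat F An Ad) X \<and> dd_rel {1..n} {1..N} (fmat F An Ad) D \<and>
     xd_rel {1..n} {1..N} (F 1 1) (fmat F An Ad) X D"

definition dra_sys where
  "dra_sys n S F An Ad L \<longleftrightarrow> frac_hom n S F \<and>
     (\<forall>i\<in>{1..n}. \<forall>k\<in>{1..n}. has_weight n F (\<lambda>l. eps i l - eps k l) (L k i)) \<and>
     refl_eq n (fmat F An Ad) (lmat L)"

context
  fixes n :: nat and S :: "'k::comm_ring_1 \<Rightarrow> 'r::ring_1" and F :: "'k::comm_ring_1 hpoly \<Rightarrow> 'k hpoly \<Rightarrow> 'r"
    and An Ad Bn Bd :: "'k hpoly mat4" and v w :: "nat \<Rightarrow> 'k hpoly"
  assumes h: "frac_hom n S F" and g: "gauge_cond n An Ad Bn Bd v w"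
begin

lemma gauge_condD [simp]:
  "i \<in> {1..n} \<Longrightarrow> v i \<in> Den n" "i \<in> {1..n} \<Longrightarrow> w i \<in> Den n"
  "i \<in> {1..n} \<Longrightarrow> j \<in> {1..n} \<Longrightarrow> k \<in> {1..n} \<Longrightarrow> l \<in> {1..n} \<Longrightarrow> An i j k l \<in> Pol n"
  "i \<in> {1..n} \<Longrightarrow> j \<in> {1..n} \<Longrightarrow> k \<in> {1..n} \<Longrightarrow> l \<in> {1..n} \<Longrightarrow> Ad i j k l \<in> Den n"
  "i \<in> {1..n} \<Longrightarrow> j \<in> {1..n} \<Longrightarrow> k \<in> {1..n} \<Longrightarrow> l \<in> {1..n} \<Longrightarrow> Bn i j k l \<in> Pol n"
  "i \<in> {1..n} \<Longrightarrow> j \<in> {1..n} \<Longrightarrow> k \<in> {1..n} \<Longrightarrow> l \<in> {1..n} \<Longrightarrow> Bd i j k l \<in> Den n"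
  using g unfolding gauge_cond_def by blast+

lemma gauge_condE:
  "i \<in> {1..n} \<Longrightarrow> j \<in> {1..n} \<Longrightarrow> k \<in> {1..n} \<Longrightarrow> l \<in> {1..n} \<Longrightarrow>
     Bn i j k l * Ad i j k l * (v k * sh k (v l)) * (w i * sh i (w j))
       = An i j k l * Bd i j k l * (v i * sh i (v j)) * (w k * sh k (w l))"
  using g unfolding gauge_cond_def by blast

abbreviation (input) "gV i \<equiv> F (v i) (w i)"
abbreviation (input) "gW i \<equiv> F (w i) (v i)"
abbreviation (input) "gV' i j \<equiv> F (sh i (v j)) (sh i (w j))"
abbreviation (input) "gW' i j \<equiv> F (sh i (w j)) (sh i (v j))"

lemma gauge_units:
  assumes "i \<in> {1..n}" "j \<in> {1..n}"
  shows "gV i * gW i = F 1 1" "gW i * gV i = F 1 1" "gV' i j * gW' i j = F 1 1" "gW' i j * gV' i j = F 1 1"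
  using assms by (auto simp: hrepD(1)[OF h] mult.commute simp del: atLeastAtMost_iff intro!: hrepD(3)[OF h])

lemma gauge_xx:
  assumes ijkl: "i \<in> {1..n}" "j \<in> {1..n}" "k \<in> {1..n}" "l \<in> {1..n}"
  shows "fmat F Bn Bd i j k l * (gV k * gV' k l) = gV i * gV' i j * fmat F An Ad i j k l"
proof -
  have "fmat F Bn Bd i j k l * (gV k * gV' k l)
    = F (Bn i j k l * (v k * sh k (v l))) (Bd i j k l * (w k * sh k (w l)))"
    using ijkl by (simp add: hrepD(1)[OF h] del: atLeastAtMost_iff)
  also have "\<dots> = F (v i * sh i (v j) * An i j k l) (w i * sh i (w j) * Ad i j k l)"
    using ijkl gauge_condE[OF ijkl]
    by (intro hrepD(3)[OF h]) (simp_all add: mult_ac del: atLeastAtMost_iff)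
  also have "\<dots> = gV i * gV' i j * fmat F An Ad i j k l"
    using ijkl by (simp add: hrepD(1)[OF h] del: atLeastAtMost_iff)
  finally show ?thesis .
qed

lemma gauge_dd:
  assumes ijkl: "i \<in> {1..n}" "j \<in> {1..n}" "k \<in> {1..n}" "l \<in> {1..n}"
  shows "fmat F An Ad l k j i * (gW' j i * gW j) = gW' l k * gW l * fmat F Bn Bd l k j i"
proof -
  have "fmat F An Ad l k j i * (gW' j i * gW j)
    = F (An l k j i * (sh j (w i) * w j)) (Ad l k j i * (sh j (v i) * v j))"
    using ijkl by (simp add: hrepD(1)[OF h] del: atLeastAtMost_iff)
  also have "\<dots> = F (sh l (w k) * w l * Bn l k j i) (sh l (v k) * v l * Bd l k j i)"
    using ijkl gauge_condE[OF ijkl(4,3,2,1)]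
    by (intro hrepD(3)[OF h]) (simp_all add: mult_ac del: atLeastAtMost_iff)
  also have "\<dots> = gW' l k * gW l * fmat F Bn Bd l k j i"
    using ijkl by (simp add: hrepD(1)[OF h] del: atLeastAtMost_iff)
  finally show ?thesis .
qed

lemma gauge_xd:
  assumes ijkl: "i \<in> {1..n}" "j \<in> {1..n}" "k \<in> {1..n}" "l \<in> {1..n}"
  shows "gW k * fmat F Bn Bd k i l j * gV l = gV' k i * fmat F An Ad k i l j * gW' l j"
proof -
  have "gW k * fmat F Bn Bd k i l j * gV l = F (w k * Bn k i l j * v l) (v k * Bd k i l j * w l)"
    using ijkl by (simp add: hrepD(1)[OF h] del: atLeastAtMost_iff)
  also have "\<dots> = F (sh k (v i) * An k i l j * sh l (w j)) (sh k (w i) * Ad k i l j * sh l (v j))"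
    using ijkl gauge_condE[OF ijkl(3,1,4,2)]
    by (intro hrepD(3)[OF h]) (simp_all add: mult_ac del: atLeastAtMost_iff)
  also have "\<dots> = gV' k i * fmat F An Ad k i l j * gW' l j"
    using ijkl by (simp add: hrepD(1)[OF h] del: atLeastAtMost_iff)
  finally show ?thesis .
qed

lemma gauge_unit_left: "p \<in> Pol n \<Longrightarrow> s \<in> Den n \<Longrightarrow> F 1 1 * F p s = F p s"
  using hrepD(1)[OF h, of 1 p 1 s] by simp

lemma gauge_refl:
  assumes ijkl: "i \<in> {1..n}" "j \<in> {1..n}" "k \<in> {1..n}" "l \<in> {1..n}"
  shows "fmat F Bn Bd i j k l = (gV i * gV' i j) * fmat F An Ad i j k l * (gW' k l * gW k)"
proof -
  have "(gV i * gV' i j) * fmat F An Ad i j k l * (gW' k l * gW k)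
    = fmat F Bn Bd i j k l * (gV k * (gV' k l * gW' k l) * gW k)"
    unfolding gauge_xx[OF ijkl, symmetric] by (simp only: mult.assoc)
  also have "\<dots> = fmat F Bn Bd i j k l * F 1 1"
    using gauge_units[OF ijkl(3,4)] gauge_unit_left[of "w k" "v k"] ijkl
    by (simp add: mult.assoc del: atLeastAtMost_iff)
  also have "\<dots> = fmat F Bn Bd i j k l"
    using hrepD(1)[OF h, of "Bn i j k l" 1 "Bd i j k l" 1] ijkl by (simp del: atLeastAtMost_iff)
  finally show ?thesis ..
qed

lemma diff_sys_gauge:
  assumes s: "diff_sys n N S F An Ad X D"
  shows "diff_sys n N S F Bn Bd (\<lambda>i \<alpha>. gV i * X i \<alpha>) (\<lambda>i \<alpha>. D i \<alpha> * gW i)"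
proof -
  have X: "has_weight n F (eps i) (X i \<alpha>)" and D: "has_weight n F (\<lambda>l. - eps i l) (D i \<alpha>)"
    if "i \<in> {1..n}" "\<alpha> \<in> {1..N}" for i \<alpha>
    using s that unfolding diff_sys_def by blast+
  have Xc: "X i \<alpha> * F p q = F (sh i p) (sh i q) * X i \<alpha>"
    and Dc: "F p q * D i \<alpha> = D i \<alpha> * F (sh i p) (sh i q)"
    if "i \<in> {1..n}" "\<alpha> \<in> {1..N}" "p \<in> Den n" "q \<in> Den n" for i \<alpha> p q
    using has_weight_X[OF X[OF that(1,2)]] D[OF that(1,2)] that(3,4) unfolding has_weight_def by simp_all
  have xx: "xx_rel {1..n} {1..N} (fmat F Bn Bd) (\<lambda>i \<alpha>. gV i * X i \<alpha>)"
    by (rule xx_rel_gauge[where V'="gV'"]) (use s in \<open>auto simp: diff_sys_def Xc gauge_xx simp del: atLeastAtMost_iff\<close>)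
  have dd: "dd_rel {1..n} {1..N} (fmat F Bn Bd) (\<lambda>i \<alpha>. D i \<alpha> * gW i)"
    by (rule dd_rel_gauge[where W'="gW'"]) (use s in \<open>auto simp: diff_sys_def Dc gauge_dd simp del: atLeastAtMost_iff\<close>)
  have e: "gV i * F 1 1 * gW i = F 1 1" if "i \<in> {1..n}" for i
    using that gauge_units(1)[OF that that] gauge_unit_left[of "w i" "v i"]
    by (simp add: mult.assoc del: atLeastAtMost_iff)
  have xd: "xd_rel {1..n} {1..N} (F 1 1) (fmat F Bn Bd) (\<lambda>i \<alpha>. gV i * X i \<alpha>) (\<lambda>i \<alpha>. D i \<alpha> * gW i)"
    by (rule xd_rel_gauge[where V'="gV'" and W'="gW'"])
      (use s in \<open>auto simp: diff_sys_def Xc Dc gauge_xd e simp del: atLeastAtMost_iff\<close>)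
  show ?thesis
    unfolding diff_sys_def using xx dd xd h X D by (auto intro!: has_weight_mult simp del: atLeastAtMost_iff)
qed

lemma dra_sys_gauge:
  assumes s: "dra_sys n S F An Ad L"
  shows "dra_sys n S F Bn Bd (\<lambda>k i. gV i * L k i * gW k)"
proof -
  have L: "has_weight n F (\<lambda>l. eps i l - eps k l) (L k i)" if "i \<in> {1..n}" "k \<in> {1..n}" for i k
    using s that unfolding dra_sys_def by blast
  have e1: "F 1 1 * L k i = L k i" if "i \<in> {1..n}" "k \<in> {1..n}" for i k
    using L[OF that] unfolding has_weight_def by blast
  have "refl_eq n (fmat F Bn Bd) (lmat (\<lambda>k i. gV i * L k i * gW k))"
  proof (rule refl_eq_conj[where G="\<lambda>i j. gV i * gV' i j" and H="\<lambda>k l. gW' k l * gW k"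
        and R="fmat F An Ad" and L="lmat L"])
    show "refl_eq n (fmat F An Ad) (lmat L)"
      using s unfolding dra_sys_def by blast
    fix B :: "'r mat4" and a b k l
    assume B: "B \<in> {fmat F An Ad, lmat L}" and *: "a \<in> {1..n}" "b \<in> {1..n}" "k \<in> {1..n}" "l \<in> {1..n}"
    have "gW' a b * gW a * (gV a * gV' a b) = gW' a b * (F 1 1 * gV' a b)"
      using gauge_units(2)[OF *(1,1)] by (simp add: mult.assoc[symmetric]) (simp add: mult.assoc)
    also have "\<dots> = F 1 1"
      using gauge_units(4)[OF *(1,2)] gauge_unit_left *(1,2) by (simp del: atLeastAtMost_iff)
    finally show "gW' a b * gW a * (gV a * gV' a b) * B a b k l = B a b k l"
      using B e1 gauge_unit_left * by (auto simp: lmat_def simp del: atLeastAtMost_iff)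
  next
    show "mat_eq n (fmat F Bn Bd) (conj_mat (\<lambda>i j. gV i * gV' i j) (\<lambda>k l. gW' k l * gW k) (fmat F An Ad))"
      unfolding mat_eq_def conj_mat_def using gauge_refl by blast
    show "mat_eq n (lmat (\<lambda>k i. gV i * L k i * gW k))
       (conj_mat (\<lambda>i j. gV i * gV' i j) (\<lambda>k l. gW' k l * gW k) (lmat L))"
      unfolding mat_eq_def conj_mat_def
    proof (intro ballI)
      fix i j k l assume *: "i \<in> {1..n}" "j \<in> {1..n}" "k \<in> {1..n}" "l \<in> {1..n}"
      have "gV i * gV' i j * L k i * (gW' k j * gW k) = gV i * (gV' i j * L k i) * (gW' k j * gW k)"
        by (simp only: mult.assoc)
      also have "gV' i j * L k i = L k i * gV' k j"
        using has_weight_L[OF L] * by (simp del: atLeastAtMost_iff)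
      also have "gV i * (L k i * gV' k j) * (gW' k j * gW k) = gV i * L k i * ((gV' k j * gW' k j) * gW k)"
        by (simp only: mult.assoc)
      also have "\<dots> = gV i * L k i * gW k"
        using gauge_units(3)[OF *(3,2)] gauge_unit_left * by (simp del: atLeastAtMost_iff)
      finally show "lmat (\<lambda>k i. gV i * L k i * gW k) i j k l
        = gV i * gV' i j * lmat L i j k l * (gW' k l * gW k)"
        by (cases "j = l") (simp_all add: lmat_def)
    qed
  qed
  then show ?thesis
    unfolding dra_sys_def using h L by (auto intro!: has_weight_mult simp del: atLeastAtMost_iff)
qed

end

subsection \<open>Relabelling\<close>

lemma diff_sys_permute:
  assumes s: "diff_sys n N S F Tn Td X D" and \<sigma>: "\<sigma> permutes {1..n}"
  shows "diff_sys n N S (fperm \<sigma> F) Tn Td (\<lambda>i. X (\<sigma> i)) (\<lambda>i. D (\<sigma> i))"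
proof -
  have T: "fmat (fperm \<sigma> F) Tn Td = (\<lambda>i j k l. fmat F Tn Td (\<sigma> i) (\<sigma> j) (\<sigma> k) (\<sigma> l))"
    by (simp add: hperm_T[OF permutes_inj[OF \<sigma>]])
  have one: "fperm \<sigma> F 1 1 = F 1 1" by (simp add: hperm_hom)
  have X: "has_weight n F (eps (\<sigma> i)) (X (\<sigma> i) \<alpha>)" and D: "has_weight n F (\<lambda>l. - eps (\<sigma> i) l) (D (\<sigma> i) \<alpha>)"
    if "i \<in> {1..n}" "\<alpha> \<in> {1..N}" for i \<alpha>
    using s that permutes_in_image[OF \<sigma>, of i] unfolding diff_sys_def by blast+
  have "has_weight n (fperm \<sigma> F) (eps i) (X (\<sigma> i) \<alpha>)" "has_weight n (fperm \<sigma> F) (\<lambda>l. - eps i l) (D (\<sigma> i) \<alpha>)"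
    if "i \<in> {1..n}" "\<alpha> \<in> {1..N}" for i \<alpha>
    using has_weight_fperm[OF X[OF that] \<sigma>] has_weight_fperm[OF D[OF that] \<sigma>] by (simp_all add: eps_permutes[OF \<sigma>])
  moreover have "frac_hom n S (fperm \<sigma> F)"
    using s frac_hom_fperm[OF _ \<sigma>] unfolding diff_sys_def by blast
  ultimately show ?thesis
    using s rel_permute[OF \<sigma>] unfolding diff_sys_def T one by blast
qed

lemma dra_sys_permute:
  assumes s: "dra_sys n S F Tn Td L" and \<sigma>: "\<sigma> permutes {1..n}"
  shows "dra_sys n S (fperm \<sigma> F) Tn Td (\<lambda>k i. L (\<sigma> k) (\<sigma> i))"
proof -
  have T: "fmat (fperm \<sigma> F) Tn Td = (\<lambda>i j k l. fmat F Tn Td (\<sigma> i) (\<sigma> j) (\<sigma> k) (\<sigma> l))"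
    by (simp add: hperm_T[OF permutes_inj[OF \<sigma>]])
  have Lm: "lmat (\<lambda>k i. L (\<sigma> k) (\<sigma> i)) = (\<lambda>i j k l. lmat L (\<sigma> i) (\<sigma> j) (\<sigma> k) (\<sigma> l))"
    using inj_eq[OF permutes_inj[OF \<sigma>]] by (simp add: fun_eq_iff lmat_def)
  have L: "has_weight n F (\<lambda>l. eps (\<sigma> i) l - eps (\<sigma> k) l) (L (\<sigma> k) (\<sigma> i))"
    if "i \<in> {1..n}" "k \<in> {1..n}" for i k
    using s that permutes_in_image[OF \<sigma>] unfolding dra_sys_def by blast
  have "has_weight n (fperm \<sigma> F) (\<lambda>l. eps i l - eps k l) (L (\<sigma> k) (\<sigma> i))"
    if "i \<in> {1..n}" "k \<in> {1..n}" for i k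
    using has_weight_fperm[OF L[OF that] \<sigma>] by (simp add: eps_permutes[OF \<sigma>])
  moreover have "frac_hom n S (fperm \<sigma> F)"
    using s frac_hom_fperm[OF _ \<sigma>] unfolding dra_sys_def by blast
  ultimately show ?thesis
    using s refl_eq_permute[OF \<sigma>] unfolding dra_sys_def T Lm by blast
qed

text \<open>The gauge transformation is used in both directions: with \<open>g = 1 / \<chi>\<close> it makes the relations symmetric, and
with \<open>g = \<chi>\<close> it goes back.\<close>

lemma gauge_cond_RT:
  "gauge_cond n Rn Rd Tn Td (\<lambda>_. 1 :: 'k::comm_ring_1 hpoly) (chi n)"
  "gauge_cond n Tn Td Rn Rd (chi n) (\<lambda>_. 1 :: 'k hpoly)"
proof -
  have RT: "Tn i j k l * Rd i j k l * (chi n i * sh i (chi n j))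
    = Rn i j k l * Td i j k l * (chi n k * sh k (chi n l) :: 'k hpoly)"
    if "i \<in> {1..n}" "j \<in> {1..n}" for i j k l
    using gauge_RT[OF that, of k l, unfolded gauge_def, where 'k='k] by (simp only: mult_ac)
  show "gauge_cond n Rn Rd Tn Td (\<lambda>_. 1 :: 'k hpoly) (chi n)"
    unfolding gauge_cond_def
    by (intro conjI ballI) (simp_all add: hshift_hom RT del: atLeastAtMost_iff)
  show "gauge_cond n Tn Td Rn Rd (chi n) (\<lambda>_. 1 :: 'k hpoly)"
    unfolding gauge_cond_def
    by (intro conjI ballI) (simp_all add: hshift_hom RT del: atLeastAtMost_iff)
qed

text \<open>Gauge transformation by \<open>1 / \<chi>\<close>, relabelling by \<open>\<sigma>\<close>, and gauge transformation by \<open>\<chi>\<close>. The last step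
takes place after \<open>\<sigma>\<close> has been applied to the coefficients, so that it inserts \<open>\<sigma>(\<chi>\<^sub>i)\<close>.\<close>

lemma diff_sys_symmetric:
  assumes s: "diff_sys n N S F Rn Rd X D" and \<sigma>: "\<sigma> permutes {1..n}"
  shows "diff_sys n N S (fperm \<sigma> F) Rn Rd
    (\<lambda>i \<alpha>. F (hperm \<sigma> (chi n i)) 1 * (F 1 (chi n (\<sigma> i)) * X (\<sigma> i) \<alpha>))
    (\<lambda>i \<alpha>. D (\<sigma> i) \<alpha> * F (chi n (\<sigma> i)) 1 * F 1 (hperm \<sigma> (chi n i)))"
proof -
  have h: "frac_hom n S F" using s unfolding diff_sys_def by blast
  note 1 = diff_sys_permute[OF diff_sys_gauge[OF h gauge_cond_RT(1) s] \<sigma>]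
  show ?thesis
    using diff_sys_gauge[OF frac_hom_fperm[OF h \<sigma>] gauge_cond_RT(2) 1] by (simp add: hperm_hom)
qed

lemma dra_sys_symmetric:
  assumes s: "dra_sys n S F Rn Rd L" and \<sigma>: "\<sigma> permutes {1..n}"
  shows "dra_sys n S (fperm \<sigma> F) Rn Rd
    (\<lambda>k i. F (hperm \<sigma> (chi n i)) 1 * (F 1 (chi n (\<sigma> i)) * L (\<sigma> k) (\<sigma> i) * F (chi n (\<sigma> k)) 1)
       * F 1 (hperm \<sigma> (chi n k)))"
proof -
  have h: "frac_hom n S F" using s unfolding dra_sys_def by blast
  note 1 = dra_sys_permute[OF dra_sys_gauge[OF h gauge_cond_RT(1) s] \<sigma>]
  show ?thesis
    using dra_sys_gauge[OF frac_hom_fperm[OF h \<sigma>] gauge_cond_RT(2) 1] by (simp add: hperm_hom)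
qed

lemma dra_sys_oscillator:
  assumes s: "diff_sys n N S F Rn Rd X D"
  shows "dra_sys n S F Rn Rd (\<lambda>k i. \<Sum>\<alpha>\<in>{1..N}. X i \<alpha> * D k \<alpha>)"
proof -
  have X: "has_weight n F (eps i) (X i \<alpha>)" and D: "has_weight n F (\<lambda>l. - eps i l) (D i \<alpha>)"
    if "i \<in> {1..n}" "\<alpha> \<in> {1..N}" for i \<alpha>
    using s that unfolding diff_sys_def by blast+
  have "has_weight n F (\<lambda>l. eps i l - eps k l) (\<Sum>\<alpha>\<in>{1..N}. X i \<alpha> * D k \<alpha>)"
    if ik: "i \<in> {1..n}" "k \<in> {1..n}" for i k
    unfolding has_weight_def
  proof (intro conjI ballI)
    show "F 1 1 * (\<Sum>\<alpha>\<in>{1..N}. X i \<alpha> * D k \<alpha>) = (\<Sum>\<alpha>\<in>{1..N}. X i \<alpha> * D k \<alpha>)"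
      using has_weight_unit(1)[OF X[OF ik(1)]] by (simp add: sum_distrib_left mult.assoc[symmetric])
    show "(\<Sum>\<alpha>\<in>{1..N}. X i \<alpha> * D k \<alpha>) * F 1 1 = (\<Sum>\<alpha>\<in>{1..N}. X i \<alpha> * D k \<alpha>)"
      using has_weight_unit(2)[OF D[OF ik(2)]] by (simp add: sum_distrib_right mult.assoc)
    fix p s :: "'a hpoly" assume ps: "p \<in> Pol n" "s \<in> Den n"
    let ?e = "\<lambda>l. eps i l - eps k l"
    show "F p s * (\<Sum>\<alpha>\<in>{1..N}. X i \<alpha> * D k \<alpha>) = (\<Sum>\<alpha>\<in>{1..N}. X i \<alpha> * D k \<alpha>) * F (hshift ?e p) (hshift ?e s)"
      unfolding sum_distrib_left sum_distrib_right
    proof (intro sum.cong refl)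
      fix \<alpha> assume \<alpha>: "\<alpha> \<in> {1..N}"
      have "F p s * X i \<alpha> = X i \<alpha> * F (hshift (eps i) p) (hshift (eps i) s)"
        using X[OF ik(1) \<alpha>] ps unfolding has_weight_def by blast
      moreover have "F (hshift (eps i) p) (hshift (eps i) s) * D k \<alpha> = D k \<alpha> * F (hshift ?e p) (hshift ?e s)"
        using has_weight_shift[OF D[OF ik(2) \<alpha>] ps, of "eps i"] by simp
      ultimately show "F p s * (X i \<alpha> * D k \<alpha>) = X i \<alpha> * D k \<alpha> * F (hshift ?e p) (hshift ?e s)"
        by (metis mult.assoc)
    qed
  qed
  moreover have "refl_eq n (fmat F Rn Rd) (lmat (\<lambda>k i. \<Sum>\<alpha>\<in>{1..N}. X i \<alpha> * D k \<alpha>))"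
    using s X unfolding diff_sys_def has_weight_def
    by (intro refl_eq_oscillator[OF refl, where e="F 1 1"]) auto
  ultimately show ?thesis
    using s unfolding diff_sys_def dra_sys_def by blast
qed

section \<open>Relators as systems of equations\<close>

definition alg_hom :: "(('g, 'k::comm_ring_1) free_alg \<Rightarrow> 'r::ring_1) \<Rightarrow> bool" where
  "alg_hom h \<longleftrightarrow> (\<forall>p q. h (p + q) = h p + h q \<and> h (p - q) = h p - h q \<and> h (p * q) = h p * h q)"

lemma alg_homD:
  assumes "alg_hom h"
  shows "h (p + q) = h p + h q" "h (p - q) = h p - h q" "h (p * q) = h p * h q" "h 0 = 0"
    "h (- p) = - h p" "h (sum f A) = (\<Sum>i\<in>A. h (f i))"
proof -
  show *: "h (p + q) = h p + h q" "h (p - q) = h p - h q" "h (p * q) = h p * h q" for p q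
    using assms unfolding alg_hom_def by blast+
  show 0: "h 0 = 0" using *(2)[of 0 0] by simp
  show "h (- p) = - h p" using *(2)[of 0 p] 0 by simp
  show "h (sum f A) = (\<Sum>i\<in>A. h (f i))"
    by (induct A rule: infinite_finite_induct) (simp_all add: * 0)
qed

lemma alg_hom_quotval: "alg_hom (quotval G P)"
  by (simp add: alg_hom_def quotval_hom)

lemma alg_hom_quotval_lift: "alg_hom (\<lambda>p. quotval G P (free_lift f p))"
  by (simp add: alg_hom_def quotval_hom free_lift_hom)

text \<open>For arguments that do not form a fraction both sides are the empty set. The unconditional form lets
\<^term>\<open>\<lambda>p s. coef (uperm n \<sigma> (ufrac n p s))\<close> be rewritten as a function.\<close>

lemma uperm_ufrac_all:
  assumes \<sigma>: "\<sigma> permutes {1..n}"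
  shows "uperm n \<sigma> (ufrac n p s) = ufrac n (hperm \<sigma> p) (hperm \<sigma> s)"
proof (cases "p \<in> Pol n \<and> s \<in> Den n")
  case True
  then show ?thesis using uperm_ufrac \<sigma> by blast
next
  case False
  have empty: "ufrac n q t = {}" if "\<not> (q \<in> Pol n \<and> t \<in> Den n)" for q t :: "'a hpoly"
    using that by (auto simp: ufrac_def loc_frac_def loc_rel_def)
  have inv_hperm: "hperm (inv_into UNIV \<sigma>) (hperm \<sigma> q) = q" for q :: "'a hpoly"
    using permutes_inv_o(2)[OF \<sigma>] by (simp add: hperm_hperm hperm_id)
  have "\<not> (hperm \<sigma> p \<in> Pol n \<and> hperm \<sigma> s \<in> Den n)"
    using hperm_Pol[OF permutes_inv[OF \<sigma>], of "hperm \<sigma> p"] hperm_Den[OF permutes_inv[OF \<sigma>], of "hperm \<sigma> s"] False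
    unfolding inv_hperm by blast
  then show ?thesis using empty False by (simp add: uperm_def loc_map_def)
qed

context
  fixes n :: nat and h :: "('e, 'k::comm_ring_1) hfree \<Rightarrow> 'r::ring_1"
  assumes h: "alg_hom h"
begin

abbreviation (input) "hF p s \<equiv> h (coef (ufrac n p s))"
abbreviation (input) "hS c \<equiv> h (scalar c)"

lemma coef_rels_iff: "(\<forall>r\<in>coef_rels n. h r = 0) \<longleftrightarrow> frac_hom n (\<lambda>c. hS c) (\<lambda>p s. hF p s)"
proof -
  have "(\<forall>r\<in>coef_rels n. h r = 0) \<longleftrightarrow>
    (\<forall>u\<in>carrier (Ubar n). \<forall>v\<in>carrier (Ubar n). h (coef (u \<oplus>\<^bsub>Ubar n\<^esub> v) - (coef u + coef v)) = 0) \<and>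
    (\<forall>u\<in>carrier (Ubar n). \<forall>v\<in>carrier (Ubar n). h (coef (u \<otimes>\<^bsub>Ubar n\<^esub> v) - coef u * coef v) = 0) \<and>
    (\<forall>c. h (coef (ufrac n (Poly_Mapping.single 0 c) 1) - scalar c) = 0)"
    unfolding coef_rels_def ball_Un by blast
  also have "\<dots> \<longleftrightarrow>
    (\<forall>u\<in>carrier (Ubar n). \<forall>v\<in>carrier (Ubar n).
      h (coef (u \<oplus>\<^bsub>Ubar n\<^esub> v)) = h (coef u) + h (coef v) \<and>
      h (coef (u \<otimes>\<^bsub>Ubar n\<^esub> v)) = h (coef u) * h (coef v)) \<and>
    (\<forall>c. hF (Poly_Mapping.single 0 c) 1 = hS c)" (is "_ \<longleftrightarrow> ?A")
    unfolding alg_homD(1-3)[OF h] right_minus_eq by blast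
  also have "\<dots> \<longleftrightarrow> frac_hom n (\<lambda>c. hS c) (\<lambda>p s. hF p s)"
  proof
    assume A: ?A
    then have 1: "h (coef (u \<oplus>\<^bsub>Ubar n\<^esub> v)) = h (coef u) + h (coef v)"
      "h (coef (u \<otimes>\<^bsub>Ubar n\<^esub> v)) = h (coef u) * h (coef v)"
      if "u \<in> carrier (Ubar n)" "v \<in> carrier (Ubar n)" for u v
      using that by blast+
    show "frac_hom n (\<lambda>c. hS c) (\<lambda>p s. hF p s)"
      unfolding frac_hom_def
    proof (intro conjI ballI allI impI)
      fix p q s t :: "'k hpoly" assume *: "p \<in> Pol n" "q \<in> Pol n" "s \<in> Den n" "t \<in> Den n"
      show "hF p s * hF q t = hF (p * q) (s * t)" "hF p s + hF q t = hF (p * t + q * s) (s * t)"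
        using 1[of "ufrac n p s" "ufrac n q t"] * by (simp_all add: ufrac_mult ufrac_add)
      show "hF p s = hF q t" if "p * t = q * s"
        using ufrac_eq[OF * that] by simp
    qed (use A in blast)
  next
    assume B: "frac_hom n (\<lambda>c. hS c) (\<lambda>p s. hF p s)"
    show ?A
    proof (intro conjI ballI allI)
      fix u v :: "'k ubar" assume uv: "u \<in> carrier (Ubar n)" "v \<in> carrier (Ubar n)"
      then obtain p s q t where *: "u = ufrac n p s" "v = ufrac n q t"
        "p \<in> Pol n" "s \<in> Den n" "q \<in> Pol n" "t \<in> Den n"
        unfolding carrier_Ubar by blast
      show "h (coef (u \<oplus>\<^bsub>Ubar n\<^esub> v)) = h (coef u) + h (coef v)"
        "h (coef (u \<otimes>\<^bsub>Ubar n\<^esub> v)) = h (coef u) * h (coef v)"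
        using * hrepD(1,2)[OF B, of p q s t] by (simp_all add: ufrac_mult ufrac_add)
    qed (use hrepD(4)[OF B] in blast)
  qed
  finally show ?thesis .
qed

lemma weight_rels_iff:
  assumes "frac_hom n (\<lambda>c. hS c) (\<lambda>p s. hF p s)"
  shows "(\<forall>r\<in>weight_rels n E wt. h r = 0) \<longleftrightarrow> (\<forall>e\<in>E. has_weight n (\<lambda>p s. hF p s) (wt e) (h (elt e)))"
proof -
  have one: "hF 1 1 = h 1"
    using hrepD(4)[OF assms, of 1] by simp
  have unit: "hF 1 1 * h p = h p" "h p * hF 1 1 = h p" for p
    unfolding one alg_homD(3)[OF h, symmetric] by simp_all
  have "(\<forall>r\<in>weight_rels n E wt. h r = 0) \<longleftrightarrow> (\<forall>e\<in>E. \<forall>u\<in>carrier (Ubar n).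
      h (coef u * elt e - elt e * coef (ushift n (wt e) u)) = 0)"
    unfolding weight_rels_def by blast
  also have "\<dots> \<longleftrightarrow> (\<forall>e\<in>E. \<forall>p\<in>Pol n. \<forall>s\<in>Den n.
      hF p s * h (elt e) = h (elt e) * h (coef (ushift n (wt e) (ufrac n p s))))"
    unfolding carrier_Ubar alg_homD(1-3)[OF h] right_minus_eq by blast
  also have "\<dots> \<longleftrightarrow> (\<forall>e\<in>E. has_weight n (\<lambda>p s. hF p s) (wt e) (h (elt e)))"
    unfolding has_weight_def unit by (simp add: ushift_ufrac)
  finally show ?thesis .
qed

end

lemma ball_diff_elts:
  "(\<forall>e\<in>diff_elts n N. Q e) \<longleftrightarrow> (\<forall>i\<in>{1..n}. \<forall>\<alpha>\<in>{1..N}. Q (XGen i \<alpha>) \<and> Q (DGen i \<alpha>))"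
  unfolding diff_elts_def by blast

lemma ball_dra_elts: "(\<forall>e\<in>dra_elts n. Q e) \<longleftrightarrow> (\<forall>i\<in>{1..n}. \<forall>k\<in>{1..n}. Q (LGen k i))"
  unfolding dra_elts_def by blast

text \<open>From left to right this is used for the canonical map to the algebra itself; from right to left it
shows that a map of generators extends to the presented algebra.\<close>

lemma diff_rels_iff:
  fixes h :: "(diff_gen, 'k::comm_ring_1) hfree \<Rightarrow> 'r::ring_1"
  assumes h: "alg_hom h"
  shows "(\<forall>r\<in>diff_rels n N. h r = 0) \<longleftrightarrow>
    diff_sys n N (\<lambda>c. h (scalar c)) (\<lambda>p s. h (coef (ufrac n p s))) Rn Rd
      (\<lambda>i \<alpha>. h (xg i \<alpha>)) (\<lambda>i \<alpha>. h (dg i \<alpha>))"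
proof -
  let ?F = "\<lambda>p s. h (coef (ufrac n p s))" and ?S = "\<lambda>c. h (scalar c)"
  let ?R = "fmat ?F Rn Rd" and ?X = "\<lambda>i \<alpha>. h (xg i \<alpha>)" and ?D = "\<lambda>i \<alpha>. h (dg i \<alpha>)"
  let ?I = "{1..n}" and ?A = "{1..N}"
  define P1 where "P1 = {xg i \<alpha> * xg j \<beta>
        - (\<Sum>k\<in>{1..n}. \<Sum>l\<in>{1..n}. coef (Rhat n i j k l) * xg k \<beta> * xg l \<alpha> :: (diff_gen, 'k) hfree)
       | i j \<alpha> \<beta>. i \<in> {1..n} \<and> j \<in> {1..n} \<and> \<alpha> \<in> {1..N} \<and> \<beta> \<in> {1..N}}"
  define P2 where "P2 = {dg i \<alpha> * dg j \<beta>
        - (\<Sum>k\<in>{1..n}. \<Sum>l\<in>{1..n}. coef (Rhat n l k j i) * dg k \<beta> * dg l \<alpha> :: (diff_gen, 'k) hfree)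
       | i j \<alpha> \<beta>. i \<in> {1..n} \<and> j \<in> {1..n} \<and> \<alpha> \<in> {1..N} \<and> \<beta> \<in> {1..N}}"
  define P3 where "P3 = {xg i \<alpha> * dg j \<beta>
        - ((\<Sum>k\<in>{1..n}. \<Sum>l\<in>{1..n}.
              coef (ushift n (eps k) (Rhat n k i l j)) * dg k \<beta> * xg l \<alpha>)
           - (if \<alpha> = \<beta> \<and> i = j then 1 else 0 :: (diff_gen, 'k) hfree))
       | i j \<alpha> \<beta>. i \<in> {1..n} \<and> j \<in> {1..n} \<and> \<alpha> \<in> {1..N} \<and> \<beta> \<in> {1..N}}"
  have rels: "diff_rels n N = coef_rels n \<union> weight_rels n (diff_elts n N) diff_wt \<union> P1 \<union> P2 \<union> P3"
    unfolding diff_rels_def P1_def P2_def P3_def ..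
  let ?h = "frac_hom n ?S ?F"
  let ?w = "\<forall>i\<in>?I. \<forall>\<alpha>\<in>?A. has_weight n ?F (eps i) (?X i \<alpha>) \<and> has_weight n ?F (\<lambda>l. - eps i l) (?D i \<alpha>)"
  have w: "(\<forall>r\<in>weight_rels n (diff_elts n N) diff_wt. h r = 0) \<longleftrightarrow> ?w" if ?h
    unfolding weight_rels_iff[OF h that] by (subst ball_diff_elts) simp
  have 1: "(\<forall>r\<in>P1. h r = 0) \<longleftrightarrow> xx_rel ?I ?A ?R ?X"
  proof -
    have "(\<forall>r\<in>P1. h r = 0) \<longleftrightarrow> (\<forall>i\<in>?I. \<forall>j\<in>?I. \<forall>\<alpha>\<in>?A. \<forall>\<beta>\<in>?A.
       h (xg i \<alpha> * xg j \<beta> - (\<Sum>k\<in>?I. \<Sum>l\<in>?I. coef (Rhat n i j k l) * xg k \<beta> * xg l \<alpha>)) = 0)"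
      unfolding P1_def by blast
    then show ?thesis
      unfolding xx_rel_def by (simp add: alg_homD[OF h] Rhat_ufrac)
  qed
  have 2: "(\<forall>r\<in>P2. h r = 0) \<longleftrightarrow> dd_rel ?I ?A ?R ?D" if hr: ?h and wt: ?w
  proof -
    have swap: "?R l k j i * ?D k \<beta> * ?D l \<alpha> = ?D k \<beta> * ?D l \<alpha> * ?R l k j i"
      if *: "k \<in> ?I" "l \<in> ?I" "j \<in> ?I" "i \<in> ?I" "\<alpha> \<in> ?A" "\<beta> \<in> ?A" for i j k l \<alpha> \<beta>
    proof (cases "Rn l k j i = (0 :: 'k hpoly)")
      case True
      then show ?thesis using frac_hom_zero[OF hr RT_Pol(2)[OF *(2,1)]] by simp
    next
      case False
      have D: "?F p s * ?D k \<beta> = ?D k \<beta> * ?F (sh k p) (sh k s)"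
        "?F p s * ?D l \<alpha> = ?D l \<alpha> * ?F (sh l p) (sh l s)" if "p \<in> Pol n" "s \<in> Den n" for p s
        using wt * that unfolding has_weight_def by blast+
      have "?R l k j i * ?D k \<beta> * ?D l \<alpha> = ?D k \<beta> * (?F (sh k (Rn l k j i)) (sh k (Rd l k j i)) * ?D l \<alpha>)"
        using D(1)[OF RT_Pol(1,2)[OF *(2,1)]] by (simp add: mult.assoc)
      also have "\<dots> = ?D k \<beta> * (?D l \<alpha> * ?F (sh l (sh k (Rn l k j i))) (sh l (sh k (Rd l k j i))))"
        by (subst D(2)[OF hshift_Pol[OF RT_Pol(1)[OF *(2,1)]] hshift_Den[OF RT_Pol(2)[OF *(2,1)]]]) (rule refl)
      also have "\<dots> = ?D k \<beta> * ?D l \<alpha> * ?R l k j i"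
        by (simp add: sh_sh_R[OF False] mult.assoc)
      finally show ?thesis .
    qed
    have "(\<forall>r\<in>P2. h r = 0) \<longleftrightarrow> (\<forall>i\<in>?I. \<forall>j\<in>?I. \<forall>\<alpha>\<in>?A. \<forall>\<beta>\<in>?A.
       h (dg i \<alpha> * dg j \<beta> - (\<Sum>k\<in>?I. \<Sum>l\<in>?I. coef (Rhat n l k j i) * dg k \<beta> * dg l \<alpha>)) = 0)"
      unfolding P2_def by blast
    also have "\<dots> \<longleftrightarrow> (\<forall>i\<in>?I. \<forall>j\<in>?I. \<forall>\<alpha>\<in>?A. \<forall>\<beta>\<in>?A.
       ?D i \<alpha> * ?D j \<beta> = (\<Sum>k\<in>?I. \<Sum>l\<in>?I. ?R l k j i * ?D k \<beta> * ?D l \<alpha>))"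
      by (simp add: alg_homD[OF h] Rhat_ufrac)
    also have "\<dots> \<longleftrightarrow> dd_rel ?I ?A ?R ?D"
      unfolding dd_rel_def using swap by (intro ball_cong refl arg_cong2[of _ _ _ _ "(=)"] sum.cong) blast
    finally show ?thesis .
  qed
  have 3: "(\<forall>r\<in>P3. h r = 0) \<longleftrightarrow> xd_rel ?I ?A (?F 1 1) ?R ?X ?D" if hr: ?h and wt: ?w
  proof -
    have one: "h 1 = ?F 1 1"
      using hrepD(4)[OF hr, of 1] by simp
    have swap: "h (coef (ushift n (eps k) (Rhat n k i l j))) * ?D k \<beta> * ?X l \<alpha> = ?D k \<beta> * ?R k i l j * ?X l \<alpha>"
      if *: "k \<in> ?I" "l \<in> ?I" "j \<in> ?I" "i \<in> ?I" "\<beta> \<in> ?A" for i j k l \<alpha> \<beta>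
    proof -
      have "has_weight n ?F (\<lambda>l. - eps k l) (?D k \<beta>)" using wt * by blast
      from has_weight_shift[OF this RT_Pol(1,2)[OF *(1,4)], of "eps k" l j] show ?thesis
        unfolding Rhat_ufrac ushift_ufrac[OF RT_Pol(1,2)[OF *(1,4)]] by (simp add: hshift_zero)
    qed
    have "(\<forall>r\<in>P3. h r = 0) \<longleftrightarrow> (\<forall>i\<in>?I. \<forall>j\<in>?I. \<forall>\<alpha>\<in>?A. \<forall>\<beta>\<in>?A.
       h (xg i \<alpha> * dg j \<beta> - ((\<Sum>k\<in>?I. \<Sum>l\<in>?I.
              coef (ushift n (eps k) (Rhat n k i l j)) * dg k \<beta> * xg l \<alpha>)
           - (if \<alpha> = \<beta> \<and> i = j then 1 else 0))) = 0)"
      unfolding P3_def by blast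
    also have "\<dots> \<longleftrightarrow> (\<forall>i\<in>?I. \<forall>j\<in>?I. \<forall>\<alpha>\<in>?A. \<forall>\<beta>\<in>?A.
       ?X i \<alpha> * ?D j \<beta> = (\<Sum>k\<in>?I. \<Sum>l\<in>?I.
              h (coef (ushift n (eps k) (Rhat n k i l j))) * ?D k \<beta> * ?X l \<alpha>)
           - (if \<alpha> = \<beta> \<and> i = j then ?F 1 1 else 0))"
      by (simp add: alg_homD[OF h] one[symmetric] if_distrib[of h])
    also have "\<dots> \<longleftrightarrow> xd_rel ?I ?A (?F 1 1) ?R ?X ?D"
      unfolding xd_rel_def using swap
      by (intro ball_cong refl arg_cong2[of _ _ _ _ "(=)"] arg_cong2[of _ _ _ _ minus] sum.cong) blast
    finally show ?thesis .
  qed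
  show ?thesis
    unfolding rels ball_Un diff_sys_def coef_rels_iff[OF h] using w 1 2 3 by blast
qed

lemma dra_rels_iff:
  fixes h :: "(dra_gen, 'k::comm_ring_1) hfree \<Rightarrow> 'r::ring_1"
  assumes h: "alg_hom h"
  shows "(\<forall>r\<in>dra_rels n. h r = 0) \<longleftrightarrow>
    dra_sys n (\<lambda>c. h (scalar c)) (\<lambda>p s. h (coef (ufrac n p s))) Rn Rd (\<lambda>k i. h (lg k i))"
proof -
  let ?F = "\<lambda>p s. h (coef (ufrac n p s))" and ?S = "\<lambda>c. h (scalar c)"
  let ?R = "fmat ?F Rn Rd" and ?L = "lmat (\<lambda>k i. h (lg k i))" and ?I = "{1..n}"
  have w: "(\<forall>r\<in>weight_rels n (dra_elts n) dra_wt. h r = 0) \<longleftrightarrow>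
      (\<forall>i\<in>?I. \<forall>k\<in>?I. has_weight n ?F (\<lambda>l. eps i l - eps k l) (h (lg k i)))" if "frac_hom n ?S ?F"
    unfolding weight_rels_iff[OF h that] by (subst ball_dra_elts) simp
  have mm: "(\<lambda>i j k l. h (mm n A B i j k l)) = mm n (\<lambda>i j k l. h (A i j k l)) (\<lambda>i j k l. h (B i j k l))" for A B
    by (simp add: fun_eq_iff mat4_mult_def alg_homD[OF h])
  have R: "(\<lambda>i j k l. h (R12 n i j k l)) = ?R"
    by (simp add: R12_def Rhat_ufrac)
  have L: "(\<lambda>i j k l. h (L1 i j k l)) = ?L"
    by (simp add: fun_eq_iff L1_def lmat_def alg_homD(4)[OF h] if_distrib[of "\<lambda>x. _ * x"])
  note mmR = mm[THEN fun_cong, THEN fun_cong, THEN fun_cong, THEN fun_cong]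
  have "(\<forall>r\<in>{reflection_lhs n i j k l - reflection_rhs n i j k l | i j k l.
        i \<in> {1..n} \<and> j \<in> {1..n} \<and> k \<in> {1..n} \<and> l \<in> {1..n}}. h r = 0) \<longleftrightarrow>
    (\<forall>i\<in>?I. \<forall>j\<in>?I. \<forall>k\<in>?I. \<forall>l\<in>?I. h (reflection_lhs n i j k l - reflection_rhs n i j k l) = 0)"
    by blast
  also have "\<dots> \<longleftrightarrow> refl_eq n ?R ?L"
    unfolding refl_eq_def reflection_lhs_def reflection_rhs_def alg_homD(2)[OF h] mmR mm R L right_minus_eq ..
  finally have refl: "(\<forall>r\<in>{reflection_lhs n i j k l - reflection_rhs n i j k l | i j k l.
        i \<in> {1..n} \<and> j \<in> {1..n} \<and> k \<in> {1..n} \<and> l \<in> {1..n}}. h r = 0) \<longleftrightarrow> refl_eq n ?R ?L" .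
  show ?thesis
    unfolding dra_rels_def ball_Un dra_sys_def coef_rels_iff[OF h] refl using w by blast
qed

subsection \<open>Relators lie in the free algebras\<close>

lemma ubar_closed:
  assumes "u \<in> carrier (Ubar n)"
  shows "v \<in> carrier (Ubar n) \<Longrightarrow> u \<oplus>\<^bsub>Ubar n\<^esub> v \<in> carrier (Ubar n)"
    "v \<in> carrier (Ubar n) \<Longrightarrow> u \<otimes>\<^bsub>Ubar n\<^esub> v \<in> carrier (Ubar n)"
    "ushift n e u \<in> carrier (Ubar n)" "\<sigma> permutes {1..n} \<Longrightarrow> uperm n \<sigma> u \<in> carrier (Ubar n)"
proof -
  obtain p s where u: "u = ufrac n p s" "p \<in> Pol n" "s \<in> Den n"
    using assms unfolding carrier_Ubar by blast
  have "u \<oplus>\<^bsub>Ubar n\<^esub> v \<in> carrier (Ubar n) \<and> u \<otimes>\<^bsub>Ubar n\<^esub> v \<in> carrier (Ubar n)"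
    if v: "v \<in> carrier (Ubar n)"
  proof -
    obtain q t where "v = ufrac n q t" "q \<in> Pol n" "t \<in> Den n"
      using v unfolding carrier_Ubar by blast
    with u show ?thesis by (simp add: ufrac_mult ufrac_add)
  qed
  then show "v \<in> carrier (Ubar n) \<Longrightarrow> u \<oplus>\<^bsub>Ubar n\<^esub> v \<in> carrier (Ubar n)"
    "v \<in> carrier (Ubar n) \<Longrightarrow> u \<otimes>\<^bsub>Ubar n\<^esub> v \<in> carrier (Ubar n)" by blast+
  show "ushift n e u \<in> carrier (Ubar n)" "\<sigma> permutes {1..n} \<Longrightarrow> uperm n \<sigma> u \<in> carrier (Ubar n)"
    using u by (simp_all add: ushift_ufrac uperm_ufrac)
qed

lemma in_alg_coef [simp, intro]: "u \<in> carrier (Ubar n) \<Longrightarrow> in_alg (hgens n E) (coef u)"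
  by (auto simp: hgens_def)

lemma in_alg_elt [simp, intro]: "e \<in> E \<Longrightarrow> in_alg (hgens n E) (elt e)"
  by (auto simp: hgens_def)

lemma hrels_closed:
  "coef_rels n \<subseteq> carrier (free_alg (hgens n E))"
  "weight_rels n E wt \<subseteq> carrier (free_alg (hgens n E))"
proof -
  show "coef_rels n \<subseteq> carrier (free_alg (hgens n E))"
    unfolding coef_rels_def by (auto intro!: in_alg_intros(5-7) in_alg_intros(3) in_alg_coef ubar_closed)
  show "weight_rels n E wt \<subseteq> carrier (free_alg (hgens n E))"
    unfolding weight_rels_def by (auto intro!: in_alg_intros(5-7) in_alg_coef in_alg_elt ubar_closed)
qed

lemma Rhat_carrier: "i \<in> {1..n} \<Longrightarrow> j \<in> {1..n} \<Longrightarrow> Rhat n i j k l \<in> carrier (Ubar n)"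
  unfolding Rhat_ufrac by (intro ufrac_carrier RT_Pol)

lemma in_alg_xg: "i \<in> {1..n} \<Longrightarrow> \<alpha> \<in> {1..N} \<Longrightarrow> in_alg (hgens n (diff_elts n N)) (xg i \<alpha>)"
  and in_alg_dg: "i \<in> {1..n} \<Longrightarrow> \<alpha> \<in> {1..N} \<Longrightarrow> in_alg (hgens n (diff_elts n N)) (dg i \<alpha>)"
  and in_alg_lg: "i \<in> {1..n} \<Longrightarrow> k \<in> {1..n} \<Longrightarrow> in_alg (hgens n (dra_elts n)) (lg k i)"
  by (auto intro!: in_alg_elt simp: diff_elts_def dra_elts_def)

lemma diff_rels_closed:
  "(diff_rels n N :: (diff_gen, 'k::comm_ring_1) hfree set) \<subseteq> carrier (free_alg (hgens n (diff_elts n N)))"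
proof -
  let ?G = "hgens n (diff_elts n N) :: ('k ubar, diff_gen) gen set"
  have if_in: "in_alg ?G (if b then 1 else (0 :: (diff_gen, 'k) hfree))" for b
    by simp
  note intros = in_alg_intros(5-7) in_alg_sum in_alg_coef ubar_closed(3) Rhat_carrier in_alg_xg in_alg_dg if_in
  show ?thesis
    unfolding diff_rels_def
    by (intro Un_least hrels_closed; clarify; intro intros; assumption)
qed

lemma dra_rels_closed:
  "(dra_rels n :: (dra_gen, 'k::comm_ring_1) hfree set) \<subseteq> carrier (free_alg (hgens n (dra_elts n)))"
proof -
  let ?I = "{1..n}"
  let ?G = "hgens n (dra_elts n) :: ('k ubar, dra_gen) gen set"
  have L: "in_alg ?G (L1 i j k l :: (dra_gen, 'k) hfree)" if "i \<in> ?I" "k \<in> ?I" for i j k l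
    by (simp add: L1_def in_alg_lg[OF that])
  have R: "in_alg ?G (R12 n i j k l :: (dra_gen, 'k) hfree)" if "i \<in> ?I" "j \<in> ?I" for i j k l
    unfolding R12_def using that by (intro in_alg_coef Rhat_carrier)
  have mm: "in_alg ?G (mm n A B i j k l :: (dra_gen, 'k) hfree)"
    if "\<And>a b. a \<in> ?I \<Longrightarrow> b \<in> ?I \<Longrightarrow> in_alg ?G (A i j a b)"
      "\<And>a b. a \<in> ?I \<Longrightarrow> b \<in> ?I \<Longrightarrow> in_alg ?G (B a b k l)" for A B i j k l
    unfolding mat4_mult_def using that by (intro in_alg_sum in_alg_intros(7))
  show ?thesis
    unfolding dra_rels_def reflection_lhs_def reflection_rhs_def
    by (intro Un_least hrels_closed; clarify; intro in_alg_intros(6) mm L R; assumption)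
qed

section \<open>Homomorphisms from the reduction algebra\<close>

lemma frac_hom_inverse:
  assumes "frac_hom n S F" "s \<in> Den n"
  shows "F s 1 * F 1 s = F 1 1" "F 1 s * F s 1 = F 1 1"
proof -
  have "F s s = F 1 1" using assms by (intro hrepD(3)[OF assms(1)]) auto
  then show "F s 1 * F 1 s = F 1 1" "F 1 s * F s 1 = F 1 1"
    using hrepD(1)[OF assms(1), of s 1 1 s] hrepD(1)[OF assms(1), of 1 s s 1] assms(2) by simp_all
qed

lemma frac_hom_unit:
  assumes "frac_hom n S F" "p \<in> Pol n" "s \<in> Den n"
  shows "F 1 1 * F p s = F p s" "F p s * F 1 1 = F p s"
  using hrepD(1)[OF assms(1), of 1 p 1 s] hrepD(1)[OF assms(1), of p 1 s 1] assms(2,3) by simp_all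

lemma quotval_relator:
  assumes "P \<subseteq> carrier (free_alg G)" "r \<in> P"
  shows "quotval G P r = 0"
  using assms quotval_eq_0_iff rel_ideal_sub by blast

abbreviation GD :: "nat \<Rightarrow> nat \<Rightarrow> ('k::comm_ring_1 ubar, diff_gen) gen set" where
  "GD n N \<equiv> hgens n (diff_elts n N)"

abbreviation GL :: "nat \<Rightarrow> ('k::comm_ring_1 ubar, dra_gen) gen set" where
  "GL n \<equiv> hgens n (dra_elts n)"

abbreviation ED :: "nat \<Rightarrow> nat \<Rightarrow> (diff_gen, 'k::comm_ring_1) hfree \<Rightarrow> (diff_gen, 'k) hfree univ_quot" where
  "ED n N \<equiv> quotval (GD n N) (diff_rels n N)"

abbreviation EL :: "nat \<Rightarrow> (dra_gen, 'k::comm_ring_1) hfree \<Rightarrow> (dra_gen, 'k) hfree univ_quot" where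
  "EL n \<equiv> quotval (GL n) (dra_rels n)"

lemma diff_sys_ED:
  "diff_sys n N (\<lambda>c. ED n N (scalar c)) (\<lambda>p s. ED n N (coef (ufrac n p s))) Rn Rd
     (\<lambda>i \<alpha>. ED n N (xg i \<alpha>)) (\<lambda>i \<alpha>. ED n N (dg i \<alpha>))"
  using diff_rels_iff[OF alg_hom_quotval] quotval_relator[OF diff_rels_closed] by blast

lemma dra_sys_EL:
  "dra_sys n (\<lambda>c. EL n (scalar c)) (\<lambda>p s. EL n (coef (ufrac n p s))) Rn Rd (\<lambda>k i. EL n (lg k i))"
  using dra_rels_iff[OF alg_hom_quotval] quotval_relator[OF dra_rels_closed] by blast

lemma frac_hom_ED: "frac_hom n (\<lambda>c. ED n N (scalar c)) (\<lambda>p s. ED n N (coef (ufrac n p s)))"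
  using diff_sys_ED unfolding diff_sys_def by blast

lemma frac_hom_EL: "frac_hom n (\<lambda>c. EL n (scalar c)) (\<lambda>p s. EL n (coef (ufrac n p s)))"
  using dra_sys_EL unfolding dra_sys_def by blast

lemma has_weight_ED:
  assumes "i \<in> {1..n}" "\<alpha> \<in> {1..N}"
  shows "has_weight n (\<lambda>p s. ED n N (coef (ufrac n p s))) (eps i) (ED n N (xg i \<alpha>))"
    "has_weight n (\<lambda>p s. ED n N (coef (ufrac n p s))) (\<lambda>l. - eps i l) (ED n N (dg i \<alpha>))"
  using diff_sys_ED assms unfolding diff_sys_def by blast+

lemma has_weight_EL:
  assumes "i \<in> {1..n}" "k \<in> {1..n}"
  shows "has_weight n (\<lambda>p s. EL n (coef (ufrac n p s))) (\<lambda>l. eps i l - eps k l) (EL n (lg k i))"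
  using dra_sys_EL assms unfolding dra_sys_def by blast

subsection \<open>The map to differential operators\<close>

lemma tau_relators: "r \<in> dra_rels n \<Longrightarrow> ED n N (free_lift (tau_gen N) r) = 0"
proof -
  have "dra_sys n (\<lambda>c. ED n N (free_lift (tau_gen N) (scalar c)))
     (\<lambda>p s. ED n N (free_lift (tau_gen N) (coef (ufrac n p s)))) Rn Rd
     (\<lambda>k i. ED n N (free_lift (tau_gen N) (lg k i)))"
    using dra_sys_oscillator[OF diff_sys_ED] by (simp add: free_lift_hom quotval_hom)
  then show "r \<in> dra_rels n \<Longrightarrow> ED n N (free_lift (tau_gen N) r) = 0"
    using dra_rels_iff[OF alg_hom_quotval_lift] by blast
qed

lemma tau_gen_in:
  assumes "g \<in> GL n"
  shows "in_alg (GD n N) (tau_gen N g)"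
proof -
  from assms consider u where "g = Coef u" "u \<in> carrier (Ubar n)"
    | k i where "g = Elt (LGen k i)" "k \<in> {1..n}" "i \<in> {1..n}"
    unfolding hgens_def dra_elts_def by blast
  then show ?thesis
  proof cases
    case 1
    then show ?thesis by simp
  next
    case 2
    show ?thesis
      unfolding 2 tau_gen.simps by (intro in_alg_sum in_alg_intros(7) in_alg_xg in_alg_dg 2)
  qed
qed

lemma tau_residue:
  "in_alg (GL n) p \<Longrightarrow>
    tau n N (residue (GL n) (dra_rels n) p) = residue (GD n N) (diff_rels n N) (free_lift (tau_gen N) p)"
  unfolding tau_def
  by (rule presented_hom(1)[OF dra_rels_closed diff_rels_closed tau_gen_in tau_relators])

lemma tau_hom: "tau n N \<in> ring_hom (Dgl n) (Diff n N)"
  unfolding tau_def Dgl_def Diff_def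
  by (rule presented_hom(2)[OF dra_rels_closed diff_rels_closed tau_gen_in tau_relators])

subsection \<open>The symmetric group on the reduction algebra\<close>

text \<open>The map that sends \<open>\<chi>\<^sub>i\<^bsup>-1\<^esup> L \<chi>\<^sub>k\<close> to the element obtained by applying \<open>\<sigma>\<close> to the indices \<open>i\<close> and \<open>k\<close>.\<close>

fun perm_gen :: "nat \<Rightarrow> (nat \<Rightarrow> nat) \<Rightarrow> ('k::comm_ring_1 ubar, dra_gen) gen \<Rightarrow> (dra_gen, 'k) hfree" where
  "perm_gen n \<sigma> (Coef u) = coef (uperm n \<sigma> u)"
| "perm_gen n \<sigma> (Elt (LGen k i)) =
    coef (ufrac n (hperm \<sigma> (chi n i)) 1) *
    (coef (ufrac n 1 (chi n (\<sigma> i))) * lg (\<sigma> k) (\<sigma> i) * coef (ufrac n (chi n (\<sigma> k)) 1)) *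
    coef (ufrac n 1 (hperm \<sigma> (chi n k)))"

definition perm_map :: "nat \<Rightarrow> (nat \<Rightarrow> nat) \<Rightarrow>
    (dra_gen, 'k::comm_ring_1) hfree set \<Rightarrow> (dra_gen, 'k) hfree set" where
  "perm_map n \<sigma> = induced_map (GL n) (dra_rels n) (perm_gen n \<sigma>)"

lemma perm_relators:
  assumes \<sigma>: "\<sigma> permutes {1..n}" and "r \<in> dra_rels n"
  shows "EL n (free_lift (perm_gen n \<sigma>) r) = 0"
proof -
  have "dra_sys n (\<lambda>c. EL n (free_lift (perm_gen n \<sigma>) (scalar c)))
     (\<lambda>p s. EL n (free_lift (perm_gen n \<sigma>) (coef (ufrac n p s)))) Rn Rd
     (\<lambda>k i. EL n (free_lift (perm_gen n \<sigma>) (lg k i)))"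
    using dra_sys_symmetric[OF dra_sys_EL \<sigma>] by (simp add: free_lift_hom quotval_hom uperm_ufrac_all[OF \<sigma>])
  then show ?thesis
    using dra_rels_iff[OF alg_hom_quotval_lift] assms(2) by blast
qed

lemma perm_gen_in:
  assumes \<sigma>: "\<sigma> permutes {1..n}" and g: "g \<in> GL n"
  shows "in_alg (GL n) (perm_gen n \<sigma> g)"
proof -
  have mem: "\<sigma> i \<in> {1..n}" if "i \<in> {1..n}" for i
    using permutes_in_image[OF \<sigma>] that by blast
  from g consider u where "g = Coef u" "u \<in> carrier (Ubar n)"
    | k i where "g = Elt (LGen k i)" "k \<in> {1..n}" "i \<in> {1..n}"
    unfolding hgens_def dra_elts_def by blast
  then show ?thesis
  proof cases
    case 1
    then show ?thesis using ubar_closed(4)[OF 1(2) \<sigma>] by simp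
  next
    case 2
    show ?thesis
      unfolding 2 perm_gen.simps
      by (intro in_alg_intros(7) in_alg_coef in_alg_lg ufrac_carrier hperm_Den[OF \<sigma>] Pol_intros(2)
          Den_one chi_Den Den_Pol mem 2)
  qed
qed

lemma perm_residue:
  "\<sigma> permutes {1..n} \<Longrightarrow> in_alg (GL n) p \<Longrightarrow>
    perm_map n \<sigma> (residue (GL n) (dra_rels n) p) = residue (GL n) (dra_rels n) (free_lift (perm_gen n \<sigma>) p)"
  unfolding perm_map_def
  by (rule presented_hom(1)[OF dra_rels_closed dra_rels_closed perm_gen_in perm_relators])

lemma perm_hom: "\<sigma> permutes {1..n} \<Longrightarrow> perm_map n \<sigma> \<in> ring_hom (Dgl n) (Dgl n)"
  unfolding perm_map_def Dgl_def
  by (rule presented_hom(2)[OF dra_rels_closed dra_rels_closed perm_gen_in perm_relators])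

lemma carrier_Dgl: "carrier (Dgl n) = residue (GL n) (dra_rels n) ` carrier (free_alg (GL n))"
  unfolding Dgl_def by (rule carrier_presented)

lemma carrier_Diff: "carrier (Diff n N) = residue (GD n N) (diff_rels n N) ` carrier (free_alg (GD n N))"
  unfolding Diff_def by (rule carrier_presented)

lemma hgens_cases:
  assumes "g \<in> hgens n E"
  obtains (Coef) p s where "g = Coef (ufrac n p s)" "p \<in> Pol n" "s \<in> Den n" | (Elt) e where "g = Elt e" "e \<in> E"
  using assms unfolding hgens_def carrier_Ubar by blast

lemma perm_map_closed:
  assumes "\<sigma> permutes {1..n}" "y \<in> carrier (Dgl n)"
  shows "perm_map n \<sigma> y \<in> carrier (Dgl n)"
  using ring_hom_memE(1)[OF perm_hom[OF assms(1)] assms(2)] .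

text \<open>In the composite the factors \<open>\<sigma>(\<chi>)\<close> at the intermediate indices occur together with their inverses.\<close>

lemma perm_map_comp:
  fixes y :: "(dra_gen, 'k::comm_ring_1) hfree set"
  assumes \<sigma>: "\<sigma> permutes {1..n}" and \<tau>: "\<tau> permutes {1..n}" and y: "y \<in> carrier (Dgl n)"
  shows "perm_map n \<sigma> (perm_map n \<tau> y) = perm_map n (\<sigma> \<circ> \<tau>) y"
proof -
  obtain p where p: "in_alg (GL n) p" "y = residue (GL n) (dra_rels n) p"
    using y unfolding carrier_Dgl by blast
  have \<sigma>\<tau>: "\<sigma> \<circ> \<tau> permutes {1..n}" using \<tau> \<sigma> by (rule permutes_compose)
  have mem: "\<sigma> i \<in> {1..n}" "\<tau> i \<in> {1..n}" if "i \<in> {1..n}" for i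
    using permutes_in_image[OF \<sigma>] permutes_in_image[OF \<tau>] that by blast+
  define F where "F = (\<lambda>p s. EL n (coef (ufrac n p s) :: (dra_gen, 'k) hfree))"
  have h: "frac_hom n (\<lambda>c. EL n (scalar c)) F" unfolding F_def by (rule frac_hom_EL)
  have gens: "EL n (free_lift (perm_gen n \<sigma>) (perm_gen n \<tau> g)) = EL n (perm_gen n (\<sigma> \<circ> \<tau>) g)"
    if "g \<in> GL n" for g :: "('k ubar, dra_gen) gen"
    using that
  proof (cases rule: hgens_cases)
    case (Coef p s)
    then show ?thesis
      by (simp add: free_lift_hom uperm_ufrac_all[OF \<sigma>] uperm_ufrac_all[OF \<tau>] uperm_ufrac_all[OF \<sigma>\<tau>] hperm_hperm)
  next
    case (Elt e)
    then obtain k i where e: "e = LGen k i" and ki: "k \<in> {1..n}" "i \<in> {1..n}"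
      unfolding dra_elts_def by blast
    define L where "L = EL n (lg (\<sigma> (\<tau> k)) (\<sigma> (\<tau> i)) :: (dra_gen, 'k) hfree)"
    have L: "F 1 1 * L = L" "L * F 1 1 = L"
      using has_weight_unit[OF has_weight_EL[OF mem(1)[OF mem(2)[OF ki(2)]] mem(1)[OF mem(2)[OF ki(1)]]]]
      unfolding F_def L_def by simp_all
    let ?a = "hperm \<sigma> (hperm \<tau> (chi n i)) :: 'k hpoly" and ?b = "chi n (\<sigma> (\<tau> i)) :: 'k hpoly"
      and ?c = "hperm \<sigma> (chi n (\<tau> i)) :: 'k hpoly"
    let ?a' = "hperm \<sigma> (hperm \<tau> (chi n k)) :: 'k hpoly" and ?b' = "chi n (\<sigma> (\<tau> k)) :: 'k hpoly"
      and ?c' = "hperm \<sigma> (chi n (\<tau> k)) :: 'k hpoly"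
    have den: "?a \<in> Den n" "?b \<in> Den n" "?c \<in> Den n" "?a' \<in> Den n" "?b' \<in> Den n" "?c' \<in> Den n"
      by (intro hperm_Den[OF \<sigma>] hperm_Den[OF \<tau>] chi_Den mem ki)+
    have "EL n (free_lift (perm_gen n \<sigma>) (perm_gen n \<tau> g))
      = F ?a 1 * (F 1 ?c * (F ?c 1 * (F 1 ?b * L * F ?b' 1) * F 1 ?c') * F ?c' 1) * F 1 ?a'"
      unfolding Elt e by (simp add: free_lift_hom uperm_ufrac_all[OF \<sigma>] quotval_hom F_def L_def hperm_hom)
    also have "\<dots> = F ?a 1 * ((F 1 ?c * F ?c 1) * F 1 ?b) * L * (F ?b' 1 * (F 1 ?c' * F ?c' 1)) * F 1 ?a'"
      by (simp only: mult.assoc)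
    also have "F 1 ?c * F ?c 1 = F 1 1"
      using den by (simp add: frac_hom_inverse[OF h])
    also have "F 1 ?c' * F ?c' 1 = F 1 1"
      using den by (simp add: frac_hom_inverse[OF h])
    also have "F 1 1 * F 1 ?b = F 1 ?b" using den by (simp add: frac_hom_unit[OF h])
    also have "F ?b' 1 * F 1 1 = F ?b' 1" using den by (simp add: frac_hom_unit[OF h])
    also have "F ?a 1 * F 1 ?b * L * F ?b' 1 * F 1 ?a' = EL n (perm_gen n (\<sigma> \<circ> \<tau>) g)"
      unfolding Elt e by (simp add: quotval_hom F_def L_def hperm_hperm mult.assoc)
    finally show ?thesis .
  qed
  have lifts: "in_alg (GL n) (free_lift (perm_gen n \<rho>) q)" if "in_alg (GL n) q" "\<rho> permutes {1..n}" for q \<rho>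
    using in_alg_free_lift[OF that(1) perm_gen_in[OF that(2)]] .
  have "perm_map n \<sigma> (perm_map n \<tau> y)
    = residue (GL n) (dra_rels n) (free_lift (perm_gen n \<sigma>) (free_lift (perm_gen n \<tau>) p))"
    using p lifts[OF p(1) \<tau>] by (simp add: perm_residue[OF \<sigma>] perm_residue[OF \<tau>])
  also have "\<dots> = residue (GL n) (dra_rels n) (free_lift (perm_gen n (\<sigma> \<circ> \<tau>)) p)"
  proof (subst residue_eq_iff[OF dra_rels_closed lifts[OF lifts[OF p(1) \<tau>] \<sigma>] lifts[OF p(1) \<sigma>\<tau>]])
    show "EL n (free_lift (perm_gen n \<sigma>) (free_lift (perm_gen n \<tau>) p)) = EL n (free_lift (perm_gen n (\<sigma> \<circ> \<tau>)) p)"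
      unfolding free_lift_comp using p(1) gens by (rule quotval_lift_eqI)
  qed
  also have "\<dots> = perm_map n (\<sigma> \<circ> \<tau>) y"
    using p by (simp add: perm_residue[OF \<sigma>\<tau>])
  finally show ?thesis .
qed

lemma perm_map_id:
  fixes y :: "(dra_gen, 'k::comm_ring_1) hfree set"
  assumes y: "y \<in> carrier (Dgl n)"
  shows "perm_map n id y = y"
proof -
  obtain p where p: "in_alg (GL n) p" "y = residue (GL n) (dra_rels n) p"
    using y unfolding carrier_Dgl by blast
  have id: "id permutes {1..n}" by (rule permutes_id)
  define F where "F = (\<lambda>p s. EL n (coef (ufrac n p s) :: (dra_gen, 'k) hfree))"
  have h: "frac_hom n (\<lambda>c. EL n (scalar c)) F" unfolding F_def by (rule frac_hom_EL)
  have gens: "EL n (perm_gen n id g) = EL n (generator g)"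
    if "g \<in> GL n" for g :: "('k ubar, dra_gen) gen"
    using that
  proof (cases rule: hgens_cases)
    case (Coef p s)
    then show ?thesis by (simp add: uperm_ufrac_all[OF id] hperm_id)
  next
    case (Elt e)
    then obtain k i where e: "e = LGen k i" and ki: "k \<in> {1..n}" "i \<in> {1..n}"
      unfolding dra_elts_def by blast
    define L where "L = EL n (lg k i :: (dra_gen, 'k) hfree)"
    have L: "F 1 1 * L = L" "L * F 1 1 = L"
      using has_weight_unit[OF has_weight_EL[OF ki(2,1)]] unfolding F_def L_def by simp_all
    have den: "chi n i \<in> (Den n :: 'k hpoly set)" "chi n k \<in> (Den n :: 'k hpoly set)" by (intro chi_Den ki)+
    have "EL n (perm_gen n id g) = (F (chi n i) 1 * F 1 (chi n i)) * L * (F (chi n k) 1 * F 1 (chi n k))"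
      unfolding Elt e by (simp add: quotval_hom F_def L_def hperm_id mult.assoc)
    also have "F (chi n i) 1 * F 1 (chi n i) = F 1 1"
      using den by (simp add: frac_hom_inverse[OF h])
    also have "F (chi n k) 1 * F 1 (chi n k) = F 1 1"
      using den by (simp add: frac_hom_inverse[OF h])
    finally have "EL n (perm_gen n id g) = L" by (simp only: L)
    then show ?thesis unfolding L_def Elt e .
  qed
  have "EL n (free_lift (perm_gen n id) p) = EL n (free_lift generator p)"
    using p(1) gens by (rule quotval_lift_eqI)
  also have "free_lift generator p = p"
    using p(1) by (induct rule: free_alg_induct) (simp_all add: free_lift_hom)
  finally have *: "EL n (free_lift (perm_gen n id) p) = EL n p" .
  have "in_alg (GL n) (free_lift (perm_gen n id) p)"
    using p(1) perm_gen_in[OF id] by (rule in_alg_free_lift)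
  from residue_eq_iff[OF dra_rels_closed this p(1)] * show ?thesis
    unfolding p(2) perm_residue[OF id p(1)] by blast
qed

section \<open>The symmetries of the ring of differential operators\<close>

lemma diff_sys_cong:
  assumes "diff_sys n N S F An Ad X D"
    and "\<And>i \<alpha>. i \<in> {1..n} \<Longrightarrow> \<alpha> \<in> {1..N} \<Longrightarrow> X' i \<alpha> = X i \<alpha>"
    and "\<And>i \<alpha>. i \<in> {1..n} \<Longrightarrow> \<alpha> \<in> {1..N} \<Longrightarrow> D' i \<alpha> = D i \<alpha>"
  shows "diff_sys n N S F An Ad X' D'"
  using assms unfolding diff_sys_def xx_rel_def dd_rel_def xd_rel_def
  by (simp cong: sum.cong del: atLeastAtMost_iff)

lemma frac_hom_uminus:
  assumes "frac_hom n S F" "p \<in> Pol n" "s \<in> Den n"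
  shows "F (- p) s = - F p s"
proof -
  have "F p s + F (- p) s = F 0 (s * s)"
    using hrepD(2)[OF assms(1), of p "- p" s s] assms by simp
  then show ?thesis
    using frac_hom_zero[OF assms(1), of "s * s"] assms(3) by (simp add: eq_neg_iff_add_eq_0 add.commute)
qed

context
  fixes n i :: nat
  assumes i: "i \<in> {1..<n}"
begin

abbreviation (input) "si \<equiv> transpose i (i + 1)"

lemma i_mem: "i \<in> {1..n}" "i + 1 \<in> {1..n}"
  using i by auto

lemma si_permutes: "si permutes {1..n}"
  by (rule permutes_swap_id[OF i_mem])

lemma hd_Den: "(hdiff i (i + 1) :: 'k::comm_ring_1 hpoly) \<in> Den n" "(hdiff i (i + 1) - 1 :: 'k hpoly) \<in> Den n"
  "(hdiff i (i + 1) + 1 :: 'k hpoly) \<in> Den n" "(- hdiff i (i + 1) :: 'k hpoly) \<in> Den n"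
proof -
  have "(- hdiff i (i + 1) :: 'k hpoly) = hdiff (i + 1) i" by (simp add: hdiff_def)
  then show "(- hdiff i (i + 1) :: 'k hpoly) \<in> Den n" using Den_hdiff(1)[OF i_mem(2,1)] by simp
qed (use Den_hdiff[OF i_mem] in simp_all)

text \<open>The products \<open>\<chi>\<^sub>i\<close> and \<open>\<chi>\<^bsub>i + 1\<^esub>\<close> are exchanged up to the factor indexed by the pair \<open>i, i + 1\<close>; all
others are symmetric in \<open>h\<^sub>i\<close> and \<open>h\<^bsub>i + 1\<^esub>\<close> or do not contain them.\<close>

lemma hperm_si_chi:
  "hperm si (chi n i) = - (hdiff i (i + 1) + 1) * (chi n (i + 1) :: 'k::comm_ring_1 hpoly)"
  "chi n i = (hdiff i (i + 1) - 1) * (hperm si (chi n (i + 1)) :: 'k hpoly)"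
  "j \<noteq> i \<Longrightarrow> j \<noteq> i + 1 \<Longrightarrow> hperm si (chi n j) = (chi n j :: 'k hpoly)"
proof -
  have ins: "{i<..n} = insert (i + 1) {i + 1<..n}" using i by auto
  have rest: "si k = k" if "k \<in> {i + 1<..n}" for k using that by (simp add: transpose_def)
  have neg: "hdiff (i + 1) i - 1 = (- (hdiff i (i + 1) + 1) :: 'k hpoly)" by (simp add: hdiff_def)
  show "hperm si (chi n i) = - (hdiff i (i + 1) + 1) * (chi n (i + 1) :: 'k hpoly)"
    unfolding chi_def ins neg[symmetric] using rest by (simp add: hperm_hom hperm_hdiff)
  show "chi n i = (hdiff i (i + 1) - 1) * (hperm si (chi n (i + 1)) :: 'k hpoly)"
    unfolding chi_def ins using rest by (simp add: hperm_hom hperm_hdiff)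
  assume j: "j \<noteq> i" "j \<noteq> i + 1"
  then have sj: "si j = j" by (simp add: transpose_def)
  have e: "hperm si (chi n j) = (\<Prod>k\<in>{j<..n}. hdiff j (si k) - 1 :: 'k hpoly)"
    unfolding chi_def by (simp only: hperm_hom hperm_hdiff sj)
  show "hperm si (chi n j) = (chi n j :: 'k hpoly)"
  proof (cases "j < i")
    case True
    then have "si permutes {j<..n}" using i by (intro permutes_swap_id) auto
    from prod.permute[OF this, of "\<lambda>k. hdiff j k - 1 :: 'k hpoly"] show ?thesis
      unfolding e unfolding chi_def by (simp only: comp_def)
  next
    case False
    then have "si k = k" if "k \<in> {j<..n}" for k using that j by (simp add: transpose_def)
    then show ?thesis unfolding e unfolding chi_def by (intro prod.cong refl) simp
  qed
qed

lemma sh_hd: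
  "sh (i + 1) (hdiff i (i + 1)) = (hdiff i (i + 1) + 1 :: 'k::comm_ring_1 hpoly)"
  "sh i (hdiff i (i + 1)) = (hdiff i (i + 1) - 1 :: 'k hpoly)"
  by (simp_all add: hshift_hdiff eps_def)

text \<open>The given formulas for \<open>s\<^sub>i\<close> are the relabelling of the modified generators, expressed in the
original ones: the ratios \<open>s\<^sub>i(\<chi>\<^sub>j) / \<chi>\<^bsub>s\<^sub>i(j)\<^esub>\<close> reduce to \<open>-(h\<^bsub>i,i+1\<^esub> + 1)\<close> for \<open>j = i\<close>, to
\<open>1 / (h\<^bsub>i,i+1\<^esub> - 1)\<close> for \<open>j = i + 1\<close> and to \<open>1\<close> otherwise, and moving them (for \<open>\<partial>\<close>, their
reciprocals) to the other side of the generator shifts \<open>h\<^bsub>i,i+1\<^esub> \<plusminus> 1\<close> to \<open>h\<^bsub>i,i+1\<^esub>\<close>.\<close>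

lemma diff_s_gen_gauge:
  fixes N :: nat
  defines "F \<equiv> (\<lambda>p s. ED n N (coef (ufrac n p s) :: (diff_gen, 'k::comm_ring_1) hfree))"
  assumes j: "j \<in> {1..n}" and \<alpha>: "\<alpha> \<in> {1..N}"
  shows "ED n N (diff_s_gen n i (Elt (XGen j \<alpha>)))
      = F (hperm si (chi n j)) 1 * (F 1 (chi n (si j)) * ED n N (xg (si j) \<alpha>))"
    and "ED n N (diff_s_gen n i (Elt (DGen j \<alpha>)))
      = ED n N (dg (si j) \<alpha>) * F (chi n (si j)) 1 * F 1 (hperm si (chi n j))"
proof -
  define X where "X = (\<lambda>j. ED n N (xg j \<alpha> :: (diff_gen, 'k) hfree))"
  define D where "D = (\<lambda>j. ED n N (dg j \<alpha> :: (diff_gen, 'k) hfree))"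
  let ?H = "hdiff i (i + 1) :: 'k hpoly"
  have h: "frac_hom n (\<lambda>c. ED n N (scalar c)) F" unfolding F_def by (rule frac_hom_ED)
  have wX: "has_weight n F (eps j) (X j)" and wD: "has_weight n F (\<lambda>l. - eps j l) (D j)" if "j \<in> {1..n}" for j
    using has_weight_ED[OF that \<alpha>] unfolding F_def X_def D_def by blast+
  have Xc: "X j * F p s = F (sh j p) (sh j s) * X j" if "j \<in> {1..n}" "p \<in> Den n" "s \<in> Den n" for j p s
    using has_weight_X[OF wX] that by simp
  have Dc: "F p s * D j = D j * F (sh j p) (sh j s)" if "j \<in> {1..n}" "p \<in> Den n" "s \<in> Den n" for j p s
    using wD that unfolding has_weight_def by simp
  have chi_in: "(chi n j :: 'k hpoly) \<in> Den n" "(hperm si (chi n j) :: 'k hpoly) \<in> Den n" if "j \<in> {1..n}" for j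
    using that hperm_Den[OF si_permutes] chi_Den by blast+
  have FF: "F p 1 * F 1 s = F p s" "F s 1 * F 1 q = F s q" if "p \<in> Den n" "s \<in> Den n" "q \<in> Den n" for p q s
    using hrepD(1)[OF h, of _ 1 1] that by simp_all
  note hd = hd_Den[where 'k='k]
  have sii: "si i = i + 1" "si (i + 1) = i" by simp_all
  have other: "si j = j" if "j \<noteq> i" "j \<noteq> i + 1" for j using that by (simp add: transpose_def)
  consider "j = i" | "j = i + 1" | "j \<noteq> i" "j \<noteq> i + 1" by blast
  then have "ED n N (diff_s_gen n i (Elt (XGen j \<alpha>))) = F (hperm si (chi n j)) (chi n (si j)) * X (si j) \<and>
    ED n N (diff_s_gen n i (Elt (DGen j \<alpha>))) = D (si j) * F (chi n (si j)) (hperm si (chi n j))"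
  proof cases
    case 1
    have "F (hperm si (chi n i)) (chi n (i + 1)) = F (- (?H + 1)) 1"
      by (rule hrepD(3)[OF h Den_Pol[OF chi_in(2)[OF i_mem(1)]] Pol_intros(3)[OF Den_Pol[OF hd(3)]]
            chi_in(1)[OF i_mem(2)] Den_one])
        (simp only: hperm_si_chi(1) mult_1_right)
    then have a: "F (hperm si (chi n i)) (chi n (i + 1)) = - F (?H + 1) 1"
      using frac_hom_uminus[OF h Den_Pol[OF hd(3)] Den_one] by simp
    have "F (chi n (i + 1)) (hperm si (chi n i)) = F (- 1) (?H + 1)"
    proof (rule hrepD(3)[OF h Den_Pol[OF chi_in(1)[OF i_mem(2)]] Pol_intros(3)[OF Pol_intros(2)]
            chi_in(2)[OF i_mem(1)] hd(3)])
      show "chi n (i + 1) * (?H + 1) = - 1 * hperm si (chi n i)"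
        unfolding hperm_si_chi(1) by (simp add: algebra_simps)
    qed
    then have b: "F (chi n (i + 1)) (hperm si (chi n i)) = - F 1 (?H + 1)"
      using frac_hom_uminus[OF h Pol_intros(2) hd(3)] by simp
    have "ED n N (diff_s_gen n i (Elt (XGen j \<alpha>))) = - (X (i + 1) * F ?H 1)"
      using 1 by (simp add: quotval_hom X_def F_def)
    moreover have "ED n N (diff_s_gen n i (Elt (DGen j \<alpha>))) = - (F 1 ?H * D (i + 1))"
      using 1 by (simp add: quotval_hom D_def F_def)
    ultimately show ?thesis
      using 1 a b Xc[OF i_mem(2) hd(1) Den_one] Dc[OF i_mem(2) Den_one hd(1)] sh_hd(1)[where 'k='k]
      by (simp add: sii hshift_hom)
  next
    case 2
    have a: "F (hperm si (chi n (i + 1))) (chi n i) = F 1 (?H - 1)"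
      using chi_in[OF i_mem(1)] chi_in[OF i_mem(2)] hd
      by (intro hrepD(3)[OF h] Den_Pol Den_one) (simp_all add: hperm_si_chi(2) mult.commute)
    have b: "F (chi n i) (hperm si (chi n (i + 1))) = F (?H - 1) 1"
      using chi_in[OF i_mem(1)] chi_in[OF i_mem(2)] hd
      by (intro hrepD(3)[OF h] Den_Pol Den_one) (simp_all add: hperm_si_chi(2) mult.commute)
    have "ED n N (diff_s_gen n i (Elt (XGen j \<alpha>))) = X i * F 1 ?H"
      using 2 by (simp add: quotval_hom X_def F_def)
    moreover have "ED n N (diff_s_gen n i (Elt (DGen j \<alpha>))) = F ?H 1 * D i"
      using 2 by (simp add: quotval_hom D_def F_def)
    ultimately show ?thesis
      using 2 a b Xc[OF i_mem(1) Den_one hd(1)] Dc[OF i_mem(1) hd(1) Den_one] sh_hd(2)[where 'k='k]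
      by (simp add: sii hshift_hom)
  next
    case 3
    have "F (chi n j) (chi n j) = F 1 1"
      using chi_in[OF j] by (intro hrepD(3)[OF h] Den_Pol Den_one) simp_all
    then show ?thesis
      using 3 has_weight_unit[OF wX[OF j]] has_weight_unit[OF wD[OF j]] other hperm_si_chi(3)[OF 3, where 'k='k]
      by (simp add: X_def D_def)
  qed
  moreover have "si j \<in> {1..n}" using permutes_in_image[OF si_permutes] j by blast
  ultimately show "ED n N (diff_s_gen n i (Elt (XGen j \<alpha>)))
      = F (hperm si (chi n j)) 1 * (F 1 (chi n (si j)) * ED n N (xg (si j) \<alpha>))"
    "ED n N (diff_s_gen n i (Elt (DGen j \<alpha>)))
      = ED n N (dg (si j) \<alpha>) * F (chi n (si j)) 1 * F 1 (hperm si (chi n j))"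
    using FF(1)[OF chi_in(2)[OF j] chi_in(1) Den_one] FF(1)[OF chi_in(1) chi_in(2)[OF j] Den_one]
    by (simp_all add: X_def D_def mult.assoc[symmetric]) (simp add: mult.assoc)
qed

lemma diff_s_relators:
  assumes "r \<in> diff_rels n N"
  shows "ED n N (free_lift (diff_s_gen n i) r) = 0"
proof -
  have "diff_sys n N (\<lambda>c. ED n N (free_lift (diff_s_gen n i) (scalar c)))
     (\<lambda>p s. ED n N (free_lift (diff_s_gen n i) (coef (ufrac n p s)))) Rn Rd
     (\<lambda>j \<alpha>. ED n N (free_lift (diff_s_gen n i) (xg j \<alpha>)))
     (\<lambda>j \<alpha>. ED n N (free_lift (diff_s_gen n i) (dg j \<alpha>)))"
  proof (rule diff_sys_cong)
    let ?F = "\<lambda>p s. ED n N (coef (ufrac n p s))"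
    show "diff_sys n N (\<lambda>c. ED n N (free_lift (diff_s_gen n i) (scalar c)))
     (\<lambda>p s. ED n N (free_lift (diff_s_gen n i) (coef (ufrac n p s)))) Rn Rd
     (\<lambda>j \<alpha>. ?F (hperm si (chi n j)) 1 * (?F 1 (chi n (si j)) * ED n N (xg (si j) \<alpha>)))
     (\<lambda>j \<alpha>. ED n N (dg (si j) \<alpha>) * ?F (chi n (si j)) 1 * ?F 1 (hperm si (chi n j)))"
      unfolding free_lift_hom diff_s_gen.simps(1) uperm_ufrac_all[OF si_permutes]
      by (rule diff_sys_symmetric[OF diff_sys_ED si_permutes])
  qed (simp_all only: free_lift_hom diff_s_gen_gauge)
  then show ?thesis
    using diff_rels_iff[OF alg_hom_quotval_lift] assms by blast
qed

lemma diff_s_gen_in: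
  assumes "(g :: ('a::comm_ring_1 ubar, diff_gen) gen) \<in> GD n N"
  shows "in_alg (GD n N) (diff_s_gen n i g)"
proof -
  have if_in: "in_alg (GD n N) (if b then p else q)"
    if "b \<Longrightarrow> in_alg (GD n N) p" "\<not> b \<Longrightarrow> in_alg (GD n N) q" for b and p q :: "(diff_gen, 'a) hfree"
    using that by simp
  note intros = if_in in_alg_intros(4,7) in_alg_xg in_alg_dg in_alg_coef ufrac_carrier Den_one Pol_intros(2)
    hd_Den(1) Den_Pol i_mem
  from assms consider u where "g = Coef u" "u \<in> carrier (Ubar n)"
    | j \<alpha> where "g = Elt (XGen j \<alpha>)" "j \<in> {1..n}" "\<alpha> \<in> {1..N}"
    | j \<alpha> where "g = Elt (DGen j \<alpha>)" "j \<in> {1..n}" "\<alpha> \<in> {1..N}"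
    unfolding hgens_def diff_elts_def by blast
  then show ?thesis
  proof cases
    case 1
    then show ?thesis using ubar_closed(4)[OF 1(2) si_permutes] by simp
  next
    case 2
    show ?thesis unfolding 2 diff_s_gen.simps by (intro intros 2(2,3))
  next
    case 3
    show ?thesis unfolding 3 diff_s_gen.simps by (intro intros 3(2,3))
  qed
qed

lemma diff_s_residue:
  "in_alg (GD n N) p \<Longrightarrow>
    diff_s n N i (residue (GD n N) (diff_rels n N) p) = residue (GD n N) (diff_rels n N) (free_lift (diff_s_gen n i) p)"
  unfolding diff_s_def
  by (rule presented_hom(1)[OF diff_rels_closed diff_rels_closed diff_s_gen_in diff_s_relators])

lemma diff_s_hom: "diff_s n N i \<in> ring_hom (Diff n N) (Diff n N)"
  unfolding diff_s_def Diff_def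
  by (rule presented_hom(2)[OF diff_rels_closed diff_rels_closed diff_s_gen_in diff_s_relators])

lemma in_alg_diff_s: "in_alg (GD n N) p \<Longrightarrow> in_alg (GD n N) (free_lift (diff_s_gen n i) p)"
  by (rule in_alg_free_lift[OF _ diff_s_gen_in])

lemma diff_s_involution:
  fixes y :: "(diff_gen, 'k::comm_ring_1) hfree set"
  assumes y: "y \<in> carrier (Diff n N)"
  shows "diff_s n N i (diff_s n N i y) = y"
proof -
  obtain p where p: "in_alg (GD n N) p" "y = residue (GD n N) (diff_rels n N) p"
    using y unfolding carrier_Diff by blast
  define F where "F = (\<lambda>p s. ED n N (coef (ufrac n p s) :: (diff_gen, 'k) hfree))"
  have h: "frac_hom n (\<lambda>c. ED n N (scalar c)) F" unfolding F_def by (rule frac_hom_ED)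
  let ?H = "hdiff i (i + 1) :: 'k hpoly"
  note hd = hd_Den[where 'k='k]
  have neg: "F (- ?H) 1 = - F ?H 1" "F 1 (- ?H) = - F 1 ?H"
  proof -
    show "F (- ?H) 1 = - F ?H 1" using hd by (intro frac_hom_uminus[OF h]) simp_all
    have "F 1 (- ?H) = F (- 1) ?H" using hd by (intro hrepD(3)[OF h]) simp_all
    then show "F 1 (- ?H) = - F 1 ?H" using hd frac_hom_uminus[OF h, of 1 ?H] by simp
  qed
  have prmH: "hperm si ?H = - ?H" by (simp add: hperm_hdiff) (simp add: hdiff_def)
  have prm1: "hperm si 1 = (1 :: 'k hpoly)" by (simp add: hperm_hom)
  note inv = frac_hom_inverse[OF h hd(1)]
  note up = uperm_ufrac_all[OF si_permutes]
  have upH: "uperm n si (ufrac n ?H 1) = ufrac n (- ?H) 1" "uperm n si (ufrac n 1 ?H) = ufrac n 1 (- ?H)"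
    by (simp_all only: up prmH prm1)
  note neg_inv = neg[unfolded Suc_eq_plus1[symmetric]] inv[unfolded Suc_eq_plus1[symmetric]]
  have gens: "ED n N (free_lift (diff_s_gen n i) (diff_s_gen n i g)) = ED n N (generator g)"
    if "g \<in> GD n N" for g :: "('k ubar, diff_gen) gen"
    using that
  proof (cases rule: hgens_cases)
    case (Coef p s)
    have "hperm si (hperm si q) = q" for q :: "'k hpoly" by (simp add: hperm_hperm hperm_id)
    then show ?thesis unfolding Coef by (simp only: diff_s_gen.simps free_lift_hom up)
  next
    case (Elt e)
    from Elt(2) consider j \<alpha> where "e = XGen j \<alpha>" "j \<in> {1..n}" "\<alpha> \<in> {1..N}"
      | j \<alpha> where "e = DGen j \<alpha>" "j \<in> {1..n}" "\<alpha> \<in> {1..N}"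
      unfolding diff_elts_def by blast
    then show ?thesis
    proof cases
      case (1 j \<alpha>)
      define X where "X = (\<lambda>j. ED n N (xg j \<alpha> :: (diff_gen, 'k) hfree))"
      have X: "X j * F 1 1 = X j"
        using has_weight_unit(2)[OF has_weight_ED(1)[OF 1(2,3)]] unfolding F_def X_def by blast
      have a: "ED n N (free_lift (diff_s_gen n i) (diff_s_gen n i g)) = - (X i * F 1 ?H * F (- ?H) 1)" if "j = i"
        unfolding Elt 1 using that by (simp add: free_lift_hom quotval_hom X_def F_def upH[unfolded Suc_eq_plus1[symmetric]])
      have b: "ED n N (free_lift (diff_s_gen n i) (diff_s_gen n i g)) = - (X (i + 1) * F ?H 1) * F 1 (- ?H)" if "j = i + 1"
        unfolding Elt 1 using that by (simp add: free_lift_hom quotval_hom X_def F_def upH[unfolded Suc_eq_plus1[symmetric]])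
      have c: "ED n N (free_lift (diff_s_gen n i) (diff_s_gen n i g)) = X j" if "j \<noteq> i" "j \<noteq> i + 1"
        unfolding Elt 1 using that by (simp add: free_lift_hom X_def)
      have "ED n N (free_lift (diff_s_gen n i) (diff_s_gen n i g)) = X j"
        using a b c X by (cases "j = i"; cases "j = i + 1") (simp_all add: mult.assoc neg_inv)
      then show ?thesis unfolding X_def Elt 1 .
    next
      case (2 j \<alpha>)
      define D where "D = (\<lambda>j. ED n N (dg j \<alpha> :: (diff_gen, 'k) hfree))"
      have D: "F 1 1 * D j = D j"
        using has_weight_unit(1)[OF has_weight_ED(2)[OF 2(2,3)]] unfolding F_def D_def by blast
      have a: "ED n N (free_lift (diff_s_gen n i) (diff_s_gen n i g)) = - (F 1 (- ?H) * (F ?H 1 * D i))" if "j = i"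
        unfolding Elt 2 using that by (simp add: free_lift_hom quotval_hom D_def F_def upH[unfolded Suc_eq_plus1[symmetric]])
      have b: "ED n N (free_lift (diff_s_gen n i) (diff_s_gen n i g)) = F (- ?H) 1 * - (F 1 ?H * D (i + 1))" if "j = i + 1"
        unfolding Elt 2 using that by (simp add: free_lift_hom quotval_hom D_def F_def upH[unfolded Suc_eq_plus1[symmetric]])
      have c: "ED n N (free_lift (diff_s_gen n i) (diff_s_gen n i g)) = D j" if "j \<noteq> i" "j \<noteq> i + 1"
        unfolding Elt 2 using that by (simp add: free_lift_hom D_def)
      have "ED n N (free_lift (diff_s_gen n i) (diff_s_gen n i g)) = D j"
        using a b c D by (cases "j = i"; cases "j = i + 1") (simp_all add: mult.assoc[symmetric] neg_inv)
      then show ?thesis unfolding D_def Elt 2 .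
    qed
  qed
  have "ED n N (free_lift (diff_s_gen n i) (free_lift (diff_s_gen n i) p)) = ED n N (free_lift generator p)"
    unfolding free_lift_comp using p(1) gens by (rule quotval_lift_eqI)
  also have "free_lift generator p = p"
    using p(1) by (induct rule: free_alg_induct) (simp_all add: free_lift_hom)
  finally have "residue (GD n N) (diff_rels n N) (free_lift (diff_s_gen n i) (free_lift (diff_s_gen n i) p))
      = residue (GD n N) (diff_rels n N) p"
    using residue_eq_iff[OF diff_rels_closed in_alg_diff_s[OF in_alg_diff_s[OF p(1)]] p(1)] by blast
  then show ?thesis
    unfolding p(2) diff_s_residue[OF p(1)] diff_s_residue[OF in_alg_diff_s[OF p(1)]] .
qed

lemma diff_s_iso: "diff_s n N i \<in> ring_iso (Diff n N) (Diff n N)"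
proof -
  have "bij_betw (diff_s n N i) (carrier (Diff n N)) (carrier (Diff n N))"
    using ring_hom_memE(1)[OF diff_s_hom]
    by (intro bij_betw_byWitness[where f'="diff_s n N i"]) (auto simp: diff_s_involution)
  then show ?thesis
    unfolding ring_iso_def using diff_s_hom by blast
qed

lemma tau_perm_map:
  fixes y :: "(dra_gen, 'k::comm_ring_1) hfree set"
  assumes y: "y \<in> carrier (Dgl n)"
  shows "tau n N (perm_map n si y) = diff_s n N i (tau n N y)"
proof -
  obtain p where p: "in_alg (GL n) p" "y = residue (GL n) (dra_rels n) p"
    using y unfolding carrier_Dgl by blast
  define F where "F = (\<lambda>p s. ED n N (coef (ufrac n p s) :: (diff_gen, 'k) hfree))"
  have gens: "ED n N (free_lift (tau_gen N) (perm_gen n si g)) = ED n N (free_lift (diff_s_gen n i) (tau_gen N g))"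
    if "g \<in> GL n" for g :: "('k ubar, dra_gen) gen"
    using that
  proof (cases rule: hgens_cases)
    case (Coef p s)
    then show ?thesis by (simp add: free_lift_hom)
  next
    case (Elt e)
    then obtain k j where e: "e = LGen k j" and kj: "k \<in> {1..n}" "j \<in> {1..n}"
      unfolding dra_elts_def by blast
    let ?a = "F (hperm si (chi n j)) 1" and ?b = "F 1 (chi n (si j))"
    let ?c = "F (chi n (si k)) 1" and ?d = "F 1 (hperm si (chi n k))"
    have "ED n N (free_lift (tau_gen N) (perm_gen n si g))
      = ?a * (?b * (\<Sum>\<alpha>\<in>{1..N}. ED n N (xg (si j) \<alpha>) * ED n N (dg (si k) \<alpha>)) * ?c) * ?d"
      unfolding Elt e by (simp add: free_lift_hom quotval_hom F_def)
    also have "\<dots> = (\<Sum>\<alpha>\<in>{1..N}. (?a * (?b * ED n N (xg (si j) \<alpha>))) * (ED n N (dg (si k) \<alpha>) * ?c * ?d))"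
      by (simp add: sum_distrib_left sum_distrib_right mult.assoc)
    also have "\<dots> = (\<Sum>\<alpha>\<in>{1..N}. ED n N (diff_s_gen n i (Elt (XGen j \<alpha>))) * ED n N (diff_s_gen n i (Elt (DGen k \<alpha>))))"
      using diff_s_gen_gauge[OF kj(2), where N=N and 'k='k] diff_s_gen_gauge[OF kj(1), where N=N and 'k='k]
      unfolding F_def by (intro sum.cong refl) (simp only:)
    also have "\<dots> = ED n N (free_lift (diff_s_gen n i) (tau_gen N g))"
      unfolding Elt e tau_gen.simps by (simp only: free_lift_hom quotval_hom)
    finally show ?thesis .
  qed
  have in1: "in_alg (GL n) (free_lift (perm_gen n si) p)"
    using p(1) perm_gen_in[OF si_permutes] by (rule in_alg_free_lift)
  have in2: "in_alg (GD n N) (free_lift (tau_gen N) q)" if "in_alg (GL n) q" for q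
    using that tau_gen_in by (rule in_alg_free_lift)
  have "ED n N (free_lift (tau_gen N) (free_lift (perm_gen n si) p))
      = ED n N (free_lift (diff_s_gen n i) (free_lift (tau_gen N) p))"
    unfolding free_lift_comp using p(1) gens by (rule quotval_lift_eqI)
  then show ?thesis
    unfolding p(2) perm_residue[OF si_permutes p(1)] tau_residue[OF in1] tau_residue[OF p(1)] diff_s_residue[OF in2[OF p(1)]]
    using residue_eq_iff[OF diff_rels_closed in2[OF in1] in_alg_diff_s[OF in2[OF p(1)]]] by blast
qed

lemma tau_image_invariant:
  "diff_s n N i ` (tau n N ` carrier (Dgl n :: (dra_gen, 'k::comm_ring_1) hfree set ring)) = tau n N ` carrier (Dgl n)"
proof -
  have inv: "perm_map n si (perm_map n si y) = y" if "y \<in> carrier (Dgl n)"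
    for y :: "(dra_gen, 'k) hfree set"
    using perm_map_comp[OF si_permutes si_permutes that] perm_map_id[OF that] by simp
  have "perm_map n si ` carrier (Dgl n :: (dra_gen, 'k) hfree set ring) = carrier (Dgl n)"
  proof
    show "perm_map n si ` carrier (Dgl n :: (dra_gen, 'k) hfree set ring) \<subseteq> carrier (Dgl n)"
      using perm_map_closed[OF si_permutes] by blast
    show "carrier (Dgl n :: (dra_gen, 'k) hfree set ring) \<subseteq> perm_map n si ` carrier (Dgl n)"
    proof
      fix y :: "(dra_gen, 'k) hfree set" assume y: "y \<in> carrier (Dgl n)"
      show "y \<in> perm_map n si ` carrier (Dgl n)"
        using inv[OF y, symmetric] perm_map_closed[OF si_permutes y] by (rule image_eqI)
    qed
  qed
  then have "tau n N ` carrier (Dgl n :: (dra_gen, 'k) hfree set ring)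
    = (\<lambda>y. tau n N (perm_map n si y)) ` carrier (Dgl n)"
    by (metis image_image)
  also have "\<dots> = diff_s n N i ` (tau n N ` carrier (Dgl n))"
    unfolding image_image using tau_perm_map by (intro image_cong) auto
  finally show ?thesis ..
qed

end

section \<open>The action of the symmetric group\<close>

lemma perm_map_iso:
  assumes \<sigma>: "\<sigma> permutes {1..n}"
  shows "perm_map n \<sigma> \<in> ring_iso (Dgl n) (Dgl n :: (dra_gen, 'k::comm_ring_1) hfree set ring)"
proof -
  have inv: "perm_map n \<tau> (perm_map n \<sigma> y) = y" if "\<sigma> permutes {1..n}" "\<tau> permutes {1..n}" "\<tau> \<circ> \<sigma> = id"
    "y \<in> carrier (Dgl n)" for y :: "(dra_gen, 'k) hfree set" and \<sigma> \<tau>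
    using perm_map_comp[OF that(2,1,4)] perm_map_id[OF that(4)] that(3) by simp
  let ?\<tau> = "inv_into UNIV \<sigma>"
  note \<tau> = permutes_inv[OF \<sigma>]
  have "bij_betw (perm_map n \<sigma>) (carrier (Dgl n :: (dra_gen, 'k) hfree set ring)) (carrier (Dgl n))"
    using perm_map_closed[OF \<sigma>] perm_map_closed[OF \<tau>]
      inv[OF \<sigma> \<tau> permutes_inv_o(2)[OF \<sigma>]] inv[OF \<tau> \<sigma> permutes_inv_o(1)[OF \<sigma>]]
    by (intro bij_betw_byWitness[where f'="perm_map n ?\<tau>"]) auto
  then show ?thesis
    unfolding ring_iso_def using perm_hom[OF \<sigma>] by blast
qed

lemma ring_iso_restrict_carrier:
  assumes "ring R" "h \<in> ring_iso R S"
  shows "restrict h (carrier R) \<in> ring_iso R S"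
  using ring.ring_iso_restrict[OF assms] by simp

lemma ring_Dgl: "ring (Dgl n)"
  unfolding Dgl_def presented_def
  by (rule ideal.quotient_is_ring[OF rel_ideal_ideal[OF dra_rels_closed]])

lemma perm_map_action:
  "group_action (sym_group n) (carrier (Dgl n :: (dra_gen, 'k::comm_ring_1) hfree set ring))
     (\<lambda>\<sigma>. restrict (perm_map n \<sigma>) (carrier (Dgl n)))"
proof -
  let ?C = "carrier (Dgl n :: (dra_gen, 'k) hfree set ring)"
  let ?\<phi> = "\<lambda>\<sigma>. restrict (perm_map n \<sigma>) ?C"
  have Bij: "?\<phi> \<sigma> \<in> Bij ?C" if "\<sigma> permutes {1..n}" for \<sigma>
    using perm_map_iso[OF that] unfolding ring_iso_def Bij_def
    by (auto simp: bij_betw_def inj_on_def)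
  have comp: "?\<phi> (\<sigma> \<circ> \<tau>) = compose ?C (?\<phi> \<sigma>) (?\<phi> \<tau>)" if "\<sigma> permutes {1..n}" "\<tau> permutes {1..n}" for \<sigma> \<tau>
  proof
    fix y :: "(dra_gen, 'k) hfree set"
    show "?\<phi> (\<sigma> \<circ> \<tau>) y = compose ?C (?\<phi> \<sigma>) (?\<phi> \<tau>) y"
      by (cases "y \<in> ?C") (simp_all add: compose_def perm_map_comp[OF that] perm_map_closed[OF that(2)])
  qed
  have "?\<phi> \<in> hom (sym_group n) (BijGroup ?C)"
    using Bij comp by (intro homI) (auto simp: BijGroup_def sym_group_def)
  then have "group_hom (sym_group n) (BijGroup ?C) ?\<phi>"
    by (simp add: group_hom_def group_hom_axioms_def sym_group_is_group group_BijGroup)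
  then show ?thesis
    by (rule group_action.intro)
qed

theorem mainTheorem6:
  fixes n :: nat
  assumes "n \<ge> 1"
  shows
    "(\<forall>N\<ge>1. tau n N \<in> ring_hom
        (Dgl n :: (dra_gen, 'k::{comm_ring_1, ring_char_0}) hfree set ring) (Diff n N)) \<and>
     (\<forall>N\<ge>1. \<forall>i\<in>{1..<n}. diff_s n N i \<in> ring_iso
        (Diff n N :: (diff_gen, 'k) hfree set ring) (Diff n N)) \<and>
     (\<forall>N\<ge>1. \<forall>i\<in>{1..<n}.
        diff_s n N i ` (tau n N ` carrier (Dgl n :: (dra_gen, 'k) hfree set ring))
          = tau n N ` carrier (Dgl n)) \<and>
     (\<exists>\<phi>. group_action (sym_group n) (carrier (Dgl n :: (dra_gen, 'k) hfree set ring)) \<phi> \<and>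
        (\<forall>\<sigma>\<in>carrier (sym_group n). \<phi> \<sigma> \<in> ring_iso (Dgl n) (Dgl n)) \<and>
        (\<forall>N\<ge>1. \<forall>i\<in>{1..<n}. \<forall>y\<in>carrier (Dgl n).
           tau n N (\<phi> (transpose i (i + 1)) y) = diff_s n N i (tau n N y)))"
proof (intro conjI allI impI ballI exI)
  let ?\<phi> = "\<lambda>\<sigma>. restrict (perm_map n \<sigma>) (carrier (Dgl n :: (dra_gen, 'k) hfree set ring))"
  show "group_action (sym_group n) (carrier (Dgl n :: (dra_gen, 'k) hfree set ring)) ?\<phi>"
    by (rule perm_map_action)
  fix \<sigma> assume "\<sigma> \<in> carrier (sym_group n)"
  then show "?\<phi> \<sigma> \<in> ring_iso (Dgl n) (Dgl n)"
    using ring_iso_restrict_carrier[OF ring_Dgl perm_map_iso] by (simp add: sym_group_carrier)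
qed (simp_all only: tau_hom diff_s_iso tau_image_invariant tau_perm_map restrict_apply if_True)

end
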